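(* Let $1\le p<p'$ be coprime integers, let $a,b\in\mathcal T\cup\mathcal T'$, let $c$ be the integer determined by $b$ as specified in the context, and let $L\ge 0$ be an integer with $L\equiv a-b\pmod 2$. Then, with $t,\boldsymbol u^L,\boldsymbol u^R,\boldsymbol Q,\boldsymbol C,\hat{\boldsymbol C},\gamma$ and the modified Gaussian $\left[{A\atop B}\right]'_q$ as defined in the context, $$ \chi^{p,p'}_{a,b,c}(L)=\sum_{\boldsymbol m\equiv \boldsymbol Q(\boldsymbol u^L+\boldsymbol u^R)} q^{\frac14\hat{\boldsymbol m}^T\boldsymbol C\hat{\boldsymbol m}-\frac14L^2-\frac12(\boldsymbol u^{L\flat}+\boldsymbol u^{R\sharp})\cdot\boldsymbol m+\frac14\gamma}\prod_{j=1}^{t-1}\left[{m_j-\frac12(\hat{\boldsymbol C}\hat{\boldsymbol m}-\boldsymbol u^L-\boldsymbol u^R)_j\atop m_j}\right]'_q . $$ Here, with $\boldsymbol Q(\boldsymbol u^L+\boldsymbol u^R)=(Q_1,\dots,Q_{t-1})$, the sum is over all $\boldsymbol m=(m_1,\dots,m_{t-1})$ with $m_j\in\mathbb Z_{\ge0}$ and $m_j\equiv Q_j\pmod 2$ for $1\le j<t$, and $\hat{\boldsymbol m}=(L,m_1,\dots,m_{t-1})$.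
   Context: **Paths.** For coprime $1\le p<p'$, the $(p,p')$-model has heights $1,\dots,p'-1$; for $1\le h\le p'-2$ the $h$th band lies between heights $h$ and $h+1$, and is even if $\lfloor hp/p'\rfloor=\lfloor (h+1)p/p'\rfloor$ and odd otherwise. For $1\le a,b,c\le p'-1$ with $c=b\pm1$ and $L\ge0$ with $L+a-b$ even, $\mathcal P^{p,p'}_{a,b,c}(L)$ is the set of integer sequences $h=(h_0,\dots,h_L)$ with $1\le h_i\le p'-1$, $|h_{i+1}-h_i|=1$, $h_0=a$, $h_L=b$. Put $h_{L+1}=c$. For $1\le i\le L$, vertex $i$ is *straight* if $h_{i+1}-h_i=h_i-h_{i-1}$ and a *peak* otherwise; its parity is that of the band between heights $h_i$ and $h_{i+1}$; it is *scoring* if it is straight and odd, or a peak and even. Let $x_i=(i-(h_i-a))/2$, $y_i^{\rm coord}=(i+(h_i-a))/2$. Set $c_i=0$ if vertex $i$ is non-scoring; if it is scoring set $c_i=x_i$ when $h_i-h_{i-1}=1$ and $c_i=y_i^{\rm coord}$ when $h_i-h_{i-1}=-1$. Put $wt(h)=\sum_{i=1}^Lc_i$ and $\chi^{p,p'}_{a,b,c}(L)=\chi^{p,p'}_{a,b,c}(L;q)=\sum_{h\in\mathcal P^{p,p'}_{a,b,c}(L)}q^{wt(h)}$. **Continued fraction data.** Write $p'/p=c_0+1/(c_1+1/(\cdots+1/c_n))$ with $c_i\ge1$ for $0\le i<n$ and $c_n\ge2$. Put $t=c_0+\cdots+c_n-2$ and $t_k=-1+\sum_{i=0}^{k-1}c_i$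 for $0\le k\le n+1$. Define $y_{-1}=0,\ y_0=1$, and $y_k=c_{k-1}y_{k-1}+y_{k-2}$ for $1\le k\le n+1$. For $t_k<j\le t_{k+1}$, $0\le k\le n$, $0\le j\le t$, put $\kappa_j=y_{k-1}+(j-t_k)y_k$. Let $\mathcal T=\{\kappa_i\}_{i=0}^{t-1}$ and $\mathcal T'=\{p'-\kappa_i\}_{i=0}^{t-1}$. (These sets can intersect only if $p=1$ or $p=p'-1$; if $a$ or $b$ lies in both, one fixes for it a choice of regarding it as an element of $\mathcal T$ or of $\mathcal T'$, independently for $a$ and $b$, and uses that choice in all definitions below; the statement is for every such choice.) **The value $c$.** If $p'>2p$ put $\tau=t_1$; if $p'<2p$ put $\tau=t_2$ (when $p=1,p'=2$ the sets $\mathcal T,\mathcal T'$ are empty). Then $c=2$ if $b=1$; $c=b-1$ if $1<b\le\tau$; $c=p'-2$ if $b=p'-1$; $c=b+1$ if $p'-\tau\le b<p'-1$; and $c$ is either of $b\pm1$ otherwise. (When $p=1$ or $p=p'-1$ the first two rules apply if $b$ is regarded as in $\mathcal T$, the third and fourth if $b$ is regarded as in $\mathcal T'$.) **Vectors.** Put $a^L=a$, $a^R=b$. For $A\in\{L,R\}$ let $\sigma^A\in\{0,\dots,t-1\}$ satisfy $\kappa_{\sigma^A}=a^A$ if $a^A\in\mathcal T$ and $\kappa_{\sigma^A}=p'-a^A$ if $a^A\in\mathcal T'$. Let $\boldsymbol e_j=(\delta_{1j},\dots,\delta_{tj})$ for $0\le j\le t$ (so $\boldsymbol e_0=0$). Let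 $\boldsymbol v^A=\boldsymbol e_{\sigma^A}-\sum_{k:\sigma^A\le t_k<t}\boldsymbol e_{t_k}$. If $a^A\in\mathcal T$: $\boldsymbol u^A=\boldsymbol v^A$, $\boldsymbol\Delta^A=-\boldsymbol v^A$. If $a^A\in\mathcal T'$: $\boldsymbol u^A=\boldsymbol v^A+\boldsymbol e_t$, $\boldsymbol\Delta^A=\boldsymbol v^A-\boldsymbol e_t$. For a $t$-vector $\boldsymbol u=(u_1,\dots,u_t)$, the $(t-1)$-vectors $\boldsymbol u^\flat,\boldsymbol u^\sharp$ are given, for $1\le j\le t-1$ with $t_k<j\le t_{k+1}$, by $u^\flat_j=0,\ u^\sharp_j=u_j$ if $k$ is even, and $u^\flat_j=u_j,\ u^\sharp_j=0$ if $k$ is odd. Write $\boldsymbol u^{L\flat}=(\boldsymbol u^L)^\flat$, $\boldsymbol u^{R\sharp}=(\boldsymbol u^R)^\sharp$. All vectors are column vectors. **Matrices.** $\boldsymbol C=(C_{ij})_{0\le i,j\le t-1}$ is tridiagonal with $C_{j,j-1}=-1,\ C_{j,j}=1,\ C_{j,j+1}=1$ if $j=t_k$ for some $1\le k\le n$, and $C_{j,j-1}=-1,\ C_{j,j}=2,\ C_{j,j+1}=-1$ otherwise (entries with indices in range). $\hat{\boldsymbol C}$ is the $t\times t$ upper-triangular matrix with rows indexed $1\le i\le t$ and columns $0\le j\le t-1$, with the same entries $C_{ij}$ (the only nonzero entry of row $t$ is $C_{t,t-1}=-1$). For an integer $t$-vector $\boldsymbol u$ define $Q_i\in\{0,1\}$,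 $0\le i<t$, by $(Q_0,\dots,Q_{t-1})^T\equiv\hat{\boldsymbol C}^{-1}\boldsymbol u\pmod 2$ and $\boldsymbol Q(\boldsymbol u)=(Q_1,\dots,Q_{t-1})$. **The number $\gamma$.** Let $\alpha_t=\beta_t=\gamma_t=0$. For $j=t,t-1,\dots,1$: put $\beta'_{j-1}=\beta_j+(\boldsymbol\Delta^L)_j-(\boldsymbol\Delta^R)_j$, $\gamma'_{j-1}=\gamma_j+2\alpha_j(\boldsymbol\Delta^R)_j$; then $\alpha''_{j-1}=\alpha_j+\beta'_{j-1}$, $\gamma''_{j-1}=\gamma'_{j-1}-(\beta'_{j-1})^2$; then $(\alpha_{j-1},\beta_{j-1},\gamma_{j-1})=(\alpha''_{j-1},\ \alpha''_{j-1}-\beta'_{j-1},\ -(\alpha''_{j-1})^2-\gamma''_{j-1})$ if $j=t_k+1$ for some $1\le k\le n$, and $=(\alpha''_{j-1},\beta'_{j-1},\gamma''_{j-1})$ otherwise. Put $\gamma=\gamma_0$. **Modified Gaussian.** For integers $A,B$: $\left[{A\atop B}\right]'_q=\frac{(q^{A-B+1})_B}{(q)_B}$ if $B\ge0$ and $0$ otherwise, where $(z)_0=1$, $(z)_n=\prod_{i=0}^{n-1}(1-zq^i)$ for $n>0$; in particular $\left[{-1\atop 0}\right]'_q=1$. *)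

theory Defs
  imports "HOL-Computational_Algebra.Formal_Laurent_Series"
begin

section \<open>Paths\<close>

text \<open>For \<open>1 \<le> h \<le> p' - 2\<close> the \<open>h\<close>-th band lies between the heights \<open>h\<close> and \<open>h + 1\<close>;
  on integers \<open>div\<close> is the floor of the quotient.\<close>

definition even_band :: "int \<Rightarrow> int \<Rightarrow> int \<Rightarrow> bool" where
  "even_band p p' h \<longleftrightarrow> (h * p) div p' = ((h + 1) * p) div p'"

definition paths :: "int \<Rightarrow> int \<Rightarrow> int \<Rightarrow> nat \<Rightarrow> int list set" where
  "paths p' a b L = {h. length h = L + 1
     \<and> (\<forall>i\<le>L. 1 \<le> h ! i \<and> h ! i \<le> p' - 1)
     \<and> (\<forall>i<L. \<bar>h ! (i + 1) - h ! i\<bar> = 1)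
     \<and> h ! 0 = a \<and> h ! L = b}"

text \<open>In the next three definitions \<open>g\<close> is a path of length \<open>L\<close> extended by \<open>h\<^bsub>L+1\<^esub> = c\<close>,
  and \<open>1 \<le> i \<le> L\<close>.\<close>

definition straight :: "int list \<Rightarrow> nat \<Rightarrow> bool" where
  "straight g i \<longleftrightarrow> g ! (i + 1) - g ! i = g ! i - g ! (i - 1)"

definition scoring :: "int \<Rightarrow> int \<Rightarrow> int list \<Rightarrow> nat \<Rightarrow> bool" where
  "scoring p p' g i \<longleftrightarrow>
     (let ev = even_band p p' (min (g ! i) (g ! (i + 1)))
      in straight g i \<and> \<not> ev \<or> \<not> straight g i \<and> ev)"

text \<open>The divisions by 2 are exact, since \<open>h\<^sub>i - a\<close> has the parity of \<open>i\<close>.\<close>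

definition vertex_wt :: "int \<Rightarrow> int \<Rightarrow> int list \<Rightarrow> nat \<Rightarrow> int" where
  "vertex_wt p p' g i =
     (if \<not> scoring p p' g i then 0
      else if g ! i - g ! (i - 1) = 1 then (int i - (g ! i - g ! 0)) div 2
      else (int i + (g ! i - g ! 0)) div 2)"

definition path_wt :: "int \<Rightarrow> int \<Rightarrow> int \<Rightarrow> int list \<Rightarrow> int" where
  "path_wt p p' c h = (\<Sum>i = 1..length h - 1. vertex_wt p p' (h @ [c]) i)"

definition chi :: "int \<Rightarrow> int \<Rightarrow> int \<Rightarrow> int \<Rightarrow> int \<Rightarrow> nat \<Rightarrow> 'a::field \<Rightarrow> 'a" where
  "chi p p' a b c L q = (\<Sum>h\<in>paths p' a b L. q powi path_wt p p' c h)"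


section \<open>Continued fraction data\<close>

text \<open>The partial quotients \<open>c\<^sub>0, \<dots>, c\<^sub>n\<close> form the list \<open>cs\<close>, so \<open>n = length cs - 1\<close>.\<close>

fun cf_val :: "nat list \<Rightarrow> rat" where
  "cf_val [] = 0"
| "cf_val [x] = of_nat x"
| "cf_val (x # y # xs) = of_nat x + 1 / cf_val (y # xs)"

definition is_cf :: "nat list \<Rightarrow> rat \<Rightarrow> bool" where
  "is_cf cs r \<longleftrightarrow> cs \<noteq> [] \<and> (\<forall>i<length cs - 1. 1 \<le> cs ! i) \<and> 2 \<le> last cs \<and> r = cf_val cs"

definition cf_t :: "nat list \<Rightarrow> nat" where
  "cf_t cs = sum_list cs - 2"

definition cf_tk :: "nat list \<Rightarrow> nat \<Rightarrow> int" where
  "cf_tk cs k = - 1 + (\<Sum>i<k. int (cs ! i))"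

text \<open>Index shift: \<open>cf_y cs k\<close> is \<open>y\<^bsub>k-1\<^esub>\<close>.\<close>

fun cf_y :: "nat list \<Rightarrow> nat \<Rightarrow> int" where
  "cf_y cs 0 = 0"
| "cf_y cs (Suc 0) = 1"
| "cf_y cs (Suc (Suc k)) = int (cs ! k) * cf_y cs (Suc k) + cf_y cs k"

definition zone :: "nat list \<Rightarrow> nat \<Rightarrow> nat" where
  "zone cs j = (THE k. k < length cs \<and> cf_tk cs k < int j \<and> int j \<le> cf_tk cs (k + 1))"

definition kappa :: "nat list \<Rightarrow> nat \<Rightarrow> int" where
  "kappa cs j = (let k = zone cs j in cf_y cs k + (int j - cf_tk cs k) * cf_y cs (k + 1))"

definition Tak :: "nat list \<Rightarrow> int set" where
  "Tak cs = kappa cs ` {..<cf_t cs}"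

definition Tak' :: "int \<Rightarrow> nat list \<Rightarrow> int set" where
  "Tak' p' cs = (\<lambda>i. p' - kappa cs i) ` {..<cf_t cs}"

text \<open>A Boolean flag records whether \<open>x\<close> is regarded as an element of \<open>Tak cs\<close> (\<open>True\<close>) or of
  \<open>Tak' p' cs\<close> (\<open>False\<close>). It is determined by \<open>x\<close> unless \<open>x\<close> lies in both sets; some flag
  is admissible iff \<open>x \<in> Tak cs \<union> Tak' p' cs\<close>.\<close>

definition regarded :: "int \<Rightarrow> nat list \<Rightarrow> int \<Rightarrow> bool \<Rightarrow> bool" where
  "regarded p' cs x inT \<longleftrightarrow> (if inT then x \<in> Tak cs else x \<in> Tak' p' cs)"

definition cf_tau :: "int \<Rightarrow> int \<Rightarrow> nat list \<Rightarrow> int" where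
  "cf_tau p p' cs = (if p' > 2 * p then cf_tk cs 1 else cf_tk cs 2)"

definition c_rule :: "int \<Rightarrow> int \<Rightarrow> nat list \<Rightarrow> int \<Rightarrow> bool \<Rightarrow> int \<Rightarrow> bool" where
  "c_rule p p' cs b bT c \<longleftrightarrow>
     (let \<tau> = cf_tau p p' cs;
          special = (p = 1 \<or> p = p' - 1);
          low = (special \<longrightarrow> bT);
          high = (special \<longrightarrow> \<not> bT)
      in if low \<and> b = 1 then c = 2
         else if low \<and> 1 < b \<and> b \<le> \<tau> then c = b - 1
         else if high \<and> b = p' - 1 then c = p' - 2
         else if high \<and> p' - \<tau> \<le> b \<and> b < p' - 1 then c = b + 1
         else c = b + 1 \<or> c = b - 1)"


section \<open>Vectors and matrices\<close>

text \<open>Vectors and matrices are functions of their indices: a \<open>t\<close>-vector uses the indices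
  \<open>1, \<dots>, t\<close>, a \<open>(t-1)\<close>-vector the indices \<open>1, \<dots>, t - 1\<close>.\<close>

definition evec :: "int \<Rightarrow> nat \<Rightarrow> int" where
  "evec j i = of_bool (1 \<le> i \<and> int i = j)"

definition vvec :: "nat list \<Rightarrow> nat \<Rightarrow> nat \<Rightarrow> int" where
  "vvec cs s i = evec (int s) i
     - (\<Sum>k\<in>{k. k \<le> length cs \<and> int s \<le> cf_tk cs k \<and> cf_tk cs k < int (cf_t cs)}.
          evec (cf_tk cs k) i)"

definition uvec :: "nat list \<Rightarrow> bool \<Rightarrow> nat \<Rightarrow> nat \<Rightarrow> int" where
  "uvec cs inT s i = (if inT then vvec cs s i else vvec cs s i + evec (int (cf_t cs)) i)"

definition Delta :: "nat list \<Rightarrow> bool \<Rightarrow> nat \<Rightarrow> nat \<Rightarrow> int" where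
  "Delta cs inT s i = (if inT then - vvec cs s i else vvec cs s i - evec (int (cf_t cs)) i)"

definition flat :: "nat list \<Rightarrow> (nat \<Rightarrow> int) \<Rightarrow> nat \<Rightarrow> int" where
  "flat cs u j = (if even (zone cs j) then 0 else u j)"

definition sharp :: "nat list \<Rightarrow> (nat \<Rightarrow> int) \<Rightarrow> nat \<Rightarrow> int" where
  "sharp cs u j = (if even (zone cs j) then u j else 0)"

text \<open>\<open>Cmat\<close> with row and column indices \<open>0, \<dots>, t - 1\<close> is the matrix \<open>C\<close>; with row indices
  \<open>1, \<dots>, t\<close> and column indices \<open>0, \<dots>, t - 1\<close> it is the matrix \<open>C\<close>-hat.\<close>

definition Cmat :: "nat list \<Rightarrow> nat \<Rightarrow> nat \<Rightarrow> int" where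
  "Cmat cs i j =
     (let brk = (\<exists>k\<in>{1..length cs - 1}. int i = cf_tk cs k)
      in if j + 1 = i then - 1
         else if j = i then (if brk then 1 else 2)
         else if j = i + 1 then (if brk then 1 else - 1)
         else 0)"

definition Chat_mult :: "nat list \<Rightarrow> (nat \<Rightarrow> int) \<Rightarrow> nat \<Rightarrow> int" where
  "Chat_mult cs v i = (\<Sum>j<cf_t cs. Cmat cs i j * v j)"

text \<open>The two-sided inverse of \<open>C\<close>-hat, with rows \<open>0, \<dots>, t - 1\<close> and columns \<open>1, \<dots>, t\<close>
  (zero elsewhere, which makes the description unique). It has integer entries because
  \<open>C\<close>-hat is triangular with diagonal entries \<open>-1\<close>.\<close>

definition Chat_inv :: "nat list \<Rightarrow> nat \<Rightarrow> nat \<Rightarrow> int" where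
  "Chat_inv cs = (THE D. let t = cf_t cs in
       (\<forall>i j. \<not> (i < t \<and> j \<in> {1..t}) \<longrightarrow> D i j = 0)
     \<and> (\<forall>i\<in>{1..t}. \<forall>k\<in>{1..t}. (\<Sum>j<t. Cmat cs i j * D j k) = of_bool (i = k))
     \<and> (\<forall>i<t. \<forall>k<t. (\<Sum>j = 1..t. D i j * Cmat cs j k) = of_bool (i = k)))"

definition Qvec :: "nat list \<Rightarrow> (nat \<Rightarrow> int) \<Rightarrow> nat \<Rightarrow> int" where
  "Qvec cs u i = (\<Sum>j = 1..cf_t cs. Chat_inv cs i j * u j) mod 2"


section \<open>The number gamma\<close>

text \<open>\<open>gamma_step\<close> passes from \<open>(\<alpha>\<^sub>j, \<beta>\<^sub>j, \<gamma>\<^sub>j)\<close> to \<open>(\<alpha>\<^bsub>j-1\<^esub>, \<beta>\<^bsub>j-1\<^esub>, \<gamma>\<^bsub>j-1\<^esub>)\<close>; \<open>foldr\<close> applies it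
  for \<open>j = t\<close> first and for \<open>j = 1\<close> last.\<close>

fun gamma_step :: "nat list \<Rightarrow> (nat \<Rightarrow> int) \<Rightarrow> (nat \<Rightarrow> int) \<Rightarrow> nat
    \<Rightarrow> int \<times> int \<times> int \<Rightarrow> int \<times> int \<times> int" where
  "gamma_step cs \<Delta>L \<Delta>R j (\<alpha>, \<beta>, \<gamma>) =
     (let \<beta>' = \<beta> + \<Delta>L j - \<Delta>R j;
          \<gamma>' = \<gamma> + 2 * \<alpha> * \<Delta>R j;
          \<alpha>'' = \<alpha> + \<beta>';
          \<gamma>'' = \<gamma>' - \<beta>'\<^sup>2
      in if \<exists>k\<in>{1..length cs - 1}. int j = cf_tk cs k + 1
         then (\<alpha>'', \<alpha>'' - \<beta>', - (\<alpha>''\<^sup>2) - \<gamma>'')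
         else (\<alpha>'', \<beta>', \<gamma>''))"

definition gamma :: "nat list \<Rightarrow> (nat \<Rightarrow> int) \<Rightarrow> (nat \<Rightarrow> int) \<Rightarrow> int" where
  "gamma cs \<Delta>L \<Delta>R =
     snd (snd (foldr (gamma_step cs \<Delta>L \<Delta>R) [1..<cf_t cs + 1] (0, 0, 0)))"


section \<open>The fermionic sum\<close>

definition qpoch :: "'a::field \<Rightarrow> 'a \<Rightarrow> nat \<Rightarrow> 'a" where
  "qpoch q x n = (\<Prod>i<n. 1 - x * q ^ i)"

definition gauss' :: "'a::field \<Rightarrow> int \<Rightarrow> int \<Rightarrow> 'a" where
  "gauss' q A B = (if B \<ge> 0 then qpoch q (q powi (A - B + 1)) (nat B) / qpoch q q (nat B) else 0)"

text \<open>The \<open>(t-1)\<close>-vectors \<open>m\<close> of non-negative integers that are congruent to \<open>Q\<close> modulo 2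
  (extended by 0 outside \<open>1, \<dots>, t - 1\<close>, so that each vector is counted once).\<close>

definition msum_set :: "nat list \<Rightarrow> (nat \<Rightarrow> int) \<Rightarrow> (nat \<Rightarrow> nat) set" where
  "msum_set cs Q = {m. (\<forall>j. j \<notin> {1..<cf_t cs} \<longrightarrow> m j = 0)
                     \<and> (\<forall>j\<in>{1..<cf_t cs}. int (m j) mod 2 = Q j mod 2)}"

definition mhat :: "nat \<Rightarrow> (nat \<Rightarrow> nat) \<Rightarrow> nat \<Rightarrow> int" where
  "mhat L m j = (if j = 0 then int L else int (m j))"

text \<open>Four times the exponent of \<open>q\<close>.\<close>

definition exponent4 :: "nat list \<Rightarrow> nat \<Rightarrow> (nat \<Rightarrow> int) \<Rightarrow> (nat \<Rightarrow> int) \<Rightarrow> int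
    \<Rightarrow> (nat \<Rightarrow> nat) \<Rightarrow> int" where
  "exponent4 cs L uL uR g m =
     (\<Sum>i<cf_t cs. \<Sum>j<cf_t cs. mhat L m i * Cmat cs i j * mhat L m j)
     - (int L)\<^sup>2
     - 2 * (\<Sum>j = 1..<cf_t cs. (flat cs uL j + sharp cs uR j) * int (m j))
     + g"

text \<open>The argument \<open>z\<close> is \<open>q\<close> to the power \<open>1/4\<close>. The division by 2 is exact for the vectors
  \<open>m\<close> of the sum if \<open>L \<equiv> a - b\<close> modulo 2: then the vector \<open>mhat L m\<close> is congruent modulo 2 to the inverse
  of \<open>C\<close>-hat applied to \<open>uL + uR\<close>.\<close>

definition fermi_term :: "'a::field \<Rightarrow> nat list \<Rightarrow> nat \<Rightarrow> (nat \<Rightarrow> int) \<Rightarrow> (nat \<Rightarrow> int) \<Rightarrow> int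
    \<Rightarrow> (nat \<Rightarrow> nat) \<Rightarrow> 'a" where
  "fermi_term z cs L uL uR g m =
     z powi exponent4 cs L uL uR g m
     * (\<Prod>j = 1..<cf_t cs.
          gauss' (z ^ 4)
            (int (m j) - (Chat_mult cs (mhat L m) j - uL j - uR j) div 2)
            (int (m j)))"

end

theory Submission
  imports Defs
begin

text \<open>Refine the generating function of paths by the number \<open>m\<close> of non-scoring vertices, with
  \<open>z\<^sup>4 = q\<close>. Passing from the \<open>(p, p')\<close>-model to the \<open>(p, p' + p)\<close>-model inserts even bands; on
  paths this inserts particles, and the refined generating function becomes a sum of the old ones
  times Gaussian polynomials. Passing to the \<open>(p' - p, p')\<close>-model exchanges even and odd bands and
  inverts \<open>z\<close>. Along the continued fraction of \<open>p'/p\<close> every insertion adds one summation variable to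
  the fermionic sum, and extending the paths at their ends, once the end heights have been reached,
  accounts for the vectors \<open>u\<close>.\<close>

section \<open>Path generating functions and band insertion\<close>

text \<open>The weight of a path counts the pairs of a step and a later scoring vertex entered in
  the opposite direction. The potential \<open>rho\<close> makes this count computable step by step:
  it rises by 1 at a scoring vertex entered upwards and falls by 1 at one entered downwards. So the
  end data fix the difference of the two kinds of scoring vertices, while \<open>S\<close> fixes
  their sum; twice (sum minus or plus difference) is four times the wanted number, hence the fourth
  root \<open>z\<close> of q.

  Under insertion the number of non-scoring vertices of the larger path becomes the length of the
  smaller one, so the summation variables are the path lengths at the successive levels, and their
  parities are those of the differences of the end heights.

  The obstacle is that modified Gaussians with negative top entry need not vanish. At a break, every
  end still at the boundary costs one step. A path of length 0 cannot pay for two such ends, yet it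
  may exist; the term with top -1 and bottom 0, whose Gaussian is 1, accounts for it. The inequality
  of \<open>chain_bound\<close> shows that every other term with a negative top vanishes, and the
  path recursion itself needs this bound.\<close>

definition rho :: "(int \<Rightarrow> int) \<Rightarrow> int \<Rightarrow> int \<Rightarrow> int" where
  "rho r h d = r h + of_bool (d = - 1)"

text \<open>For a peak the band ahead is the one just traversed, hence \<open>h - d\<close> in the
  second case. In both cases the potential \<open>rho\<close> changes by the entering direction
  times the score.\<close>

definition score :: "(int \<Rightarrow> int) \<Rightarrow> int \<Rightarrow> int \<Rightarrow> int \<Rightarrow> int" where
  "score r h d e = (if e = d then of_bool (r (h + d) \<noteq> r h) else of_bool (r (h - d) = r h))"

text \<open>\<open>r h\<close> is the number of odd bands below \<open>h\<close>. The paths have \<open>n\<close> steps and \<open>S\<close> scoring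
  vertices; they start at \<open>h\<close>, entered in direction \<open>d\<close>, and arrive at \<open>hT\<close> in direction \<open>dT\<close>.\<close>

fun path_gf :: "'a::field \<Rightarrow> (int \<Rightarrow> int) \<Rightarrow> int \<Rightarrow> int \<Rightarrow> int \<Rightarrow> nat \<Rightarrow> int \<Rightarrow> int \<Rightarrow> int \<Rightarrow> 'a" where
  "path_gf z r H hT dT 0 h d S = of_bool (h = hT \<and> d = dT \<and> S = 0)"
| "path_gf z r H hT dT (Suc n) h d S =
     (if 1 \<le> h \<and> h \<le> H then
        (\<Sum>e\<in>{1, - 1}. z powi (2 * (S - score r h d e - e * (rho r hT dT - rho r (h + e) e)))
                       * path_gf z r H hT dT n (h + e) e (S - score r h d e))
      else 0)"

lemma score_cases: "score r h d e = 0 \<or> score r h d e = 1"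
  by (auto simp: score_def)

lemma path_gf_neg: "S < 0 \<Longrightarrow> path_gf z r H hT dT n h d S = 0"
proof (induction n arbitrary: h d S)
  case (Suc n)
  have "S - score r h d e < 0" for e
    using Suc.prems score_cases[of r h d e] by auto
  then show ?case using Suc.IH by simp
qed simp

lemma path_gf_gt: "S > int n \<Longrightarrow> path_gf z r H hT dT n h d S = 0"
proof (induction n arbitrary: h d S)
  case (Suc n)
  have "S - score r h d e > int n" for e
    using Suc.prems score_cases[of r h d e] by auto
  then show ?case using Suc.IH by simp
qed simp

text \<open>This is the Gaussian polynomial with top k + n - 1 and bottom k. It counts the
  placements of k particles into n slots, each particle having weight q for every slot it passes.
  The recursion asks whether the first slot is occupied; with no slot there is no room for a
  particle.\<close>

fun qbin :: "'a::field \<Rightarrow> nat \<Rightarrow> nat \<Rightarrow> 'a" where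
  "qbin q k 0 = of_bool (k = 0)"
| "qbin q 0 (Suc n) = 1"
| "qbin q (Suc k) (Suc n) = q ^ Suc k * qbin q (Suc k) n + qbin q k (Suc n)"

text \<open>After insertion both ends \<open>h + r h\<close> and \<open>h + r h + 1\<close> of an
  even band represent the old height \<open>h\<close>. A path moving in direction \<open>d\<close>
  arrives at the end it meets first: the lower one on the way up, the upper one on the way
  down.\<close>

definition lift :: "(int \<Rightarrow> int) \<Rightarrow> int \<Rightarrow> int \<Rightarrow> int" where
  "lift r h d = h + rho r h d"

section \<open>Insertion of one more even band between consecutive odd bands\<close>

locale band_insertion =
  fixes z :: "'a::field" and r r' :: "int \<Rightarrow> int" and H H' hT dT :: int
  assumes z0: "z \<noteq> 0"
    and H1: "1 \<le> H"
    and r0: "r 0 = 0" and r1: "r 1 = 0" and rH: "r (H + 1) = r H"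
    and rstep: "0 \<le> h \<Longrightarrow> h \<le> H \<Longrightarrow> r (h + 1) = r h \<or> r (h + 1) = r h + 1"
    and H': "H' = H + r H + 1"
    and r': "0 \<le> h \<Longrightarrow> h \<le> H + 1 \<Longrightarrow> r' (h + r h) = r h \<and> r' (h + r h + 1) = r h"
    and hT: "0 \<le> hT" "hT \<le> H + 1" and dT: "dT = 1 \<or> dT = - 1"
begin

lemma r_mono: "h \<le> k \<Longrightarrow> 0 \<le> h \<Longrightarrow> k \<le> H + 1 \<Longrightarrow> r h \<le> r k"
proof (induction k rule: int_ge_induct)
  case (step i)
  then show ?case using rstep[of i] by auto
qed simp

abbreviation "U \<equiv> path_gf z r H hT dT"
abbreviation "U' \<equiv> path_gf z r' H' (lift r hT dT) dT"

text \<open>Requiring the first vertex not to score yields a recursion that matches the Pascal rule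
  of the particle sum \<open>T\<close>. At length 0 there is no vertex to restrict.\<close>

definition F where
  "F n h d S = (case n of 0 \<Rightarrow> U' 0 h d S | Suc m \<Rightarrow>
     if 1 \<le> h \<and> h \<le> H' then
       (\<Sum>e\<in>{1, - 1}. if score r' h d e = 0 then z powi (2 * (S - e * (rho r' (lift r hT dT) dT - rho r' (h + e) e)))
                       * U' m (h + e) e S else 0)
     else 0)"

text \<open>With \<open>s\<close> scoring vertices among \<open>n + s\<close>, exactly
  \<open>n\<close> do not score; they take the place of the \<open>n\<close> steps of the old
  path.\<close>

definition X where "X n a d s = F (n + s) (lift r a d) d (int s)"

lemma
  assumes a: "1 \<le> a" "a \<le> H" and d: "d = 1 \<or> d = - 1"
  defines "x \<equiv> lift r a d"
  shows r'_x: "r' x = r a" and r'_xd: "r' (x + d) = r a"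
    and x_in: "1 \<le> x" "x \<le> H'" and xd_in: "1 \<le> x + d" "x + d \<le> H'"
    and ahead_even: "r (a + d) = r a \<Longrightarrow> x + d = lift r (a + d) d \<and> r' (x + 2 * d) = r a"
    and ahead_odd: "r (a + d) \<noteq> r a \<Longrightarrow> x + 2 * d = lift r (a + d) d \<and> r' (x + 2 * d) = r (a + d)"
    and behind_even: "r (a - d) = r a \<Longrightarrow> x = lift r (a - d) (- d) \<and> r' (x - d) = r a"
    and behind_odd: "r (a - d) \<noteq> r a \<Longrightarrow> x - d = lift r (a - d) (- d) \<and> r' (x - d) = r (a - d)"
proof -
  note A = r'[of a] r'[of "a + 1"] r'[of "a - 1"] rstep[of a] rstep[of "a - 1"] r_mono[of 0 a] r_mono[of a H]
     r0 rH H1 H' a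
  show "r' x = r a" "r' (x + d) = r a" "1 \<le> x" "x \<le> H'" "1 \<le> x + d" "x + d \<le> H'"
    using A d by (auto simp: x_def lift_def rho_def algebra_simps)
  show "r (a + d) = r a \<Longrightarrow> x + d = lift r (a + d) d \<and> r' (x + 2 * d) = r a"
    using A d by (auto simp: x_def lift_def rho_def algebra_simps)
  show "r (a + d) \<noteq> r a \<Longrightarrow> x + 2 * d = lift r (a + d) d \<and> r' (x + 2 * d) = r (a + d)"
    using A d by (auto simp: x_def lift_def rho_def algebra_simps)
  show "r (a - d) = r a \<Longrightarrow> x = lift r (a - d) (- d) \<and> r' (x - d) = r a"
    using A d by (auto simp: x_def lift_def rho_def algebra_simps)
  show "r (a - d) \<noteq> r a \<Longrightarrow> x - d = lift r (a - d) (- d) \<and> r' (x - d) = r (a - d)"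
    using A d by (auto simp: x_def lift_def rho_def algebra_simps)
qed

lemma rho_lift: "0 \<le> h \<Longrightarrow> h \<le> H + 1 \<Longrightarrow> d = 1 \<or> d = - 1 \<Longrightarrow> rho r' (lift r h d) d = rho r h d"
  using r'[of h] by (auto simp: lift_def rho_def add.assoc)

lemma lift_inj:
  assumes "0 \<le> h" "h \<le> H + 1" "0 \<le> k" "k \<le> H + 1"
  shows "lift r h d = lift r k d \<longleftrightarrow> h = k"
  using r_mono[of h k] r_mono[of k h] assms by (cases "h \<le> k") (auto simp: lift_def rho_def)

lemma r'_lift: "0 \<le> h \<Longrightarrow> h \<le> H + 1 \<Longrightarrow> d = 1 \<or> d = - 1 \<Longrightarrow> r' (lift r h d) = r h \<and> r' (lift r h d + d) = r h"
  using r'[of h] by (elim disjE) (simp_all add: lift_def rho_def add.assoc)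

abbreviation bT where "bT \<equiv> rho r hT dT"

lemma F_0: "F 0 h d S = U' 0 h d S" by (simp add: F_def)

lemma F_Suc: "F (Suc m) h d S = (if 1 \<le> h \<and> h \<le> H' then
       (\<Sum>e\<in>{1, - 1}. if score r' h d e = 0 then z powi (2 * (S - e * (bT - rho r' (h + e) e)))
                       * U' m (h + e) e S else 0)
     else 0)"
  using rho_lift[OF hT dT] by (simp add: F_def)

lemma U'_Suc: "U' (Suc m) h d S =
     (if 1 \<le> h \<and> h \<le> H' then
        (\<Sum>e\<in>{1, - 1}. z powi (2 * (S - score r' h d e - e * (bT - rho r' (h + e) e)))
                       * U' m (h + e) e (S - score r' h d e))
      else 0)"
  using rho_lift[OF hT dT] by simp

lemma U'_odd:
  assumes "r' (y - e) \<noteq> r' y" "r' (y + e) = r' y" "e = 1 \<or> e = - 1"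
  shows "U' M y e S = F M y e S"
proof (cases M)
  case (Suc m)
  have "score r' y e f = 0" if "f \<in> {1, - 1}" for f
    using assms that by (auto simp: score_def)
  then show ?thesis unfolding Suc U'_Suc F_Suc by (auto intro!: sum.cong)
qed (simp add: F_0)

text \<open>Within the inserted even band between \<open>x\<close> and \<open>x + d\<close> a path
  either leaves or turns back, and every turn scores. The states at \<open>x + d\<close> in
  direction \<open>d\<close> and at \<open>x\<close> in direction \<open>- d\<close> are the two
  phases of this zigzag; each is expressed by the other and by lifts of old heights, so that the
  zigzag can be eliminated afterwards.\<close>

lemma
  assumes a: "1 \<le> a" "a \<le> H" and d: "d = 1 \<or> d = - 1"
  defines "x \<equiv> lift r a d"
  shows F_expand: "F (Suc m) x d S = z powi (2 * (S - d * (bT - rho r a d))) * U' m (x + d) d S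
       + (if r (a - d) = r a then 0
          else z powi (2 * (S + d * (bT - rho r (a - d) (- d)))) * F m (lift r (a - d) (- d)) (- d) S)"
    and Y_Suc: "U' (Suc m) (x + d) d S =
         (if r (a + d) = r a then F (Suc m) (lift r (a + d) d) d S
          else z powi (2 * (S - 1 - d * (bT - rho r (a + d) d))) * F m (lift r (a + d) d) d (S - 1))
       + z powi (2 * (S - 1 + d * (bT - rho r a d) - 1)) * U' m x (- d) (S - 1)"
    and W_Suc: "U' (Suc m) x (- d) S =
         (if r (a - d) = r a then F (Suc m) (lift r (a - d) (- d)) (- d) S
          else z powi (2 * (S - 1 + d * (bT - rho r (a - d) (- d)))) * F m (lift r (a - d) (- d)) (- d) (S - 1))
       + z powi (2 * (S - 1 - d * (bT - rho r a d))) * U' m (x + d) d (S - 1)"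
    and Y_0: "U' 0 (x + d) d S = (if r (a + d) = r a then F 0 (lift r (a + d) d) d S else 0)"
    and W_0: "U' 0 x (- d) S = (if r (a - d) = r a then F 0 (lift r (a - d) (- d)) (- d) S else 0)"
proof -
  note B = r'_x[OF a d, folded x_def] r'_xd[OF a d, folded x_def] x_in[OF a d, folded x_def]
    xd_in[OF a d, folded x_def]
  note ae = ahead_even[OF a d, folded x_def] and ao = ahead_odd[OF a d, folded x_def]
    and be = behind_even[OF a d, folded x_def] and bo = behind_odd[OF a d, folded x_def]
  have sum_d: "(\<Sum>e\<in>{1, - 1}. f e) = f d + f (- d)" for f :: "int \<Rightarrow> 'a"
    using d by (auto simp: add.commute)
  have dm: "- d = 1 \<or> - d = - 1" using d by auto
  have dd: "d * d = 1" "d \<noteq> - d" "- d \<noteq> d" using d by auto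
  have rho_xd: "rho r' (x + d) d = rho r a d" "rho r' x (- d) = rho r a d + d"
    using B d by (auto simp: rho_def)
  have rho_b: "r (a - d) \<noteq> r a \<Longrightarrow> rho r' (x - d) (- d) = rho r (a - d) (- d)"
    using bo by (auto simp: rho_def)
  have rho_a: "r (a + d) \<noteq> r a \<Longrightarrow> rho r' (x + 2 * d) d = rho r (a + d) d"
    using ao by (auto simp: rho_def)
  have odd_b: "U' m (x - d) (- d) S = F m (lift r (a - d) (- d)) (- d) S" if "r (a - d) \<noteq> r a" for m S
  proof -
    have "r' (x - d - d) = r' (x - d)"
    proof -
      have "0 \<le> a - d" "a - d \<le> H + 1" using a d by auto
      from r'_lift[OF this dm] have "r' (lift r (a - d) (- d) - d) = r (a - d)" by simp
      then show ?thesis using bo[OF that] by metis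
    qed
    have "U' m (x - d) (- d) S = F m (x - d) (- d) S"
    proof (rule U'_odd)
      show "r' (x - d - - d) \<noteq> r' (x - d)" using bo[OF that] that B(1) by (metis diff_minus_eq_add diff_add_cancel)
      show "r' (x - d + - d) = r' (x - d)" using \<open>r' (x - d - d) = r' (x - d)\<close> by simp
    qed (rule dm)
    then show ?thesis using bo[OF that] by simp
  qed
  have odd_a: "U' m (x + 2 * d) d S = F m (lift r (a + d) d) d S" if "r (a + d) \<noteq> r a" for m S
  proof -
    have "r' (x + 2 * d + d) = r' (x + 2 * d)"
    proof -
      have "0 \<le> a + d" "a + d \<le> H + 1" using a d by auto
      from r'_lift[OF this d] have "r' (lift r (a + d) d + d) = r (a + d)" by simp
      then show ?thesis using ao[OF that] by metis
    qed
    have "U' m (x + 2 * d) d S = F m (x + 2 * d) d S"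
    proof (rule U'_odd)
      have "x + 2 * d - d = x + d" by simp
      then show "r' (x + 2 * d - d) \<noteq> r' (x + 2 * d)" using ao[OF that] that B(2) by metis
    qed (use d \<open>r' (x + 2 * d + d) = r' (x + 2 * d)\<close> in simp_all)
    then show ?thesis using ao[OF that] by simp
  qed
  show "F (Suc m) x d S = z powi (2 * (S - d * (bT - rho r a d))) * U' m (x + d) d S
       + (if r (a - d) = r a then 0
          else z powi (2 * (S + d * (bT - rho r (a - d) (- d)))) * F m (lift r (a - d) (- d)) (- d) S)"
    unfolding F_Suc sum_d using B dd be bo rho_xd rho_b odd_b by (auto simp: score_def)
  have x2: "x + d + d = x + 2 * d" by simp
  show "U' (Suc m) (x + d) d S =
         (if r (a + d) = r a then F (Suc m) (lift r (a + d) d) d S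
          else z powi (2 * (S - 1 - d * (bT - rho r (a + d) d))) * F m (lift r (a + d) d) d (S - 1))
       + z powi (2 * (S - 1 + d * (bT - rho r a d) - 1)) * U' m x (- d) (S - 1)"
  proof (cases "r (a + d) = r a")
    case True
    have xe: "r' (x + d + d) = r a" "lift r (a + d) d = x + d" using ae[OF True] x2 by metis+
    have "F (Suc m) (x + d) d S = z powi (2 * (S - d * (bT - rho r' (x + 2 * d) d))) * U' m (x + 2 * d) d S"
      unfolding F_Suc sum_d using B dd xe(1) by (simp add: score_def x2)
    then show ?thesis unfolding xe(2) U'_Suc sum_d using B dd xe(1) True
      by (simp add: score_def x2 rho_xd; simp add: algebra_simps)
  next
    case False
    have "r' (x + d + d) \<noteq> r a" using ao[OF False] False x2 by metis
    then show ?thesis unfolding U'_Suc sum_d using B dd False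
      by (simp add: score_def x2 rho_xd rho_a odd_a; simp add: algebra_simps)
  qed
  show "U' (Suc m) x (- d) S =
         (if r (a - d) = r a then F (Suc m) (lift r (a - d) (- d)) (- d) S
          else z powi (2 * (S - 1 + d * (bT - rho r (a - d) (- d)))) * F m (lift r (a - d) (- d)) (- d) (S - 1))
       + z powi (2 * (S - 1 - d * (bT - rho r a d))) * U' m (x + d) d (S - 1)"
  proof (cases "r (a - d) = r a")
    case True
    have xe: "r' (x - d) = r a" "lift r (a - d) (- d) = x" using be[OF True] by metis+
    have "F (Suc m) x (- d) S = z powi (2 * (S + d * (bT - rho r' (x - d) (- d)))) * U' m (x - d) (- d) S"
      unfolding F_Suc sum_d using B dd xe(1) by (simp add: score_def)
    then show ?thesis unfolding xe(2) U'_Suc sum_d using B dd xe(1) True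
      by (simp add: score_def rho_xd; simp add: algebra_simps)
  next
    case False
    have "r' (x - d) \<noteq> r a" using bo[OF False] False by metis
    then show ?thesis unfolding U'_Suc sum_d using B dd False
      by (simp add: score_def rho_xd rho_b odd_b; simp add: algebra_simps)
  qed
  show "U' 0 (x + d) d S = (if r (a + d) = r a then F 0 (lift r (a + d) d) d S else 0)"
  proof (cases "r (a + d) = r a")
    case False
    have "x + d \<noteq> lift r hT d"
    proof
      assume *: "x + d = lift r hT d"
      have "r' (lift r hT d) = r hT" using r'_lift[OF hT, of "d"] r'_lift[OF hT, of "- d"] d by auto
      then have "r hT = r a" using * B by simp
      with * have "hT = a + d" using d by (auto simp: x_def lift_def rho_def)
      with False \<open>r hT = r a\<close> show False by simp
    qed
    then show ?thesis using False by auto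
  qed (use ae in \<open>simp add: F_0\<close>)
  show "U' 0 x (- d) S = (if r (a - d) = r a then F 0 (lift r (a - d) (- d)) (- d) S else 0)"
  proof (cases "r (a - d) = r a")
    case False
    have "x \<noteq> lift r hT (- d)"
    proof
      assume *: "x = lift r hT (- d)"
      have "r' (lift r hT (- d)) = r hT" using r'_lift[OF hT, of "d"] r'_lift[OF hT, of "- d"] d by auto
      then have "r hT = r a" using * B by simp
      with * have "hT = a - d" using d by (auto simp: x_def lift_def rho_def)
      with False \<open>r hT = r a\<close> show False by simp
    qed
    then show ?thesis using False by auto
  qed (use be in \<open>simp add: F_0\<close>)
qed

text \<open>Each of the \<open>k\<close> inserted particles contributes two scoring vertices, so the
  old path underneath has only \<open>S - 2 * k\<close> of them.\<close>

definition T where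
  "T n a d S = (\<Sum>k\<le>nat S. qbin (z ^ 4) k n * U n a d (S - 2 * int k))"

text \<open>Pascal's rule for \<open>qbin\<close>. If a particle sits in the first slot, its removal
  gives the same sum with two scoring vertices fewer; otherwise all particles are carried past the
  first step of the old path.\<close>

lemma T_Suc:
  assumes "1 \<le> a" "a \<le> H"
  shows "T (Suc n) a d (int s) = (if s \<ge> 2 then T (Suc n) a d (int s - 2) else 0)
    + (\<Sum>e\<in>{1, - 1}. z powi (2 * (int s - score r a d e - e * (bT - rho r (a + e) e)))
         * T n (a + e) e (int s - score r a d e))"
proof -
  let ?u = "\<lambda>k. U (Suc n) a d (int s - 2 * int k)"
  let ?w = "\<lambda>e. z powi (2 * (int s - score r a d e - e * (bT - rho r (a + e) e)))"
  have 1: "T (Suc n) a d (int s) = (\<Sum>k\<le>s. (z ^ 4) ^ k * qbin (z ^ 4) k n * ?u k)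
       + (\<Sum>k\<in>{1..s}. qbin (z ^ 4) (k - 1) (Suc n) * ?u k)"
  proof -
    have "qbin (z ^ 4) k (Suc n) = (z ^ 4) ^ k * qbin (z ^ 4) k n + (if k \<in> {1..s} then qbin (z ^ 4) (k - 1) (Suc n) else 0)"
      if "k \<le> s" for k
      using that by (cases k; cases n) auto
    then have "T (Suc n) a d (int s) = (\<Sum>k\<le>s. (z ^ 4) ^ k * qbin (z ^ 4) k n * ?u k
       + (if k \<in> {1..s} then qbin (z ^ 4) (k - 1) (Suc n) * ?u k else 0))"
      unfolding T_def by (auto intro!: sum.cong simp: algebra_simps simp del: path_gf.simps)
    also have "\<dots> = (\<Sum>k\<le>s. (z ^ 4) ^ k * qbin (z ^ 4) k n * ?u k)
       + (\<Sum>k\<in>{..s} \<inter> {1..s}. qbin (z ^ 4) (k - 1) (Suc n) * ?u k)"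
      unfolding sum.distrib by (subst sum.inter_restrict[symmetric]) auto
    also have "{..s} \<inter> {1..s} = {1..s}" by auto
    finally show ?thesis .
  qed
  have 2: "(\<Sum>k\<in>{1..s}. qbin (z ^ 4) (k - 1) (Suc n) * ?u k) = (if s \<ge> 2 then T (Suc n) a d (int s - 2) else 0)"
  proof (cases "s \<ge> 2")
    case True
    then obtain t where t: "s = Suc (Suc t)" by (metis le_add_diff_inverse plus_1_eq_Suc numeral_2_eq_2 add_Suc)
    have "(\<Sum>k\<in>{1..s}. qbin (z ^ 4) (k - 1) (Suc n) * ?u k) = (\<Sum>k\<le>Suc t. qbin (z ^ 4) k (Suc n) * ?u (Suc k))"
      by (rule sum.reindex_bij_witness[of _ Suc "\<lambda>k. k - 1"]) (auto simp: t)
    also have "\<dots> = T (Suc n) a d (int s - 2)"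
    proof -
      have "U (Suc n) a d (- int t - 2) = 0" by (rule path_gf_neg) simp
      then show ?thesis unfolding T_def by (simp add: t algebra_simps del: path_gf.simps qbin.simps)
    qed
    finally show ?thesis using True by simp
  next
    case False
    then have "?u k = 0" if "k \<in> {1..s}" for k using that by (intro path_gf_neg) auto
    then show ?thesis using False by simp
  qed
  have 3: "(z ^ 4) ^ k * qbin (z ^ 4) k n * ?u k =
      (\<Sum>e\<in>{1, - 1}. ?w e * (qbin (z ^ 4) k n * U n (a + e) e (int s - score r a d e - 2 * int k)))" for k
  proof -
    \<comment> \<open>Carrying \<open>k\<close> particles past the step multiplies by the fourth
      power of \<open>z\<close> for each; this is exactly the weight of the \<open>2 * k\<close>
      scoring vertices that the old path lacks.\<close>
    have p: "(z ^ 4) ^ k * z powi (2 * (int s - 2 * int k - score r a d e - e * (bT - rho r (a + e) e))) = ?w e" for e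
    proof -
      have "(z ^ 4) ^ k = z powi (4 * int k)"
        by (simp flip: power_mult add: power_int_def nat_mult_distrib)
      then show ?thesis using z0 by (simp flip: power_int_add add: algebra_simps)
    qed
    have "(z ^ 4) ^ k * qbin (z ^ 4) k n * ?u k = (\<Sum>e\<in>{1, - 1}.
       ((z ^ 4) ^ k * z powi (2 * (int s - 2 * int k - score r a d e - e * (bT - rho r (a + e) e))))
        * (qbin (z ^ 4) k n * U n (a + e) e (int s - 2 * int k - score r a d e)))"
      using assms by (simp add: algebra_simps)
    then show ?thesis unfolding p by (simp add: algebra_simps)
  qed
  have 4: "(\<Sum>k\<le>s. qbin (z ^ 4) k n * U n (a + e) e (int s - score r a d e - 2 * int k)) = T n (a + e) e (int s - score r a d e)" for e
    unfolding T_def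
  proof (rule sum.mono_neutral_right)
    show "\<forall>i\<in>{..s} - {..nat (int s - score r a d e)}.
       qbin (z ^ 4) i n * U n (a + e) e (int s - score r a d e - 2 * int i) = 0"
    proof
      fix i assume "i \<in> {..s} - {..nat (int s - score r a d e)}"
      then have "int s - score r a d e - 2 * int i < 0" by auto
      then show "qbin (z ^ 4) i n * U n (a + e) e (int s - score r a d e - 2 * int i) = 0"
        by (simp only: path_gf_neg mult_zero_right)
    qed
  qed (use score_cases[of r a d e] in auto)
  show ?thesis unfolding 1 2 3 sum.swap[of _ "{1, - 1}"]
    unfolding 4 sum_distrib_left[symmetric] by simp
qed

lemma rho_diff:
  assumes "1 \<le> a" "a \<le> H" "d = 1 \<or> d = - 1" "e \<in> {1, - 1}"
  shows "rho r (a + e) e = rho r a d + d * score r a d e"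
  using assms rstep[of a] rstep[of "a - 1"] by (auto simp: rho_def score_def)

text \<open>Elimination of the two zigzag states. One full period of the zigzag uses two scoring
  vertices and gives the term with \<open>s - 2\<close>; the remaining terms leave the inserted band
  towards a neighbour of \<open>a\<close>.\<close>

lemma X_Suc:
  assumes a: "1 \<le> a" "a \<le> H" and d: "d = 1 \<or> d = - 1"
  shows "X (Suc n) a d s = (if s \<ge> 2 then z powi (4 * (int s - 1)) * X (Suc n) a d (s - 2) else 0)
    + (\<Sum>e\<in>{1, - 1}. let t = int s - score r a d e; \<beta> = bT - rho r (a + e) e in
         if t \<ge> 0 then z powi (2 * t * (1 + score r a d e) - 2 * \<beta> * (e + d * score r a d e))
           * X n (a + e) e (nat t) else 0)"
proof -
  let ?x = "lift r a d"
  have sum_d: "(\<Sum>e\<in>{1, - 1}. f e) = f d + f (- d)" for f :: "int \<Rightarrow> 'a"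
    using d by (auto simp: add.commute)
  let ?ea = "r (a + d) = r a" and ?eb = "r (a - d) = r a"
  define A where "A = bT - rho r a d"
  define Y where "Y t = U' (n + t) (?x + d) d (int t)" for t
  define W where "W t = U' (n + t) ?x (- d) (int t)" for t
  define P where "P t = X n (a - d) (- d) t" for t
  define Q where "Q t = X n (a + d) d t" for t
  have ra: "rho r (a + d) d = rho r a d + d * of_bool (\<not> ?ea)"
    using rho_diff[OF a d, of d] d by (auto simp: score_def)
  have rb: "rho r (a - d) (- d) = rho r a d + d * of_bool ?eb"
    using rho_diff[OF a d, of "- d"] d by (auto simp: score_def)
  have dd: "d * d = 1" "d * (d * k) = k" for k using d by auto
  have Y: "Y t = (if ?ea then Q t else if t = 0 then 0 else z powi (2 * (int t - d * A)) * Q (t - 1))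
      + (if t = 0 then 0 else z powi (2 * (int t - 2 + d * A)) * W (t - 1))" for t
  proof (cases "n + t")
    case 0
    then show ?thesis using Y_0[OF a d, of 0] by (auto simp: Y_def Q_def X_def)
  next
    case (Suc m)
    have neg: "F m' y e S = 0" if "S < 0" for m' y e S
      using that by (cases m') (auto simp: F_0 F_Suc path_gf_neg simp del: path_gf.simps intro: path_gf.simps(1))
    show ?thesis
    proof (cases t)
      case 0
      then have "n = Suc m" using Suc by simp
      then show ?thesis using Y_Suc[OF a d, of m 0] 0
        by (auto simp: Y_def Q_def X_def path_gf_neg neg simp del: path_gf.simps)
    next
      case (Suc t')
      with \<open>n + t = Suc m\<close> have m: "m = n + t'" by simp
      show ?thesis using Y_Suc[OF a d, of m "int t"] Suc m
        by (auto simp: Y_def Q_def W_def X_def ra A_def algebra_simps dd simp del: path_gf.simps)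
    qed
  qed
  have W: "W t = (if ?eb then P t else if t = 0 then 0 else z powi (2 * (int t - 1 + d * A)) * P (t - 1))
      + (if t = 0 then 0 else z powi (2 * (int t - 1 - d * A)) * Y (t - 1))" for t
  proof (cases "n + t")
    case 0
    then show ?thesis using W_0[OF a d, of 0] by (auto simp: W_def P_def X_def)
  next
    case (Suc m)
    have neg: "F m' y e S = 0" if "S < 0" for m' y e S
      using that by (cases m') (auto simp: F_0 F_Suc path_gf_neg simp del: path_gf.simps intro: path_gf.simps(1))
    show ?thesis
    proof (cases t)
      case 0
      then have "n = Suc m" using Suc by simp
      then show ?thesis using W_Suc[OF a d, of m 0] 0
        by (auto simp: W_def P_def X_def path_gf_neg neg simp del: path_gf.simps)
    next
      case (Suc t')
      with \<open>n + t = Suc m\<close> have m: "m = n + t'" by simp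
      show ?thesis using W_Suc[OF a d, of m "int t"] Suc m
        by (auto simp: Y_def P_def W_def X_def rb A_def algebra_simps dd simp del: path_gf.simps)
    qed
  qed
  have XS: "X (Suc n) a d t = z powi (2 * (int t - d * A)) * Y t
     + (if ?eb then 0 else z powi (2 * (int t + d * A)) * P t)" for t
    using F_expand[OF a d, of "n + t" "int t"] by (auto simp: X_def Y_def P_def A_def rb)
  have mp: "z powi i * (z powi j * w) = z powi (i + j) * w" for i j w
    using z0 by (simp add: power_int_add)
  note rules = sum_d Let_def score_def add_uminus_conv_diff ra rb P_def[symmetric] Q_def[symmetric] A_def
  have bT: "bT = A + rho r a d" by (simp add: A_def)
  have nd: "(- d = d) = False" "(d = 0) = False" using d by auto
  consider "s = 0" | "s = 1" | t where "s = Suc (Suc t)"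
    by (metis One_nat_def not0_implies_Suc)
  then show ?thesis
  proof cases
    case 1
    show ?thesis
      unfolding XS Y sum_d Let_def 1 score_def add_uminus_conv_diff ra rb P_def[symmetric] Q_def[symmetric] bT
      by (cases ?ea; cases ?eb) (simp_all add: P_def[symmetric] Q_def[symmetric] nd algebra_simps dd)
  next
    case 2
    have W0: "W 0 = (if ?eb then P 0 else 0)" using W[of 0] by simp
    show ?thesis
      unfolding XS Y[of 1] sum_d Let_def score_def add_uminus_conv_diff ra rb P_def[symmetric] Q_def[symmetric] bT 2
      by (cases ?ea; cases ?eb) (simp_all add: W0 P_def[symmetric] Q_def[symmetric] nd distrib_left mp, simp_all add: algebra_simps dd mp)
  next
    case 3
    define B where "B = d * A"
    have Xs: "X (Suc n) a d s = z powi (2 * (int s - B)) * (if ?ea then Q s else z powi (2 * (int s - B)) * Q (s - 1))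
      + z powi (4 * int s - 4) * (if ?eb then P (s - 1) else z powi (2 * (int s - 2 + B)) * P t)
      + z powi (4 * int s - 4) * (z powi (2 * (int t - B)) * Y t)
      + (if ?eb then 0 else z powi (2 * (int s + B)) * P s)"
      unfolding 3 XS Y[of "Suc (Suc t)"] B_def[symmetric]
      by (cases ?ea; cases ?eb; simp add: W[of "Suc t"] B_def[symmetric] distrib_left mp; simp add: algebra_simps)
    \<comment> \<open>Reading \<open>XS\<close> backwards at \<open>s - 2\<close> replaces the last
      zigzag state by \<open>X\<close> itself and closes the recursion.\<close>
    have Yt: "z powi (2 * (int t - B)) * Y t = X (Suc n) a d t - (if ?eb then 0 else z powi (2 * (int t + B)) * P t)"
      unfolding XS B_def by simp
    show ?thesis
      unfolding Xs Yt sum_d Let_def score_def add_uminus_conv_diff ra rb P_def[symmetric] Q_def[symmetric] bT 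
      by (cases ?ea; cases ?eb) (simp_all add: 3 P_def[symmetric] Q_def[symmetric] nd B_def right_diff_distrib mp, simp_all add: algebra_simps dd mp nat_add_distrib)
  qed
qed

text \<open>Either the lift lies outside the strip already, or the only exit that does not score
  leads out of it; the target is not reached there, since lifts of the target in the outward
  direction stay inside.\<close>

lemma X_Suc_outside:
  assumes "h = 0 \<or> h = H + 1" "d = 1 \<or> d = - 1"
  shows "X (Suc n) h d s = 0"
proof -
  have t: "\<not> (1 \<le> k \<and> k \<le> H') \<Longrightarrow> k \<noteq> lift r hT e \<or> e \<noteq> dT \<Longrightarrow> U' m k e S = 0" for m k e S
    by (cases m) (auto simp del: of_bool_eq_iff)
  have lT: "1 \<le> lift r hT (- 1)" "lift r hT 1 \<le> H'"
    using r_mono[of 0 hT] r_mono[of hT "H + 1"] hT H' r0 rH by (auto simp: lift_def rho_def)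
  have rr: "r' 1 = 0" "r' 2 = 0" "r' H' = r H" "r' (H' - 1) = r H"
    using r'[of 0] r'[of 1] r'[of H] r'[of "H + 1"] r0 r1 rH H1 H' by (auto simp: algebra_simps)
  have H'1: "1 \<le> H'" using H1 H' r_mono[of 0 H] r0 by auto
  from assms(1) show ?thesis
  proof
    assume h: "h = 0"
    show ?thesis
    proof (cases "d = 1")
      case True
      then show ?thesis using h by (simp add: X_def lift_def rho_def F_Suc r0)
    next
      case False
      then have d: "d = - 1" using assms by auto
      have "U' (n + s) 0 (- 1) (int s) = 0" by (rule t) (use lT in auto)
      then show ?thesis using h d rr by (simp add: X_def lift_def rho_def F_Suc r0 score_def)
    qed
  next
    assume h: "h = H + 1"
    show ?thesis
    proof (cases "d = 1")
      case True
      then have l: "lift r h d = H'" using h rH H' by (simp add: lift_def rho_def)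
      have "U' (n + s) (H' + 1) 1 (int s) = 0" by (rule t) (use lT in auto)
      then show ?thesis using True rr l by (simp add: X_def F_Suc score_def)
    next
      case False
      then have d: "d = - 1" using assms by auto
      then have l: "lift r h d = H' + 1" using h rH H' by (simp add: lift_def rho_def)
      show ?thesis using l by (simp add: X_def F_Suc)
    qed
  qed
qed

lemma T_0: "T 0 a d (int s) = of_bool (a = hT \<and> d = dT \<and> s = 0)"
proof -
  have "T 0 a d (int s) = (\<Sum>k\<le>s. if k = 0 then U 0 a d (int s) else 0)"
    unfolding T_def by (auto intro!: sum.cong)
  then show ?thesis by (simp add: sum.delta)
qed

lemma X_0:
  assumes "0 \<le> a" "a \<le> H + 1"
  shows "X 0 a d s = of_bool (a = hT \<and> d = dT \<and> s = 0)"
proof (cases s)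
  case 0
  have "lift r a d = lift r hT d \<longleftrightarrow> a = hT" using lift_inj[of a hT d] assms hT by simp
  then show ?thesis using 0 by (auto simp: X_def F_0)
next
  case (Suc m)
  have "U' m y e (int s) = 0" for y e by (rule path_gf_gt) (use Suc in simp)
  then show ?thesis using Suc by (simp add: X_def F_Suc)
qed

text \<open>Both sides obey the same recursion, by \<open>X_Suc\<close> and \<open>T_Suc\<close>,
  once the power of \<open>z\<close> is split off. The outer induction runs over the steps of the
  old path and the inner one over \<open>s\<close>, because the particle term keeps the length and
  lowers \<open>s\<close> by 2.\<close>

theorem X_eq_T:
  assumes "0 \<le> a" "a \<le> H + 1" "d = 1 \<or> d = - 1"
  shows "X n a d s = z powi ((int s)\<^sup>2 - (bT - rho r a d)\<^sup>2) * T n a d (int s)"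
  using assms
proof (induction n arbitrary: a d s)
  case 0
  show ?case unfolding T_0 X_0[OF 0(1,2)] by (cases "s = 0") auto
next
  case (Suc n)
  show ?case
  proof (cases "a = 0 \<or> a = H + 1")
    case True
    then have "T (Suc n) a d (int s) = 0" by (auto simp: T_def)
    then show ?thesis using X_Suc_outside[OF True Suc.prems(3)] by simp
  next
    case False
    then have a: "1 \<le> a" "a \<le> H" using Suc.prems by auto
    have mp: "z powi i * (z powi j * w) = z powi (i + j) * w" for i j w
      using z0 by (simp add: power_int_add)
    let ?\<beta> = "bT - rho r a d"
    show ?thesis
    proof (induction s rule: less_induct)
      case (less s)
      have 1: "(if s \<ge> 2 then z powi (4 * (int s - 1)) * X (Suc n) a d (s - 2) else 0)
        = z powi ((int s)\<^sup>2 - ?\<beta>\<^sup>2) * (if s \<ge> 2 then T (Suc n) a d (int s - 2) else 0)"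
      proof (cases "s \<ge> 2")
        case True
        then have "int (s - 2) = int s - 2" by simp
        moreover have "X (Suc n) a d (s - 2) = z powi ((int (s - 2))\<^sup>2 - ?\<beta>\<^sup>2) * T (Suc n) a d (int (s - 2))"
          using less[of "s - 2"] True by simp
        moreover have "4 * (int s - 1) + ((int s - 2)\<^sup>2 - ?\<beta>\<^sup>2) = (int s)\<^sup>2 - ?\<beta>\<^sup>2"
          by (simp add: power2_eq_square algebra_simps)
        ultimately show ?thesis using True by (simp only: mp if_True)
      qed simp
      have 2: "(let t = int s - score r a d e; \<beta> = bT - rho r (a + e) e in
         if t \<ge> 0 then z powi (2 * t * (1 + score r a d e) - 2 * \<beta> * (e + d * score r a d e))
           * X n (a + e) e (nat t) else 0)
         = z powi ((int s)\<^sup>2 - ?\<beta>\<^sup>2) * (z powi (2 * (int s - score r a d e - e * (bT - rho r (a + e) e)))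
         * T n (a + e) e (int s - score r a d e))" if e: "e \<in> {1, - 1}" for e
      proof (cases "int s - score r a d e \<ge> 0")
        case True
        have IH: "X n (a + e) e (nat (int s - score r a d e))
          = z powi ((int s - score r a d e)\<^sup>2 - (bT - rho r (a + e) e)\<^sup>2) * T n (a + e) e (int s - score r a d e)"
        proof -
          have "0 \<le> a + e" "a + e \<le> H + 1" "e = 1 \<or> e = - 1" using a e by auto
          from Suc.IH[OF this, of "nat (int s - score r a d e)"] show ?thesis
            unfolding int_nat_eq if_P[OF True] .
        qed
        define b where "b = bT - rho r (a + e) e"
        define k where "k = score r a d e"
        have \<beta>: "?\<beta> = b + d * k"
          using rho_diff[OF a Suc.prems(3) e] by (simp add: b_def k_def)
        \<comment> \<open>Completion of the square; as the score \<open>k\<close> is 0 or 1, it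
          equals its own square.\<close>
        have ex: "2 * (int s - k) * (1 + k) - 2 * b * (e + d * k) + ((int s - k)\<^sup>2 - b\<^sup>2)
          = (int s)\<^sup>2 - (b + d * k)\<^sup>2 + 2 * (int s - k - e * b)"
        proof -
          have "k = 0 \<or> k = 1" unfolding k_def by (rule score_cases)
          then show ?thesis using Suc.prems(3) by (elim disjE) (simp_all add: power2_eq_square algebra_simps)
        qed
        have "z powi (2 * (int s - k) * (1 + k) - 2 * b * (e + d * k)) * X n (a + e) e (nat (int s - k))
          = z powi (2 * (int s - k) * (1 + k) - 2 * b * (e + d * k) + ((int s - k)\<^sup>2 - b\<^sup>2)) * T n (a + e) e (int s - k)"
          unfolding IH[folded k_def b_def] mp ..
        also have "\<dots> = z powi ((int s)\<^sup>2 - (b + d * k)\<^sup>2) * (z powi (2 * (int s - k - e * b)) * T n (a + e) e (int s - k))"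
          unfolding ex mp ..
        finally show ?thesis using True
          unfolding Let_def \<beta> b_def[symmetric] k_def[symmetric] by simp
      next
        case False
        then have "U n (a + e) e (int s - score r a d e - 2 * int k) = 0" for k
          by (intro path_gf_neg) auto
        then have "T n (a + e) e (int s - score r a d e) = 0" unfolding T_def by (intro sum.neutral) simp
        then show ?thesis unfolding Let_def if_not_P[OF False] by (simp only: mult_zero_right)
      qed
      show ?case
        unfolding X_Suc[OF a Suc.prems(3), where s = s] T_Suc[OF a, where s = s] 1
          distrib_left[of "z powi ((int s)\<^sup>2 - (bT - rho r a d)\<^sup>2)"] sum_distrib_left
        by (rule arg_cong2[where f = "(+)", OF refl], rule sum.cong[OF refl], erule 2)
    qed
  qed
qed

end

context band_insertion
begin

text \<open>If the band behind is even, turning back at the lift would score, so the restricted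
  first step can only cross the inserted band. Cancelling this step leaves all paths from the far
  end of the band, without any restriction on their first vertex.\<close>

theorem insert_even:
  assumes "1 \<le> a" "a \<le> H" "d = 1 \<or> d = - 1" "r (a - d) = r a"
  shows "U' (n + s) (lift r a d + d) d (int s)
    = z powi ((int s - 1)\<^sup>2 - (bT - rho r a d - d)\<^sup>2) * T (Suc n) a d (int s)"
proof -
  have mp: "z powi i * (z powi j * w) = z powi (i + j) * w" for i j w
    using z0 by (simp add: power_int_add)
  have "X (Suc n) a d s = z powi (2 * (int s - d * (bT - rho r a d))) * U' (n + s) (lift r a d + d) d (int s)"
    unfolding X_def using F_expand[OF assms(1,2,3), of "n + s" "int s"] assms(4) by simp
  moreover have "X (Suc n) a d s = z powi ((int s)\<^sup>2 - (bT - rho r a d)\<^sup>2) * T (Suc n) a d (int s)"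
    by (rule X_eq_T) (use assms in auto)
  ultimately have "z powi (- (2 * (int s - d * (bT - rho r a d)))) * (z powi (2 * (int s - d * (bT - rho r a d))) * U' (n + s) (lift r a d + d) d (int s))
    = z powi (- (2 * (int s - d * (bT - rho r a d)))) * (z powi ((int s)\<^sup>2 - (bT - rho r a d)\<^sup>2) * T (Suc n) a d (int s))"
    by simp
  moreover have "- (2 * (int s - d * (bT - rho r a d))) + ((int s)\<^sup>2 - (bT - rho r a d)\<^sup>2)
     = (int s - 1)\<^sup>2 - (bT - rho r a d - d)\<^sup>2"
    using assms(3) by (auto simp: power2_eq_square algebra_simps)
  ultimately show ?thesis unfolding mp by simp
qed

text \<open>The lift separates an odd band from an even one. Entered through the odd band it never
  scores, entered through the even band it always does, whichever way the path goes on; reversing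
  the entering direction therefore lifts the restriction on the first vertex at the price of one
  scoring vertex.\<close>

theorem insert_odd:
  assumes "1 \<le> a" "a \<le> H" "d = 1 \<or> d = - 1" "r (a - d) \<noteq> r a"
  shows "U' (Suc n + s) (lift r a d) (- d) (int s + 1)
    = z powi ((int s)\<^sup>2 - (bT - rho r a d)\<^sup>2) * T (Suc n) a d (int s)"
proof -
  let ?x = "lift r a d"
  note B = r'_x[OF assms(1-3)] r'_xd[OF assms(1-3)] behind_odd[OF assms]
  have "r' (?x - d) \<noteq> r' ?x" using B assms(4) by metis
  have s0: "score r' ?x d e = 0" and s1: "score r' ?x (- d) e = 1" if "e \<in> {1, - 1}" for e
    using that assms(3) B(1,2) \<open>r' (?x - d) \<noteq> r' ?x\<close> by (auto simp: score_def)
  have "U' (Suc n + s) ?x (- d) (int s + 1) = X (Suc n) a d s"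
    unfolding X_def add_Suc F_Suc U'_Suc
    by (rule if_cong[OF refl sum.cong[OF refl] refl]) (simp only: s0 s1; simp)
  also have "\<dots> = z powi ((int s)\<^sup>2 - (bT - rho r a d)\<^sup>2) * T (Suc n) a d (int s)"
    by (rule X_eq_T) (use assms in auto)
  finally show ?thesis .
qed

end

text \<open>Exchanging even and odd bands turns scoring vertices into non-scoring ones and inverts \<open>z\<close>.\<close>

lemma path_gf_dual:
  fixes z :: "'a::field"
  assumes z0: "z \<noteq> 0"
    and rD: "\<And>h. 1 \<le> h \<Longrightarrow> h \<le> H \<Longrightarrow> rD h = h - 1 - r h"
    and rstep: "\<And>h. 1 \<le> h \<Longrightarrow> h < H \<Longrightarrow> r (h + 1) = r h \<or> r (h + 1) = r h + 1"
    and hT: "1 \<le> hT" "hT \<le> H" and dT: "dT = 1 \<or> dT = - 1"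
    and h: "1 \<le> h" "h \<le> H" "1 \<le> h - d" "h - d \<le> H" and d: "d = 1 \<or> d = - 1"
  shows "path_gf z rD H hT dT n h d (int n - S)
    = z powi ((int n - 1)\<^sup>2 - (hT - dT - h)\<^sup>2) * path_gf (inverse z) r H hT dT n h d S"
  using h d
proof (induction n arbitrary: h d S)
  case 0
  then show ?case using dT by (auto simp: power2_eq_square)
next
  case (Suc n)
  have mp: "z powi i * (z powi j * w) = z powi (i + j) * w" for i j w
    using z0 by (simp add: power_int_add)
  have "z powi (2 * (int (Suc n) - S - score rD h d e - e * (rho rD hT dT - rho rD (h + e) e)))
         * path_gf z rD H hT dT n (h + e) e (int (Suc n) - S - score rD h d e)
    = z powi ((int (Suc n) - 1)\<^sup>2 - (hT - dT - h)\<^sup>2) *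
        (inverse z powi (2 * (S - score r h d e - e * (rho r hT dT - rho r (h + e) e)))
         * path_gf (inverse z) r H hT dT n (h + e) e (S - score r h d e))" (is "?A = ?B")
    if e: "e \<in> {1, - 1}" for e
  proof (cases "1 \<le> h + e \<and> h + e \<le> H")
    case True
    have sc: "score rD h d e = 1 - score r h d e"
      using True Suc.prems e rstep[of h] rstep[of "h - 1"] rD[of h] rD[of "h + 1"] rD[of "h - 1"]
      by (auto simp: score_def)
    have IH: "path_gf z rD H hT dT n (h + e) e (int n - (S - score r h d e))
      = z powi ((int n - 1)\<^sup>2 - (hT - dT - (h + e))\<^sup>2) * path_gf (inverse z) r H hT dT n (h + e) e (S - score r h d e)"
      by (rule Suc.IH) (use True Suc.prems e in auto)
    have rho: "rho rD hT dT - rho rD (h + e) e = hT - dT - h - (rho r hT dT - rho r (h + e) e)"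
      using rD[of hT] rD[of "h + e"] True hT dT e by (auto simp: rho_def)
    have e1: "int (Suc n) - S - (1 - score r h d e) = int n - (S - score r h d e)" by simp
    have e2: "2 * (int n - (S - score r h d e) - e * (hT - dT - h - (rho r hT dT - rho r (h + e) e)))
         + ((int n - 1)\<^sup>2 - (hT - dT - (h + e))\<^sup>2)
       = (int (Suc n) - 1)\<^sup>2 - (hT - dT - h)\<^sup>2 + - (2 * (S - score r h d e - e * (rho r hT dT - rho r (h + e) e)))"
      using e by (auto simp: power2_eq_square algebra_simps)
    show ?thesis
      unfolding sc rho e1 IH mp e2
      by (simp only: power_int_inverse power_int_minus[symmetric] mp)
  next
    case False
    \<comment> \<open>The dual count \<open>rD\<close> is only known inside the strip, but a path
      that leaves it cannot continue, and the target lies inside.\<close>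
    then have "path_gf w r' H hT dT n (h + e) e S' = 0" for w :: 'a and r' S'
      using hT by (cases n) auto
    then show ?thesis by simp
  qed
  then show ?case
    unfolding path_gf.simps sum_distrib_left if_distrib[of "\<lambda>x. _ * x"]
    using Suc.prems by (simp del: sum.insert)
qed

section \<open>Reflection of the strip and modifications at the ends of a path\<close>

definition reflect :: "(int \<Rightarrow> int) \<Rightarrow> int \<Rightarrow> int \<Rightarrow> int" where
  "reflect r H h = r H - r (H + 1 - h)"

text \<open>Turning the strip upside down preserves the parity of the bands and negates directions,
  so the lemmas about the lower boundary carry over to the upper one.\<close>

lemma path_gf_reflect:
  assumes "d = 1 \<or> d = - 1" "dT = 1 \<or> dT = - 1"
  shows "path_gf z (reflect r H) H hT dT n h d S = path_gf z r H (H + 1 - hT) (- dT) n (H + 1 - h) (- d) S"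
  using assms(1)
proof (induction n arbitrary: h d S)
  case 0
  then show ?case using assms by auto
next
  case (Suc n)
  have sc: "score (reflect r H) h d e = score r (H + 1 - h) (- d) (- e)" for e
    by (auto simp: score_def reflect_def algebra_simps)
  have rho: "rho (reflect r H) h d = r H + 1 - rho r (H + 1 - h) (- d)" if "d = 1 \<or> d = - 1" for h d
    using that by (auto simp: rho_def reflect_def)
  have summand: "z powi (2 * (S - score (reflect r H) h d e - e * (rho (reflect r H) hT dT - rho (reflect r H) (h + e) e)))
      * path_gf z (reflect r H) H hT dT n (h + e) e (S - score (reflect r H) h d e)
    = z powi (2 * (S - score r (H + 1 - h) (- d) (- e) - (- e) * (rho r (H + 1 - hT) (- dT) - rho r (H + 1 - h + (- e)) (- e))))
      * path_gf z r H (H + 1 - hT) (- dT) n (H + 1 - h + (- e)) (- e) (S - score r (H + 1 - h) (- d) (- e))"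
    if "e \<in> {1, - 1}" for e
  proof -
    have h': "H + 1 - (h + e) = H + 1 - h + - e" by simp
    have e: "e = 1 \<or> e = - 1" using that by auto
    show ?thesis unfolding sc rho[OF assms(2)] rho[OF e] h' Suc.IH[OF e]
      by (simp add: algebra_simps)
  qed
  have r: "1 \<le> h \<and> h \<le> H \<longleftrightarrow> 1 \<le> H + 1 - h \<and> H + 1 - h \<le> H" by auto
  show ?case
    unfolding path_gf.simps r using summand[of 1] summand[of "- 1"] by (simp add: add.commute)
qed

lemma sum_pm: "(\<Sum>e\<in>{1, - 1}. f e) = f 1 + f (- 1 :: int)" for f :: "int \<Rightarrow> 'a::comm_monoid_add"
  by simp

text \<open>Both targets are reached from height 1, which is entered downwards unless the whole path
  is a single step. Turning up there is a peak in an even band and scores; going straight on to 0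
  does not. The power of \<open>z\<close> records the change of the target potential, step by
  step.\<close>

lemma path_gf_target_flip:
  fixes z :: "'a::field"
  assumes z0: "z \<noteq> 0" and r: "r 0 = 0" "r 1 = 0" "r 2 = 0"
    and "1 \<le> n" "d = - 1 \<or> h \<noteq> 1 \<or> 2 \<le> n" "d = 1 \<or> d = - 1"
  shows "path_gf z r H 2 1 n h d (S + 1) = z powi (2 * (int n - h)) * path_gf z r H 0 (- 1) n h d S"
  using assms(5-)
proof (induction n arbitrary: h d S)
  case (Suc n)
  have mp: "z powi i * (z powi j * w) = z powi (i + j) * w" for i j w
    using z0 by (simp add: power_int_add)
  show ?case
  proof (cases "n = 0")
    case True
    show ?thesis
    proof (cases "h = 1")
      case h: True
      then have "d = - 1" using Suc.prems True by auto
      then show ?thesis using r by (auto simp: True h score_def rho_def sum_pm simp del: sum.insert)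
    next
      case False
      then show ?thesis by (simp add: True)
    qed
  next
    case False
    have rr: "rho r 2 1 = 0" "rho r 0 (- 1) = 1" using r by (auto simp: rho_def)
    have "z powi (2 * (S + 1 - score r h d e - e * (0 - rho r (h + e) e))) * path_gf z r H 2 1 n (h + e) e (S + 1 - score r h d e)
      = z powi (2 * (int (Suc n) - h)) * (z powi (2 * (S - score r h d e - e * (1 - rho r (h + e) e))) * path_gf z r H 0 (- 1) n (h + e) e (S - score r h d e))"
      if h: "1 \<le> h" and e: "e \<in> {1, - 1}" for e
    proof -
      have IH: "path_gf z r H 2 1 n (h + e) e (S - score r h d e + 1) = z powi (2 * (int n - (h + e))) * path_gf z r H 0 (- 1) n (h + e) e (S - score r h d e)"
        by (rule Suc.IH) (use False h e in auto)
      have S: "S + 1 - score r h d e = S - score r h d e + 1" by simp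
      have ex: "2 * (S - score r h d e + 1 - e * (0 - rho r (h + e) e)) + 2 * (int n - (h + e))
          = 2 * (int (Suc n) - h) + 2 * (S - score r h d e - e * (1 - rho r (h + e) e))"
        by (simp add: algebra_simps)
      show ?thesis unfolding S IH mp ex ..
    qed
    note summand = this
    show ?thesis
    proof (cases "1 \<le> h \<and> h \<le> H")
      case True
      show ?thesis unfolding path_gf.simps if_P[OF True] rr sum_distrib_left
        by (rule sum.cong[OF refl], rule summand) (use True in auto)
    qed auto
  qed
qed simp

text \<open>At height 1 a path that has more than one step left must go up to 2, and this peak in an
  even band scores.\<close>

lemma path_gf_extend_left:
  assumes r: "r 1 = 0" "r 2 = 0" and H: "1 \<le> H"
  shows "path_gf z r H hT dT (Suc (Suc n)) 1 (- 1) (S + 1)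
    = z powi (2 * (S - rho r hT dT)) * path_gf z r H hT dT (Suc n) 2 1 S"
  using r H by (simp add: score_def rho_def)

text \<open>A last step from 2 up to 3 is replaced by the two steps 2, 1, 2. The bands above and
  below height 2 have different parity, so the vertex there scores equally in both cases; the new
  peak at 1 lies in an even band and adds one scoring vertex.\<close>

lemma path_gf_extend_right:
  fixes z :: "'a::field"
  assumes z0: "z \<noteq> 0" and r: "r 1 = 0" "r 2 = 0" "r 3 = 1" and H: "2 \<le> H"
    and "1 \<le> n" "d = 1 \<or> d = - 1"
  shows "path_gf z r H 2 1 (Suc n) h d (S + 1) = z powi (2 * (int n + 1 - h)) * path_gf z r H 3 1 n h d S"
  using assms(6-)
proof (induction n arbitrary: h d S)
  case (Suc n)
  have mp: "z powi i * (z powi j * w) = z powi (i + j) * w" for i j w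
    using z0 by (simp add: power_int_add)
  show ?case
  proof (cases "n = 0")
    case True
    show ?thesis
    proof (cases "h = 2")
      case h: True
      show ?thesis
      proof (cases "d = 1")
        case d: True
        show ?thesis using r H by (auto simp: True h d score_def rho_def sum_pm simp del: sum.insert)
      next
        case False
        then have d: "d = - 1" using Suc.prems by auto
        show ?thesis using r H by (auto simp: True h d score_def rho_def sum_pm simp del: sum.insert)
      qed
    next
      case False
      then show ?thesis by (simp add: True)
    qed
  next
    case False
    have rr: "rho r 2 1 = 0" "rho r 3 1 = 1" using r by (auto simp: rho_def)
    have "z powi (2 * (S + 1 - score r h d e - e * (0 - rho r (h + e) e))) * path_gf z r H 2 1 (Suc n) (h + e) e (S + 1 - score r h d e)
      = z powi (2 * (int (Suc n) + 1 - h)) * (z powi (2 * (S - score r h d e - e * (1 - rho r (h + e) e))) * path_gf z r H 3 1 n (h + e) e (S - score r h d e))"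
      if e: "e \<in> {1, - 1}" for e
    proof -
      have IH: "path_gf z r H 2 1 (Suc n) (h + e) e (S - score r h d e + 1) = z powi (2 * (int n + 1 - (h + e))) * path_gf z r H 3 1 n (h + e) e (S - score r h d e)"
        by (rule Suc.IH) (use False e in auto)
      have S: "S + 1 - score r h d e = S - score r h d e + 1" by simp
      have ex: "2 * (S - score r h d e + 1 - e * (0 - rho r (h + e) e)) + 2 * (int n + 1 - (h + e))
          = 2 * (int (Suc n) + 1 - h) + 2 * (S - score r h d e - e * (1 - rho r (h + e) e))"
        by (simp add: algebra_simps)
      show ?thesis unfolding S IH mp ex ..
    qed
    note summand = this
    show ?thesis
    proof (cases "1 \<le> h \<and> h \<le> H")
      case True
      show ?thesis unfolding path_gf.simps(2)[of _ _ _ _ _ "Suc n"] path_gf.simps(2)[of _ _ _ _ _ n h d S] if_P[OF True] rr sum_distrib_left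
        by (rule sum.cong[OF refl], rule summand)
    qed auto
  qed
qed simp

text \<open>For heights from 0 to p' the minimum matters only at p', where it gives p - 1 instead of
  p: the fictitious band above the strip counts as even, like the one below it.\<close>

definition odd_below :: "int \<Rightarrow> int \<Rightarrow> int \<Rightarrow> int" where
  "odd_below p p' h = min (h * p) (p * p' - 1) div p'"

lemma div_eqI: "0 < y \<Longrightarrow> k * y \<le> x \<Longrightarrow> x < (k + 1) * y \<Longrightarrow> x div y = (k::int)"
  by (rule int_div_pos_eq[where r = "x - k * y"]) (simp_all add: algebra_simps)

lemma div_bounds: "0 < y \<Longrightarrow> (x div y) * y \<le> x \<and> x < (x div y + 1) * (y::int)"
  using pos_mod_bound[of y x] pos_mod_sign[of y x] div_mult_mod_eq[of x y] by (simp add: distrib_right; linarith)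

section \<open>The bands of the (p, p')-model\<close>

locale model =
  fixes p p' :: int
  assumes p: "1 \<le> p" "p < p'" and cop: "coprime p p'"
begin

abbreviation "H \<equiv> p' - 1"
abbreviation "r \<equiv> odd_below p p'"

lemma model_insert: "model p (p' + p)"
proof
  show "coprime p (p' + p)"
  proof (rule coprimeI)
    fix c assume "c dvd p" "c dvd p' + p"
    then have "c dvd p'" by (metis dvd_add_left_iff)
    then show "is_unit c" using \<open>c dvd p\<close> cop by (metis coprime_common_divisor)
  qed
qed (use p in auto)

lemma model_dual: "model (p' - p) p'"
proof
  show "coprime (p' - p) p'"
  proof (rule coprimeI)
    fix c assume "c dvd p' - p" "c dvd p'"
    then have "c dvd p" by (metis dvd_diff_right_iff dvd_diff_commute)
    then show "is_unit c" using \<open>c dvd p'\<close> cop by (metis coprime_common_divisor)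
  qed
qed (use p in auto)

lemma r_inside: "0 \<le> h \<Longrightarrow> h \<le> H \<Longrightarrow> r h = (h * p) div p'"
proof -
  assume h: "0 \<le> h" "h \<le> H"
  have "h * p \<le> (p' - 1) * p" using h p by (intro mult_right_mono) auto
  then have "h * p \<le> p * p' - 1" using p by (simp add: algebra_simps)
  then show ?thesis by (simp add: odd_below_def)
qed

lemma r_top: "r p' = p - 1" "r H = p - 1"
proof -
  have "min (p' * p) (p * p' - 1) = p * p' - 1" by (simp add: mult.commute)
  then show "r p' = p - 1" unfolding odd_below_def using p by (intro div_eqI) (auto simp: algebra_simps)
  have "H * p div p' = p - 1" using p by (intro div_eqI) (auto simp: algebra_simps)
  then show "r H = p - 1" using p by (simp add: r_inside)
qed

lemma r_bounds: "0 \<le> h \<Longrightarrow> h \<le> p' \<Longrightarrow> r h * p' \<le> h * p \<and> (h \<le> H \<longrightarrow> h * p < (r h + 1) * p')"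
proof (cases "h = p'")
  case True
  then show ?thesis using r_top p by (simp add: algebra_simps)
next
  case False
  assume "0 \<le> h" "h \<le> p'"
  with False have h: "0 \<le> h" "h \<le> H" by auto
  show ?thesis unfolding r_inside[OF h] using div_bounds[of p' "h * p"] p by auto
qed

lemma r_0: "r 0 = 0" and r_1: "r 1 = 0"
  using p by (auto simp: r_inside)

lemma r_step: "0 \<le> h \<Longrightarrow> h \<le> H \<Longrightarrow> r (h + 1) = r h \<or> r (h + 1) = r h + 1"
proof (cases "h = H")
  case True
  then show ?thesis using r_top by simp
next
  case False
  assume h: "0 \<le> h" "h \<le> H"
  note b = r_bounds[of h] r_bounds[of "h + 1"]
  have 1: "r h * p' < (r (h + 1) + 1) * p'"
    using b h False p by (auto simp: algebra_simps)
  have 2: "r (h + 1) * p' < (r h + 2) * p'"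
    using b h False p by (auto simp: algebra_simps)
  show ?thesis using 1 2 p by (auto simp: mult_less_cancel_right)
qed

text \<open>Adding \<open>r h * p\<close> to the bounds of \<open>r_bounds\<close> gives the
  corresponding bounds for the divisor \<open>p' + p\<close>. The height p' is treated apart because
  of the convention in \<open>odd_below\<close>.\<close>

lemma r_insert:
  assumes "0 \<le> h" "h \<le> H + 1"
  shows "odd_below p (p' + p) (h + r h) = r h \<and> odd_below p (p' + p) (h + r h + 1) = r h"
proof -
  have m: "model p (p' + p)"
    by (rule model_insert)
  have rn: "0 \<le> r h" unfolding odd_below_def using p assms
    by (intro pos_imp_zdiv_nonneg_iff[THEN iffD2]) auto
  show ?thesis
  proof (cases "h = p'")
    case True
    then have "h + r h = p' + p - 1" "h + r h + 1 = p' + p" "r h = p - 1" using r_top by auto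
    then show ?thesis using model.r_top[OF m] by metis
  next
    case False
    then have h: "0 \<le> h" "h \<le> H" using assms by auto
    have rp: "r h \<le> p - 1"
    proof -
      have "r h * p' < p * p'" using r_bounds[of h] h p
        by (smt (verit) mult_strict_right_mono mult.commute)
      then show ?thesis using p by simp
    qed
    note b = r_bounds[of h]
    have 1: "(h + r h) * p div (p' + p) = r h"
      by (intro div_eqI) (use b h p in \<open>auto simp: algebra_simps\<close>)
    have 2: "(h + r h + 1) * p div (p' + p) = r h"
      by (intro div_eqI) (use b h p in \<open>auto simp: algebra_simps\<close>)
    have 3: "odd_below p (p' + p) (h + r h) = (h + r h) * p div (p' + p)"
      by (intro model.r_inside[OF m]) (use h rp rn in auto)
    have 4: "odd_below p (p' + p) (h + r h + 1) = (h + r h + 1) * p div (p' + p)"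
      by (intro model.r_inside[OF m]) (use h rp rn in auto)
    show ?thesis using 1 2 3 4 by simp
  qed
qed

text \<open>Coprimality makes the lower bound on \<open>h * p\<close> strict at inner heights;
  taking the complement of the two strict bounds then determines the floor.\<close>

lemma r_dual:
  assumes "1 \<le> h" "h \<le> H"
  shows "odd_below (p' - p) p' h = h - 1 - r h"
proof -
  have m: "model (p' - p) p'"
    by (rule model_dual)
  have "r h * p' \<noteq> h * p"
  proof
    assume "r h * p' = h * p"
    then have "p' dvd h * p" by (metis dvd_triv_right)
    then have "p' dvd h" using cop by (simp add: coprime_dvd_mult_left_iff coprime_commute)
    then show False using assms by (auto dest: zdvd_imp_le)
  qed
  then have "r h * p' < h * p \<and> h * p < (r h + 1) * p'" using r_bounds[of h] assms by auto
  then have "h * (p' - p) div p' = h - 1 - r h"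
    by (intro div_eqI) (use p in \<open>auto simp: algebra_simps\<close>)
  then show ?thesis using model.r_inside[OF m, of h] assms by simp
qed

lemma band_insertion:
  assumes "z \<noteq> 0" "0 \<le> hT" "hT \<le> p'" "dT = 1 \<or> dT = - 1"
  shows "band_insertion z r (odd_below p (p' + p)) H (p' + p - 1) hT dT"
  using assms p r_0 r_1 r_step r_insert r_top by unfold_locales auto

end

lemma qbin_bottom: "qbin q k 1 = 1" for q :: "'a::field"
  by (induction k) auto

section \<open>Gaussian polynomials\<close>

text \<open>Not being a root of unity keeps the denominators of the Gaussians away from 0. The
  property passes to the fourth power, which is q, and to the inverse, which duality uses.\<close>

definition generic :: "'a::field \<Rightarrow> bool" where
  "generic z \<longleftrightarrow> z \<noteq> 0 \<and> (\<forall>i>0. z ^ i \<noteq> 1)"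

lemma generic_power: "generic z \<Longrightarrow> 0 < k \<Longrightarrow> generic (z ^ k)"
  by (auto simp: generic_def simp flip: power_mult)

lemma generic_inverse: "generic z \<Longrightarrow> generic (inverse z)"
  by (auto simp: generic_def power_inverse)

lemma gauss'_0 [simp]: "gauss' q A 0 = 1"
  by (simp add: gauss'_def qpoch_def)

text \<open>One factor of the numerator is 1 minus the zeroth power of q. For negative
  \<open>A\<close> there is in general no such factor, and the modified Gaussian need not
  vanish.\<close>

lemma gauss'_small: 
  assumes "generic q" "0 \<le> A" "A < int m"
  shows "gauss' q A (int m) = 0"
proof -
  have "q powi (A - int m + 1) * q ^ nat (int m - 1 - A) = 1"
  proof -
    have "q powi (A - int m + 1) * q powi (int m - 1 - A) = q powi ((A - int m + 1) + (int m - 1 - A))"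
      using assms by (intro power_int_add[symmetric]) (simp add: generic_def)
    then show ?thesis using assms by (simp add: power_int_def)
  qed
  moreover have "nat (int m - 1 - A) < m" using assms by auto
  ultimately have "qpoch q (q powi (A - int m + 1)) m = 0"
    unfolding qpoch_def by (metis finite_lessThan lessThan_iff prod_zero_iff right_minus_eq)
  then show ?thesis by (simp add: gauss'_def)
qed

lemma gauss'_qbin:
  fixes q :: "'a::field"
  assumes q: "generic q"
  shows "gauss' q (int k + int m) (int m) = qbin q k (Suc m)"
proof -
  define N where "N k m = (\<Prod>i<m. 1 - q ^ (Suc k + i))" for k m
  define D where "D m = N 0 m" for m
  have D0: "D m \<noteq> 0" for m using q by (auto simp: D_def N_def generic_def simp del: power_Suc)
  have g: "gauss' q (int k + int m) (int m) = N k m / D m" for k m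
  proof -
    have "q powi (int k + 1) * q ^ i = q ^ (Suc k + i)" for i
    proof -
      have "int k + 1 = int (Suc k)" by simp
      then show ?thesis by (simp only: power_int_of_nat power_add)
    qed
    then show ?thesis by (simp add: gauss'_def qpoch_def N_def D_def)
  qed
  have N1: "N k (Suc m) = (1 - q ^ Suc k) * N (Suc k) m" for k m
    unfolding N_def by (subst prod.lessThan_Suc_shift) simp
  have N2: "N k (Suc m) = N k m * (1 - q ^ (Suc k + m))" for k m by (simp add: N_def)
  have "N k m / D m = qbin q k (Suc m)"
  proof (induction k arbitrary: m)
    case 0
    then show ?case using D0[of m] by (simp add: D_def)
  next
    case (Suc k)
    note IHk = Suc
    show ?case
    proof (induction m)
      case 0
      then show ?case using qbin_bottom[of q "Suc k"] by (simp add: D_def N_def)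
    next
      case (Suc m)
      have d: "D (Suc m) = D m * (1 - q ^ Suc m)" by (simp add: D_def N2)
      have d0: "1 - q ^ Suc m \<noteq> 0" using D0[of "Suc m"] d by auto
      have "qbin q (Suc k) (Suc (Suc m)) = q ^ Suc k * (N (Suc k) m / D m) + N k (Suc m) / D (Suc m)"
        unfolding Suc.IH IHk by simp
      also have "\<dots> = (q ^ Suc k * (1 - q ^ Suc m) + (1 - q ^ Suc k)) * N (Suc k) m / D (Suc m)"
        unfolding N1 d using D0[of m] d0 by (simp add: field_simps del: power_Suc)
      also have "q ^ Suc k * (1 - q ^ Suc m) + (1 - q ^ Suc k) = 1 - q ^ (Suc (Suc k) + m)"
        by (simp add: algebra_simps power_add)
      finally show ?case by (simp add: N2 mult.commute)
    qed
  qed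
  then show ?thesis using g by simp
qed

lemma gauss'_inverse:
  fixes q :: "'a::field"
  assumes q: "generic q"
  shows "gauss' (inverse q) A (int m) = q powi (- (int m * (A - int m))) * gauss' q A (int m)"
proof -
  have q0: "q \<noteq> 0" using q by (simp add: generic_def)
  have f: "1 - inverse q powi k = - (q powi (- k)) * (1 - q powi k)" for k
    using q0 by (simp add: algebra_simps power_int_inverse power_int_minus field_simps)
  have P: "(\<Prod>i<m. 1 - inverse q powi (B + int i)) = (\<Prod>i<m. - (q powi (- (B + int i)))) * (\<Prod>i<m. 1 - q powi (B + int i))" for B m
    unfolding f prod.distrib ..
  have pw: "x powi B * x ^ i = x powi (B + int i)" if "x \<noteq> 0" for x :: 'a and B i
    using that by (simp add: power_int_add)
  have e: "qpoch x (x powi B) m = (\<Prod>i<m. 1 - x powi (B + int i))" if "x \<noteq> 0" for x :: 'a and B m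
    using that by (simp add: qpoch_def pw)
  have e1: "qpoch x x m = (\<Prod>i<m. 1 - x powi (1 + int i))" if "x \<noteq> 0" for x :: 'a and m
    using e[OF that, of 1] by simp
  have s: "(\<Prod>i<n. - (q powi (- (B + int i)))) = (- 1) ^ n * q powi (- (\<Sum>i<n. B + int i))" for B n
    by (induction n) (simp_all add: q0 power_int_add[symmetric] power_int_diff algebra_simps power_int_add)
  have s2: "(\<Sum>i<n. B + int i) = int n * B + (\<Sum>i<n. int i)" for B n
    by (simp add: sum.distrib)
  have "gauss' (inverse q) A (int m) = ((- 1) ^ m * q powi (- (\<Sum>i<m. A - int m + 1 + int i)) * qpoch q (q powi (A - int m + 1)) m)
     / ((- 1) ^ m * q powi (- (\<Sum>i<m. 1 + int i)) * qpoch q q m)"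
  proof -
    have q0': "inverse q \<noteq> 0" using q0 by simp
    have "gauss' (inverse q) A (int m) = qpoch (inverse q) (inverse q powi (A - int m + 1)) m / qpoch (inverse q) (inverse q) m"
      by (simp add: gauss'_def)
    then show ?thesis unfolding e[OF q0'] e1[OF q0'] e[OF q0] e1[OF q0] P s .
  qed
  also have "\<dots> = (q powi (- (\<Sum>i<m. A - int m + 1 + int i)) / q powi (- (\<Sum>i<m. 1 + int i))) * gauss' q A (int m)"
    by (simp add: gauss'_def)
  also have "q powi (- (\<Sum>i<m. A - int m + 1 + int i)) / q powi (- (\<Sum>i<m. 1 + int i)) = q powi (- (int m * (A - int m)))"
    unfolding s2 using q0 by (simp flip: power_int_diff add: algebra_simps)
  finally show ?thesis .
qed

text \<open>The sum is regrouped by the value of the top entry. Tops from 0 to \<open>m - 1\<close>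
  contribute nothing on either side, whereas a negative top would contribute on the left only; hence
  the hypothesis wherever \<open>G\<close> is nonzero.\<close>

lemma gauss'_sum:
  fixes q :: "'a::field"
  assumes q: "generic q" and fin: "finite M"
    and ne: "\<And>n. n \<in> M \<Longrightarrow> G n \<noteq> 0 \<Longrightarrow> 0 \<le> A n \<and> A n \<le> int K + int m"
  shows "(\<Sum>n\<in>M. gauss' q (A n) (int m) * G n)
    = (\<Sum>k\<le>K. qbin q k (Suc m) * (\<Sum>n\<in>M. if A n = int k + int m then G n else 0))"
proof -
  have "(\<Sum>k\<le>K. qbin q k (Suc m) * (if A n = int k + int m then G n else 0)) = gauss' q (A n) (int m) * G n"
    if n: "n \<in> M" for n
  proof (cases "G n = 0")
    case False
    note b = ne[OF n this]
    show ?thesis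
    proof (cases "A n < int m")
      case True
      then show ?thesis using gauss'_small[OF q] b by auto
    next
      case False
      then obtain k where k: "A n = int k + int m" by (metis add.commute not_less zle_iff_zadd)
      then have "(\<Sum>k'\<le>K. qbin q k' (Suc m) * (if A n = int k' + int m then G n else 0))
        = (\<Sum>k'\<le>K. if k' = k then qbin q k (Suc m) * G n else 0)"
        by (intro sum.cong) auto
      then show ?thesis using b k by (simp add: gauss'_qbin[OF q] del: qbin.simps)
    qed
  next
    case True
    then show ?thesis by (intro trans[OF sum.neutral]) auto
  qed
  then show ?thesis unfolding sum_distrib_left
    by (subst sum.swap) (simp del: qbin.simps cong: sum.cong)
qed

text \<open>The number \<open>k\<close> of particles is traded for the next summation variable
  \<open>n\<close> by \<open>m + 1 - n = L + 1 - m + f - 2 * k\<close>. The parity condition on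
  \<open>n\<close> says that \<open>k\<close> is an integer, and the top entry is
  \<open>k + m\<close>.\<close>

lemma qbin_sum_even:
  fixes q :: "'a::field" and G :: "int \<Rightarrow> 'a"
  assumes q: "generic q" and G: "\<And>S. S < 0 \<or> S > int m + 1 \<Longrightarrow> G S = 0" and K: "L + 1 + f \<le> K"
  shows "(\<Sum>k\<le>K. qbin q k (Suc m) * G (int L + 1 - int m + int f - 2 * int k))
    = (\<Sum>n\<in>{n. n \<le> m + 1 \<and> even (L + n + f)}. gauss' q ((int L + int n + int f) div 2) (int m) * G (int m + 1 - int n))"
proof -
  let ?M = "{n. n \<le> m + 1 \<and> even (L + n + f)}"
  have "(\<Sum>n\<in>?M. if (int L + int n + int f) div 2 = int k + int m then G (int m + 1 - int n) else 0)
     = G (int L + 1 - int m + int f - 2 * int k)" for k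
  proof (cases "0 \<le> 2 * int m + 2 * int k - int L - int f \<and> 2 * int m + 2 * int k - int L - int f \<le> int m + 1")
    case True
    define n0 where "n0 = nat (2 * int m + 2 * int k - int L - int f)"
    have n0: "int n0 = 2 * int m + 2 * int k - int L - int f" using True by (simp add: n0_def)
    have "(\<Sum>n\<in>?M. if (int L + int n + int f) div 2 = int k + int m then G (int m + 1 - int n) else 0)
      = (\<Sum>n\<in>?M. if n = n0 then G (int m + 1 - int n0) else 0)"
    proof (intro sum.cong refl if_cong)
      fix n assume "n \<in> ?M"
      then have "even (int L + int n + int f)" by simp
      then show "(int L + int n + int f) div 2 = int k + int m \<longleftrightarrow> n = n0" using n0 by presburger
    qed auto
    also have "n0 \<in> ?M"
    proof -
      have "int (L + n0 + f) = 2 * (int m + int k)" using n0 by simp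
      then have "even (L + n0 + f)" by (metis dvd_triv_left even_of_nat_iff)
      then show ?thesis using n0 True by auto
    qed
    then have "(\<Sum>n\<in>?M. if n = n0 then G (int m + 1 - int n0) else 0) = G (int m + 1 - int n0)" by simp
    finally show ?thesis using n0 by (simp add: algebra_simps)
  next
    case False
    then have G0: "G (int L + 1 - int m + int f - 2 * int k) = 0" by (intro G) auto
    have ne: "(int L + int n + int f) div 2 \<noteq> int k + int m" if n: "n \<in> ?M" for n
    proof
      assume "(int L + int n + int f) div 2 = int k + int m"
      moreover have "even (int L + int n + int f)" "n \<le> m + 1" using n by auto
      ultimately have "(int L + int n + int f) = 2 * (int k + int m)" by (metis dvd_mult_div_cancel)
      then show False using False \<open>n \<le> m + 1\<close> by auto
    qed
    show ?thesis unfolding G0 by (intro sum.neutral ballI if_not_P ne)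
  qed
  moreover have "(\<Sum>n\<in>?M. gauss' q ((int L + int n + int f) div 2) (int m) * G (int m + 1 - int n))
    = (\<Sum>k\<le>K. qbin q k (Suc m) * (\<Sum>n\<in>?M. if (int L + int n + int f) div 2 = int k + int m then G (int m + 1 - int n) else 0))"
    by (intro gauss'_sum[OF q]) (use K in auto)
  ultimately show ?thesis by simp
qed

text \<open>The same change of variable after dualisation, now with
  \<open>n = l - m - 2 * k\<close>. Here \<open>l\<close> may be negative and \<open>n\<close>
  enters the top entry with a minus sign, so non-negative tops have to be secured by the vanishing
  of \<open>G\<close>.\<close>

lemma qbin_sum_odd:
  fixes q :: "'a::field" and G :: "int \<Rightarrow> 'a"
  assumes q: "generic q" and G: "\<And>S. S < 0 \<or> S > int m + 1 \<Longrightarrow> G S = 0" and K: "l \<le> int K"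
    and ne: "\<And>n. n \<le> m + 1 \<Longrightarrow> even (l + int m - int n) \<Longrightarrow> G (int n) \<noteq> 0 \<Longrightarrow> 0 \<le> l + int m - int n"
  shows "(\<Sum>k\<le>K. qbin q k (Suc m) * G (l - int m - 2 * int k))
    = (\<Sum>n\<in>{n. n \<le> m + 1 \<and> even (l + int m - int n)}. gauss' q ((l + int m - int n) div 2) (int m) * G (int n))"
proof -
  let ?M = "{n. n \<le> m + 1 \<and> even (l + int m - int n)}"
  have "(\<Sum>n\<in>?M. if (l + int m - int n) div 2 = int k + int m then G (int n) else 0)
     = G (l - int m - 2 * int k)" for k
  proof (cases "0 \<le> l - int m - 2 * int k \<and> l - int m - 2 * int k \<le> int m + 1")
    case True
    define n0 where "n0 = nat (l - int m - 2 * int k)"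
    have n0: "int n0 = l - int m - 2 * int k" using True by (simp add: n0_def)
    have "(\<Sum>n\<in>?M. if (l + int m - int n) div 2 = int k + int m then G (int n) else 0)
      = (\<Sum>n\<in>?M. if n = n0 then G (int n0) else 0)"
    proof (intro sum.cong refl if_cong)
      fix n assume "n \<in> ?M"
      then have "even (l + int m - int n)" by simp
      then show "(l + int m - int n) div 2 = int k + int m \<longleftrightarrow> n = n0" using n0 by presburger
    qed auto
    also have "n0 \<in> ?M"
    proof -
      have "l + int m - int n0 = 2 * (int m + int k)" using n0 by simp
      then have "even (l + int m - int n0)" by (metis dvd_triv_left)
      then show ?thesis using n0 True by (simp del: even_diff even_add)
    qed
    then have "(\<Sum>n\<in>?M. if n = n0 then G (int n0) else 0) = G (int n0)" by simp
    finally show ?thesis using n0 by simp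
  next
    case False
    then have G0: "G (l - int m - 2 * int k) = 0" by (intro G) auto
    have ne: "(l + int m - int n) div 2 \<noteq> int k + int m" if n: "n \<in> ?M" for n
    proof
      assume "(l + int m - int n) div 2 = int k + int m"
      moreover have "even (l + int m - int n)" "n \<le> m + 1" using n by auto
      ultimately have "(l + int m - int n) = 2 * (int k + int m)" by (metis dvd_mult_div_cancel)
      then show False using False \<open>n \<le> m + 1\<close> by auto
    qed
    show ?thesis unfolding G0 by (intro sum.neutral ballI if_not_P ne)
  qed
  moreover have "(\<Sum>n\<in>?M. gauss' q ((l + int m - int n) div 2) (int m) * G (int n))
    = (\<Sum>k\<le>K. qbin q k (Suc m) * (\<Sum>n\<in>?M. if (l + int m - int n) div 2 = int k + int m then G (int n) else 0))"
  proof (intro gauss'_sum[OF q])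
    fix n assume "n \<in> ?M" "G (int n) \<noteq> 0"
    then show "0 \<le> (l + int m - int n) div 2 \<and> (l + int m - int n) div 2 \<le> int K + int m"
      using ne[of n] K by auto
  qed simp
  ultimately show ?thesis by simp
qed

section \<open>One step of the recursion\<close>

definition end_h :: "bool \<Rightarrow> int \<Rightarrow> int" where "end_h b H = (if b then 1 else H)"
definition sg :: "bool \<Rightarrow> int" where "sg b = (if b then 1 else - 1)"
definition end_dist :: "bool \<Rightarrow> int \<Rightarrow> int \<Rightarrow> int" where "end_dist b H h = (if b then h else H + 1 - h)"

lemma sg_pm: "sg b = 1 \<or> sg b = - 1" by (simp add: sg_def)

text \<open>The outward exit neither stays in the strip nor hits the target. The inward exit runs
  through an even band and is a peak or straight according to the entering direction, so reversing
  that direction changes the score of the first vertex and nothing else.\<close>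

lemma path_gf_flip_left:
  assumes r: "r (end_h b H - sg b) = r (end_h b H)" "r (end_h b H + sg b) = r (end_h b H)"
    and T: "hT \<noteq> end_h b H - sg b"
  shows "path_gf z r H hT dT (Suc n) (end_h b H) (- sg b) (S + 1) = path_gf z r H hT dT (Suc n) (end_h b H) (sg b) S"
proof -
  have "path_gf z r H hT dT n (end_h b H - sg b) (- sg b) S' = 0" for S'
    using T by (cases n) (auto simp: end_h_def sg_def)
  then show ?thesis using r by (cases b) (simp_all add: score_def end_h_def sg_def)
qed

lemma path_gf_flip_right:
  fixes z :: "'a::field"
  assumes z0: "z \<noteq> 0" and r: "r 0 = 0" "r 1 = 0" "r (H + 1) = r H"
    and f: "r (end_h b H + sg b) = r (end_h b H)"
    and n: "1 \<le> n" "d = - sg b \<or> h \<noteq> end_h b H \<or> 2 \<le> n" "d = 1 \<or> d = - 1"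
  shows "path_gf z r H (end_h b H + sg b) (sg b) n h d (S + 1)
    = z powi (2 * (int n - end_dist b H h)) * path_gf z r H (end_h b H - sg b) (- sg b) n h d S"
proof (cases b)
  case True
  have "path_gf z r H 2 1 n h d (S + 1) = z powi (2 * (int n - h)) * path_gf z r H 0 (- 1) n h d S"
    by (rule path_gf_target_flip[OF z0]) (use True r f n in \<open>auto simp: end_h_def sg_def\<close>)
  then show ?thesis using True by (simp add: end_h_def sg_def end_dist_def)
next
  case False
  have d: "- d = 1 \<or> - d = - 1" using n by auto
  have "path_gf z (reflect r H) H 2 1 n (H + 1 - h) (- d) (S + 1)
    = z powi (2 * (int n - (H + 1 - h))) * path_gf z (reflect r H) H 0 (- 1) n (H + 1 - h) (- d) S"
    by (rule path_gf_target_flip[OF z0]) (use False r f n in \<open>auto simp: reflect_def end_h_def sg_def\<close>)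
  then show ?thesis using False d by (simp add: path_gf_reflect end_h_def sg_def end_dist_def)
qed

lemma path_gf_ext_left:
  assumes r: "r 1 = 0" "r (H + 1) = r H" and f: "r (end_h b H + sg b) = r (end_h b H)" and H: "1 \<le> H"
    and dT: "dT = 1 \<or> dT = - 1"
  shows "path_gf z r H hT dT (Suc (Suc n)) (end_h b H) (- sg b) (S + 1)
    = z powi (2 * (S - (if b then rho r hT dT else r H + 1 - rho r hT dT)))
      * path_gf z r H hT dT (Suc n) (end_h b H + sg b) (sg b) S"
proof (cases b)
  case True
  then show ?thesis using path_gf_extend_left[of r H z hT dT n S] r f H by (simp add: end_h_def sg_def del: path_gf.simps)
next
  case False
  have rho: "rho (reflect r H) (H + 1 - hT) (- dT) = r H + 1 - rho r hT dT"
    using dT by (auto simp: rho_def reflect_def)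
  have "path_gf z (reflect r H) H (H + 1 - hT) (- dT) (Suc (Suc n)) 1 (- 1) (S + 1)
    = z powi (2 * (S - rho (reflect r H) (H + 1 - hT) (- dT))) * path_gf z (reflect r H) H (H + 1 - hT) (- dT) (Suc n) 2 1 S"
    by (rule path_gf_extend_left) (use False r f H in \<open>auto simp: reflect_def end_h_def sg_def\<close>)
  moreover have "- dT = 1 \<or> - dT = - 1" using dT by auto
  ultimately show ?thesis using False
    by (simp add: path_gf_reflect rho end_h_def sg_def del: path_gf.simps)
qed

lemma path_gf_ext_right:
  fixes z :: "'a::field"
  assumes z0: "z \<noteq> 0" and r: "r 1 = 0" "r (H + 1) = r H"
    and f: "r (end_h b H + sg b) = r (end_h b H)" "r (end_h b H + 2 * sg b) = r (end_h b H) + sg b"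
    and H: "2 \<le> H" and n: "1 \<le> n" "d = 1 \<or> d = - 1"
  shows "path_gf z r H (end_h b H + sg b) (sg b) (Suc n) h d (S + 1)
    = z powi (2 * (int n + 1 - end_dist b H h)) * path_gf z r H (end_h b H + 2 * sg b) (sg b) n h d S"
proof (cases b)
  case True
  have "path_gf z r H 2 1 (Suc n) h d (S + 1) = z powi (2 * (int n + 1 - h)) * path_gf z r H 3 1 n h d S"
    by (rule path_gf_extend_right[OF z0]) (use True r f n H in \<open>auto simp: end_h_def sg_def\<close>)
  then show ?thesis using True by (simp add: end_h_def sg_def end_dist_def del: path_gf.simps)
next
  case False
  have d: "- d = 1 \<or> - d = - 1" using n by auto
  have "path_gf z (reflect r H) H 2 1 (Suc n) (H + 1 - h) (- d) (S + 1)
    = z powi (2 * (int n + 1 - (H + 1 - h))) * path_gf z (reflect r H) H 3 1 n (H + 1 - h) (- d) S"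
    by (rule path_gf_extend_right[OF z0]) (use False r f n H in \<open>auto simp: reflect_def end_h_def sg_def\<close>)
  then show ?thesis using False d by (simp add: path_gf_reflect end_h_def sg_def end_dist_def del: path_gf.simps)
qed

text \<open>The last of the \<open>L + 1\<close> steps leads to the extra height beyond the end
  point, which is thus \<open>hT - dT\<close>. The starting point is counted as a vertex too, its
  score depending on the entering direction \<open>e\<close>; \<open>m\<close> is the number of
  non-scoring vertices among these \<open>L + 1\<close>.\<close>

definition Phi :: "'a::field \<Rightarrow> int \<Rightarrow> int \<Rightarrow> int \<Rightarrow> int \<Rightarrow> int \<Rightarrow> int \<Rightarrow> nat \<Rightarrow> nat \<Rightarrow> 'a" where
  "Phi z p p' a e hT dT L m = path_gf z (odd_below p p') (p' - 1) hT dT (Suc L) a e (int L + 1 - int m)"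

lemma Phi_0: "Phi z p p' a e hT dT 0 m
  = of_bool (1 \<le> a \<and> a \<le> p' - 1 \<and> hT = a + dT \<and> int m = 1 - score (odd_below p p') a e dT)"
  if "dT = 1 \<or> dT = - 1"
proof -
  let ?r = "odd_below p p'"
  have 1: "z powi (2 * (int 0 + 1 - int m - score ?r a e f - f * (rho ?r hT dT - rho ?r (a + f) f)))
      * path_gf z ?r (p' - 1) hT dT 0 (a + f) f (int 0 + 1 - int m - score ?r a e f)
    = (if f = dT then of_bool (hT = a + dT \<and> int m = 1 - score ?r a e dT) else 0)" for f
    by (cases "f = dT \<and> hT = a + dT \<and> int m = 1 - score ?r a e dT") auto
  show ?thesis unfolding Phi_def path_gf.simps(2) 1 using that by (auto simp: sum.delta)
qed

context model
begin

lemma qbin_sum_extend: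
  assumes "S \<le> int K"
  shows "(\<Sum>k\<le>nat S. qbin q k (Suc m) * path_gf z r H hT dT n a d (S - 2 * int k))
    = (\<Sum>k\<le>K. qbin q k (Suc m) * path_gf z r H hT dT n a d (S - 2 * int k))"
proof (rule sum.mono_neutral_left)
  show "\<forall>i\<in>{..K} - {..nat S}. qbin q i (Suc m) * path_gf z r H hT dT n a d (S - 2 * int i) = 0"
  proof
    fix i assume "i \<in> {..K} - {..nat S}"
    then have "S - 2 * int i < 0" by auto
    then show "qbin q i (Suc m) * path_gf z r H hT dT n a d (S - 2 * int i) = 0"
      by (simp only: path_gf_neg mult_zero_right)
  qed
qed (use assms in auto)

lemma Phi_insert_even:
  assumes z0: "z \<noteq> 0" and a: "1 \<le> a" "a \<le> H" and d: "d = 1 \<or> d = - 1" and e: "r (a - d) = r a"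
    and T: "0 \<le> hT" "hT \<le> p'" "dT = 1 \<or> dT = - 1" and K: "L + 1 \<le> K"
  shows "Phi z p (p' + p) (lift r a d + d) d (lift r hT dT) dT L m
    = z powi ((int L - int m)\<^sup>2 - (rho r hT dT - rho r a d - d)\<^sup>2)
      * (\<Sum>k\<le>K. qbin (z ^ 4) k (Suc m) * path_gf z r H hT dT (Suc m) a d (int L + 1 - int m - 2 * int k))"
proof (cases "m \<le> L + 1")
  case True
  interpret B: band_insertion z r "odd_below p (p' + p)" H "p' + p - 1" hT dT
    by (rule band_insertion[OF z0 T])
  define s where "s = L + 1 - m"
  have s: "m + s = Suc L" "int s = int L + 1 - int m" using True by (auto simp: s_def)
  have "Phi z p (p' + p) (lift r a d + d) d (lift r hT dT) dT L m
    = z powi ((int s - 1)\<^sup>2 - (rho r hT dT - rho r a d - d)\<^sup>2) * B.T (Suc m) a d (int s)"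
    unfolding Phi_def using B.insert_even[OF a d e, of m s] unfolding s by simp
  also have "B.T (Suc m) a d (int s) = (\<Sum>k\<le>K. qbin (z ^ 4) k (Suc m) * path_gf z r H hT dT (Suc m) a d (int s - 2 * int k))"
    unfolding B.T_def by (rule qbin_sum_extend) (use K s in linarith)
  also have "int s - 1 = int L - int m" using s by simp
  finally show ?thesis unfolding s .
next
  case False
  then have "Phi z p (p' + p) (lift r a d + d) d (lift r hT dT) dT L m = 0"
    unfolding Phi_def by (intro path_gf_neg) auto
  moreover have "path_gf z r H hT dT (Suc m) a d (int L + 1 - int m - 2 * int k) = 0" for k
    using False by (intro path_gf_neg) auto
  ultimately show ?thesis by (simp only: mult_zero_right sum.neutral_const)
qed

lemma Phi_insert_odd:
  assumes z0: "z \<noteq> 0" and a: "1 \<le> a" "a \<le> H" and d: "d = 1 \<or> d = - 1" and e: "r (a - d) \<noteq> r a"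
    and T: "0 \<le> hT" "hT \<le> p'" "dT = 1 \<or> dT = - 1" and K: "L \<le> K"
  shows "Phi z p (p' + p) (lift r a d) (- d) (lift r hT dT) dT L m
    = z powi ((int L - int m)\<^sup>2 - (rho r hT dT - rho r a d)\<^sup>2)
      * (\<Sum>k\<le>K. qbin (z ^ 4) k (Suc m) * path_gf z r H hT dT (Suc m) a d (int L - int m - 2 * int k))"
proof -
  interpret B: band_insertion z r "odd_below p (p' + p)" H "p' + p - 1" hT dT
    by (rule band_insertion[OF z0 T])
  show ?thesis
  proof (cases "m \<le> L")
    case True
    define s where "s = L - m"
    have s: "Suc m + s = Suc L" "int s = int L - int m" using True by (auto simp: s_def)
    have s1: "int L + 1 - int m = int s + 1" using s by simp
    have "Phi z p (p' + p) (lift r a d) (- d) (lift r hT dT) dT L m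
      = z powi ((int s)\<^sup>2 - (rho r hT dT - rho r a d)\<^sup>2) * B.T (Suc m) a d (int s)"
      unfolding Phi_def s1 using B.insert_odd[OF a d e, of m s] unfolding s(1) by simp
    also have "B.T (Suc m) a d (int s) = (\<Sum>k\<le>K. qbin (z ^ 4) k (Suc m) * path_gf z r H hT dT (Suc m) a d (int s - 2 * int k))"
      unfolding B.T_def by (rule qbin_sum_extend) (use K s in linarith)
    finally show ?thesis unfolding s .
  next
    case False
    let ?r' = "odd_below p (p' + p)"
    \<comment> \<open>The first vertex lies between an odd band ahead and an even band behind, hence
      always scores; so at most \<open>L\<close> vertices fail to score.\<close>
    have "score ?r' (lift r a d) (- d) f = 1" if "f \<in> {1, - 1}" for f
    proof -
      have "?r' (lift r a d - d) \<noteq> ?r' (lift r a d)"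
        using B.behind_odd[OF a d e] B.r'_x[OF a d] e by metis
      moreover have "?r' (lift r a d + d) = ?r' (lift r a d)"
        using B.r'_xd[OF a d] B.r'_x[OF a d] by metis
      ultimately show ?thesis using that d by (auto simp: score_def)
    qed
    then have "path_gf z ?r' (p' + p - 1) (lift r hT dT) dT (Suc L) (lift r a d) (- d) (int L + 1 - int m) = 0"
      using False by (simp add: path_gf_neg)
    moreover have "path_gf z r H hT dT (Suc m) a d (int L - int m - 2 * int k) = 0" for k
      using False by (intro path_gf_neg) auto
    ultimately show ?thesis unfolding Phi_def by (simp only: mult_zero_right sum.neutral_const)
  qed
qed

end

declare path_gf.simps(2) [simp del] qbin.simps [simp del]

lemma sum_of_bool_even:
  fixes c :: int
  assumes "0 \<le> c" "c \<le> int K"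
  shows "(\<Sum>k\<le>K. of_bool (c - 2 * int k = 0)) = (of_bool (even c) :: 'a::semiring_1)"
proof (cases "even c")
  case True
  then obtain k where "c = 2 * k" by blast
  then obtain n where n: "c = 2 * int n" using assms by (metis mult_le_0_iff nat_0_le not_le zero_le_mult_iff zero_less_numeral)
  have "(\<Sum>k\<le>K. of_bool (c - 2 * int k = 0)) = (\<Sum>k\<le>K. if k = n then 1 else 0 :: 'a)"
    by (intro sum.cong) (auto simp: n)
  also have "\<dots> = 1" using n assms by (subst sum.delta) auto
  finally show ?thesis using True by simp
next
  case False
  then have "c - 2 * int k \<noteq> 0" for k by auto
  then show ?thesis using False by simp
qed

section \<open>The step without a break: insertion alone\<close>

context model
begin

text \<open>\<open>fl\<close> and \<open>fr\<close> mark an end that leaves the boundary at this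
  level. Its direction is turned outwards before the insertion, which makes its lift move away from
  the boundary instead of staying there. Every turn shifts the number of scoring vertices by one;
  \<open>f\<close> collects these shifts in the parity condition and in the top entry.\<close>

lemma nonbreak_step:
  fixes L m :: nat
  assumes z: "generic z" and H2: "2 \<le> H" and a: "1 \<le> a" "a \<le> H" and d: "d = 1 \<or> d = - 1"
    and T: "0 \<le> hT" "hT \<le> p'" "dT = 1 \<or> dT = - 1"
    and ad: "ad = (if fl then - d else d)" and e: "r (a - ad) = r a"
    and gT: "gT = (if fr then end_h bR H - sg bR else hT)" and eT: "eT = (if fr then - sg bR else dT)"
    and fl: "fl \<Longrightarrow> a = end_h bL H \<and> d = - sg bL \<and> r (a - sg bL) = r a \<and> r (a + sg bL) = r a \<and> hT \<noteq> a - sg bL"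
    and fr: "fr \<Longrightarrow> hT = end_h bR H + sg bR \<and> dT = sg bR \<and> r (end_h bR H + sg bR) = r (end_h bR H)"
    and afr: "fr \<Longrightarrow> \<not> fl \<Longrightarrow> a \<noteq> end_h bR H \<or> d = - sg bR"
  defines "f \<equiv> of_bool fl + of_bool fr"
  shows "Phi z p (p' + p) (lift r a ad + ad) ad (lift r gT eT) eT L m
    = z powi ((int L - int m)\<^sup>2 - (rho r gT eT - rho r a ad - ad)\<^sup>2
        - (if fr then 2 * (int m + 1 - end_dist bR H a) else 0))
      * (\<Sum>n\<in>{n. n \<le> m + 1 \<and> even (L + n + f)}.
          gauss' (z ^ 4) ((int L + int n + int f) div 2) (int m) * Phi z p p' a d hT dT m n)"
proof -
  have z0: "z \<noteq> 0" using z by (simp add: generic_def)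
  have q: "generic (z ^ 4)" using z by (rule generic_power) simp
  define G where "G S = path_gf z r H hT dT (Suc m) a d S" for S
  define G' where "G' S = path_gf z r H gT eT (Suc m) a ad S" for S
  define w where "w = (if fr then 2 * (int m + 1 - end_dist bR H a) else 0)"
  let ?K = "L + 1 + f"
  have ad': "ad = 1 \<or> ad = - 1" using d ad by auto
  have T': "0 \<le> gT" "gT \<le> p'" "eT = 1 \<or> eT = - 1"
    using T p by (auto simp: gT eT end_h_def sg_def)
  have 1: "Phi z p (p' + p) (lift r a ad + ad) ad (lift r gT eT) eT L m
    = z powi ((int L - int m)\<^sup>2 - (rho r gT eT - rho r a ad - ad)\<^sup>2)
      * (\<Sum>k\<le>?K. qbin (z ^ 4) k (Suc m) * G' (int L + 1 - int m - 2 * int k))"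
    unfolding G'_def by (rule Phi_insert_even[OF z0 a ad' e T']) simp
  have GP: "G (int m + 1 - int n) = Phi z p p' a d hT dT m n" for n
    by (simp add: G_def Phi_def)
  have S0: "(\<Sum>k\<le>?K. qbin (z ^ 4) k (Suc m) * G (int L + 1 - int m + int f - 2 * int k))
    = (\<Sum>n\<in>{n. n \<le> m + 1 \<and> even (L + n + f)}.
          gauss' (z ^ 4) ((int L + int n + int f) div 2) (int m) * Phi z p p' a d hT dT m n)"
    unfolding GP[symmetric]
  proof (rule qbin_sum_even[OF q])
    fix S assume "S < 0 \<or> S > int m + 1"
    then show "G S = 0" unfolding G_def by (auto intro: path_gf_neg path_gf_gt simp del: path_gf.simps)
  qed simp
  have S1: "z powi (- w) * (\<Sum>k\<le>?K. qbin (z ^ 4) k (Suc m) * G (int L + 1 - int m + int f - 2 * int k))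
    = (\<Sum>k\<le>?K. qbin (z ^ 4) k (Suc m) * G' (int L + 1 - int m - 2 * int k))"
  proof (cases "fl \<and> fr \<and> bL = bR \<and> m = 0")
    case False
    have left: "path_gf z r H hT dT (Suc m) a ad S = G (S + of_bool fl)" for S
    proof (cases fl)
      case True
      then have f': "a = end_h bL H" "d = - sg bL" "r (a - sg bL) = r a" "r (a + sg bL) = r a" "hT \<noteq> a - sg bL"
        using fl by auto
      show ?thesis unfolding G_def
        using path_gf_flip_left[of r bL H hT z dT m S] f' True ad by simp
    qed (simp add: G_def ad)
    have rel: "G' S = z powi (- w) * G (S + int f)" for S
    proof (cases fr)
      case True
      have c: "ad = - sg bR \<or> a \<noteq> end_h bR H \<or> 2 \<le> Suc m"
      proof (cases fl)
        case fl': True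
        then show ?thesis using False True fl[OF fl'] H2
          by (cases bL; cases bR; cases m) (auto simp: end_h_def sg_def)
      qed (use afr True ad in auto)
      have "path_gf z r H (end_h bR H + sg bR) (sg bR) (Suc m) a ad (S + 1)
        = z powi (2 * (int (Suc m) - end_dist bR H a)) * path_gf z r H (end_h bR H - sg bR) (- sg bR) (Suc m) a ad S"
        by (rule path_gf_flip_right[OF z0]) (use r_0 r_1 r_top fr[OF True] c ad' in auto)
      then have "G (S + 1 + of_bool fl) = z powi w * G' S"
        using left[of "S + 1"] fr[OF True] True by (simp add: G'_def gT eT w_def algebra_simps del: path_gf.simps)
      then have "z powi (- w) * G (S + int f) = z powi (- w) * (z powi w * G' S)"
        using True by (simp add: f_def algebra_simps)
      also have "\<dots> = G' S" using z0 by (simp add: power_int_minus)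
      finally show ?thesis by simp
    next
      case False
      then show ?thesis using left[of S] by (simp add: G'_def gT eT w_def f_def del: path_gf.simps)
    qed
    show ?thesis unfolding rel sum_distrib_left
      by (intro sum.cong refl) (simp add: algebra_simps del: qbin.simps)
  next
    case True
    \<comment> \<open>The remaining case is a single step from a boundary height with both ends
      turned there, which \<open>path_gf_flip_right\<close> excludes. Both generating functions are
      computed outright.\<close>
    then have t: fl fr "bL = bR" "m = 0" by auto
    have F: "a = end_h bR H" "d = - sg bR" "hT = a + sg bR" "dT = sg bR" "r (a - sg bR) = r a" "r (a + sg bR) = r a"
      using fl[OF t(1)] fr[OF t(2)] t(3) by auto
    have w0: "w = 0" using t F by (simp add: w_def end_dist_def end_h_def)
    have f2: "f = 2" using t by (simp add: f_def)
    have s: "- sg bR \<noteq> sg bR" "sg bR \<noteq> - sg bR" using sg_pm[of bR] by auto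
    have P0: "path_gf z r H (a + h) h (Suc 0) a (- h) S = of_bool (S = 1)"
      if h: "h = 1 \<or> h = - 1" "r (a + h) = r a" for h S
    proof -
      have "Phi z p p' a (- h) (a + h) h 0 (nat (1 - S)) = of_bool (nat (1 - S) = 0)"
        unfolding Phi_0[OF h(1)] using a h by (auto simp: score_def)
      then show ?thesis
      proof (cases "S \<le> 1")
        case True
        then show ?thesis using \<open>Phi z p p' a (- h) (a + h) h 0 (nat (1 - S)) = _\<close>
          by (simp add: Phi_def del: path_gf.simps)
      qed (simp add: path_gf_gt del: path_gf.simps)
    qed
    have G: "G S = of_bool (S = 1)" for S
      unfolding G_def t(4) F(2-4) using P0[OF sg_pm F(6)] .
    have G': "G' S = of_bool (S = 1)" for S
    proof -
      have "G' S = path_gf z r H (a + - sg bR) (- sg bR) (Suc 0) a (- (- sg bR)) S"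
        unfolding G'_def t(4) gT eT ad F(2) using t F(1) by simp
      also have "\<dots> = of_bool (S = 1)" by (rule P0) (use sg_pm[of bR] F(5) in auto)
      finally show ?thesis .
    qed
    have qb: "qbin (z ^ 4) k (Suc 0) = 1" for k using qbin_bottom[of "z ^ 4" k] by simp
    have e1: "(of_bool (int L + 1 - int 0 + int f - 2 * int k = 1) :: 'a) = of_bool (int L + 2 - 2 * int k = 0)" for k
      by (simp add: f2)
    have e2: "(of_bool (int L + 1 - int 0 - 2 * int k = 1) :: 'a) = of_bool (int L - 2 * int k = 0)" for k
      by simp
    have "(\<Sum>k\<le>?K. of_bool (int L + 2 - 2 * int k = 0)) = (of_bool (even (int L + 2)) :: 'a)"
      by (rule sum_of_bool_even) (auto simp: f2)
    moreover have "(\<Sum>k\<le>?K. of_bool (int L - 2 * int k = 0)) = (of_bool (even (int L)) :: 'a)"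
      by (rule sum_of_bool_even) (auto simp: f2)
    ultimately show ?thesis unfolding G G' t(4) qb w0 e1 e2 mult_1 by simp
  qed
  have mp: "z powi (i - w) * x = z powi i * (z powi (- w) * x)" for i x
    using z0 by (simp flip: power_int_add mult.assoc)
  show ?thesis unfolding 1 S1[symmetric] S0 w_def[symmetric] mp ..
qed

end

text \<open>The (1, 3)-model arises by insertion from the (1, 2)-model, which has one height only.
  There a path has a single step, so \<open>m = 0\<close>, and all that remains of the particle sum
  is a parity condition on \<open>L\<close>.\<close>

lemma base_step:
  fixes z :: "'a::field"
  assumes z: "generic z" and d: "d = 1 \<or> d = - 1" and f: "f = 1 \<or> f = - 1"
  shows "Phi z 1 3 (lift (\<lambda>_. 0) 1 d + d) d (lift (\<lambda>_. 0) (1 + f) f) f L m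
    = z powi ((int L)\<^sup>2 - (of_bool (f = - 1) - of_bool (d = 1))\<^sup>2) * of_bool (m = 0 \<and> even (L + of_bool (f = d)))"
proof -
  have z0: "z \<noteq> 0" using z by (simp add: generic_def)
  interpret model 1 2 by unfold_locales auto
  have r: "odd_below 1 2 h = 0" if "0 \<le> h" "h \<le> 2" for h
  proof -
    have "h = 0 \<or> h = 1 \<or> h = 2" using that by auto
    then show ?thesis by (auto simp: odd_below_def)
  qed
  have l: "lift (\<lambda>_. 0) 1 d = lift (odd_below 1 2) 1 d" "lift (\<lambda>_. 0) (1 + f) f = lift (odd_below 1 2) (1 + f) f"
    using d f by (auto simp: lift_def rho_def r)
  have rho: "rho (odd_below 1 2) (1 + f) f - rho (odd_below 1 2) 1 d - d = of_bool (f = - 1) - of_bool (d = 1)"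
    using d f by (auto simp: rho_def r)
  let ?g = "path_gf z (odd_below 1 2) (2 - 1) (1 + f) f (Suc m) 1 d"
  have 1: "Phi z 1 (2 + 1) (lift (odd_below 1 2) 1 d + d) d (lift (odd_below 1 2) (1 + f) f) f L m
    = z powi ((int L - int m)\<^sup>2 - (of_bool (f = - 1) - of_bool (d = 1))\<^sup>2)
      * (\<Sum>k\<le>L + 1. qbin (z ^ 4) k (Suc m) * ?g (int L + 1 - int m - 2 * int k))"
    unfolding rho[symmetric] by (rule Phi_insert_even[OF z0]) (use d f r in auto)
  have 2: "(\<Sum>k\<le>L + 1. qbin (z ^ 4) k (Suc m) * ?g (int L + 1 - int m - 2 * int k))
     = of_bool (m = 0 \<and> even (L + of_bool (f = d)))"
  proof (cases m)
    case 0
    have "?g S = of_bool (S = of_bool (f \<noteq> d))" for S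
    proof (cases "S \<le> 1")
      case True
      have "?g S = Phi z 1 2 1 d (1 + f) f 0 (nat (1 - S))" using True 0 by (simp add: Phi_def del: path_gf.simps)
      also have "\<dots> = of_bool (S = of_bool (f \<noteq> d))"
        unfolding Phi_0[OF f] using True d f by (auto simp: score_def r)
      finally show ?thesis .
    qed (simp add: 0 path_gf_gt del: path_gf.simps)
    then have "(\<Sum>k\<le>L + 1. qbin (z ^ 4) k (Suc m) * ?g (int L + 1 - int m - 2 * int k))
       = (\<Sum>k\<le>L + 1. of_bool (int L + of_bool (f = d) - 2 * int k = 0))"
      using qbin_bottom[of "z ^ 4"] unfolding 0 by (intro sum.cong refl) (auto simp del: qbin.simps)
    also have "\<dots> = of_bool (even (int L + of_bool (f = d)))"
      by (rule sum_of_bool_even) auto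
    finally show ?thesis using 0 by simp
  next
    case (Suc m')
    have "?g S = 0" for S
      using d f by (cases m') (auto simp: Suc sum_pm path_gf.simps(2) simp del: sum.insert)
    then show ?thesis using Suc by (simp del: qbin.simps path_gf.simps)
  qed
  show ?thesis unfolding l using 1 unfolding 2 by (cases "m = 0") simp_all
qed

section \<open>The step at a break: duality followed by insertion\<close>

context model
begin

lemma Phi_dual:
  assumes z: "z \<noteq> 0" and a: "1 \<le> a" "a \<le> H" "1 \<le> a - d" "a - d \<le> H" and d: "d = 1 \<or> d = - 1"
    and T: "1 \<le> hT" "hT \<le> H" "dT = 1 \<or> dT = - 1"
  shows "path_gf z (odd_below (p' - p) p') H hT dT (Suc m) a d S
    = z powi ((int m)\<^sup>2 - (hT - dT - a)\<^sup>2) * path_gf (inverse z) r H hT dT (Suc m) a d (int m + 1 - S)"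
proof -
  have "path_gf z (odd_below (p' - p) p') H hT dT (Suc m) a d (int (Suc m) - (int m + 1 - S))
    = z powi ((int (Suc m) - 1)\<^sup>2 - (hT - dT - a)\<^sup>2) * path_gf (inverse z) r H hT dT (Suc m) a d (int m + 1 - S)"
    by (rule path_gf_dual[OF z _ _ T a d]) (use r_dual r_step in auto)
  then show ?thesis by simp
qed

text \<open>\<open>A\<close> and \<open>B\<close> are the potentials of the two ends in the dual
  model. The lift of an end at the boundary lands one height too far inside; the corrections by
  \<open>sg\<close> belong to the end that is put back at the boundary.\<close>

lemma break_heights:
  assumes p3: "3 \<le> p'" and flat: "r 2 = 0" "r (H - 1) = r H"
    and a: "1 \<le> a" "a \<le> H" "1 \<le> a - d" "a - d \<le> H" and d: "d = 1 \<or> d = - 1"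
    and T: "1 \<le> hT" "hT \<le> H" "1 \<le> hT - dT" "hT - dT \<le> H" and dT: "dT = 1 \<or> dT = - 1"
    and xl: "xl \<Longrightarrow> a = end_h bL H \<and> d = - sg bL"
    and xr: "xr \<Longrightarrow> hT = end_h bR H + sg bR \<and> dT = sg bR"
    and P: "P = p' - p" and rD: "rD = odd_below P p'" and Q: "Q = p' + P" and r': "r' = odd_below P Q"
    and a2: "a2 = (if xl then end_h bL (Q - 1) else lift rD a d)"
    and d2: "d2 = (if xl then - sg bL else - d)"
    and h2: "h2 = (if xr then end_h bR (Q - 1) + sg bR else lift rD hT dT)"
    and A: "A = rho rD a d" and B: "B = rho rD hT dT"
  shows "rD 1 = 0" "rD 2 = 1" "rD H = P - 1" "rD (H - 1) = P - 2"
    "r' 1 = 0" "r' (Q - 1) = P - 1" "r' Q = P - 1" "r' 2 = 0" "r' 3 = 1" "r' (Q - 2) = P - 1" "r' (Q - 3) = P - 2"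
    "1 \<le> A" "A \<le> P - 1" "1 \<le> B" "B \<le> P - 1" "4 \<le> Q - 1"
    "lift rD a d = a + A" "lift rD hT dT = hT + B"
    "rho r' a2 d2 + d2 = A - (if xl then sg bL else 0)"
    "rho r' h2 dT = B - (if xr then sg bR else 0)"
    "xl \<Longrightarrow> A = (if bL then 1 else P - 1) \<and> a + A = end_h bL (Q - 1) + sg bL"
    "xr \<Longrightarrow> B = (if bR then 1 else P - 1) \<and> hT + B = end_h bR (Q - 1) + 2 * sg bR"
proof -
  interpret D: model P p' unfolding P by (rule model_dual)
  interpret M': model P Q unfolding Q by (rule D.model_insert)
  have T0: "0 \<le> hT" "hT \<le> p'" using T by auto
  interpret B: band_insertion 1 rD r' "p' - 1" "p' + P - 1" hT dT
    unfolding rD r' Q by (rule D.band_insertion[OF _ T0 dT]) simp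
  have H2: "2 \<le> H" using p3 by simp
  show rDv: "rD 1 = 0" "rD 2 = 1" "rD H = P - 1" "rD (H - 1) = P - 2"
    using r_dual[of 1] r_dual[of 2] r_dual[of H] r_dual[of "H - 1"] r_1 r_top flat p3 p
    by (auto simp: rD P)
  have Q': "Q = p' + P" by (rule Q)
  show r'v: "r' 1 = 0" "r' (Q - 1) = P - 1" "r' Q = P - 1" "r' 2 = 0" "r' 3 = 1" "r' (Q - 2) = P - 1" "r' (Q - 3) = P - 2"
  proof -
    show "r' 1 = 0" "r' (Q - 1) = P - 1" "r' Q = P - 1" using M'.r_1 M'.r_top by (auto simp: r')
    have "lift rD 1 (- 1) = 2" "lift rD 2 1 = 3" "lift rD H 1 = Q - 2" "lift rD (H - 1) (- 1) = Q - 3"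
      using rDv by (auto simp: lift_def rho_def Q')
    then show "r' 2 = 0" "r' 3 = 1" "r' (Q - 2) = P - 1" "r' (Q - 3) = P - 2"
      using B.r'_lift[of 1 "- 1"] B.r'_lift[of 2 1] B.r'_lift[of H 1] B.r'_lift[of "H - 1" "- 1"] rDv p3
      by auto
  qed
  have rho_bd: "1 \<le> rho rD h e \<and> rho rD h e \<le> P - 1" if "1 \<le> h" "h \<le> H" "1 \<le> h - e" "h - e \<le> H" "e = 1 \<or> e = - 1" for h e
    using that(5)
  proof
    assume e: "e = 1"
    have "rD 2 \<le> rD h" "rD h \<le> rD H" using B.r_mono[of 2 h] B.r_mono[of h H] that e by auto
    then show ?thesis using e rDv by (simp add: rho_def)
  next
    assume e: "e = - 1"
    have "rD 1 \<le> rD h" "rD h \<le> rD (H - 1)" using B.r_mono[of 1 h] B.r_mono[of h "H - 1"] that e by auto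
    then show ?thesis using e rDv by (simp add: rho_def)
  qed
  show Ab: "1 \<le> A" "A \<le> P - 1" using rho_bd[OF a d] by (auto simp: A)
  show Bb: "1 \<le> B" "B \<le> P - 1" using rho_bd[OF T dT] by (auto simp: B)
  show a1: "lift rD a d = a + A" by (simp add: lift_def A)
  show h1: "lift rD hT dT = hT + B" by (simp add: lift_def B)
  have r'a: "r' (a + A) = rD a" using B.r'_lift[of a d] a d a1 by auto
  have r'h: "r' (hT + B) = rD hT" using B.r'_lift[of hT dT] T dT h1 by auto
  have xlv: "A = (if bL then 1 else P - 1)" "a + A = end_h bL (Q - 1) + sg bL" "a = end_h bL H" "d = - sg bL" if xl
    using xl[OF that] rDv by (auto simp: A end_h_def sg_def rho_def Q')
  have xrv: "B = (if bR then 1 else P - 1)" "hT + B = end_h bR (Q - 1) + 2 * sg bR" "hT - dT = end_h bR H" "dT = sg bR" if xr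
    using xr[OF that] rDv by (auto simp: B end_h_def sg_def rho_def Q')
  show RA: "rho r' a2 d2 + d2 = A - (if xl then sg bL else 0)"
  proof (cases xl)
    case True
    then show ?thesis using xlv[OF True] r'v by (auto simp: a2 d2 rho_def end_h_def sg_def)
  next
    case False
    then have "a2 = a + A" "d2 = - d" using a1 by (auto simp: a2 d2)
    then show ?thesis using r'a d False by (auto simp: rho_def A)
  qed
  show RB: "rho r' h2 dT = B - (if xr then sg bR else 0)"
  proof (cases xr)
    case True
    then show ?thesis using xrv[OF True] r'v by (auto simp: h2 rho_def end_h_def sg_def)
  next
    case False
    then have "h2 = hT + B" using h1 by (auto simp: h2)
    then show ?thesis using r'h False by (auto simp: rho_def B)
  qed
  show "4 \<le> Q - 1" using p p3 flat r_top H2 rDv B.r_mono[of 2 H] unfolding Q' by auto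
  show "xl \<Longrightarrow> A = (if bL then 1 else P - 1) \<and> a + A = end_h bL (Q - 1) + sg bL" using xlv by blast
  show "xr \<Longrightarrow> B = (if bR then 1 else P - 1) \<and> hT + B = end_h bR (Q - 1) + 2 * sg bR" using xrv by blast
qed

text \<open>The even band behind the start is odd in the dual model, so
  \<open>Phi_insert_odd\<close> applies. An end that has to remain at the boundary is lifted one
  height too far; prolonging the path by one step there puts it back. \<open>x\<close> counts these
  prolongations, so the inserted paths have length \<open>L - x\<close>.\<close>

lemma break_step:
  fixes L m :: nat
  assumes z: "generic z" and p3: "3 \<le> p'" and flat: "r 2 = 0" "r (H - 1) = r H"
    and a: "1 \<le> a" "a \<le> H" "1 \<le> a - d" "a - d \<le> H" and d: "d = 1 \<or> d = - 1" and ev: "r (a - d) = r a"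
    and T: "1 \<le> hT" "hT \<le> H" "1 \<le> hT - dT" "hT - dT \<le> H" and dT: "dT = 1 \<or> dT = - 1"
    and xl: "xl \<Longrightarrow> a = end_h bL H \<and> d = - sg bL"
    and xr: "xr \<Longrightarrow> hT = end_h bR H + sg bR \<and> dT = sg bR"
    and x: "x = (of_bool xl + of_bool xr :: nat)"
    and bound: "\<And>n. Phi (inverse z) p p' a d hT dT m n \<noteq> 0 \<Longrightarrow> n + x \<le> m + 1 \<or> m = 0 \<and> n = 0"
    and rD: "rD = odd_below (p' - p) p'" and Q: "Q = p' + (p' - p)" and r': "r' = odd_below (p' - p) Q"
    and a2: "a2 = (if xl then end_h bL (Q - 1) else lift rD a d)"
    and d2: "d2 = (if xl then - sg bL else - d)"
    and h2: "h2 = (if xr then end_h bR (Q - 1) + sg bR else lift rD hT dT)"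
  shows "Phi z (p' - p) Q a2 d2 h2 dT L m
    = z powi ((int L - int m)\<^sup>2 - (rho r' h2 dT - rho r' a2 d2 - d2)\<^sup>2
        + (if xr then 2 * sg bR * (hT - dT - a) + 2 * int m else 0))
      * (\<Sum>n\<in>{n. n \<le> m + 1 \<and> even (int L - int x + int m - int n)}.
          gauss' (z ^ 4) ((int L - int x + int m - int n) div 2) (int m)
          * (z powi ((int m)\<^sup>2 - (hT - dT - a)\<^sup>2) * Phi (inverse z) p p' a d hT dT m n))" (is ?main)
proof -
  define P where "P = p' - p"
  have z0: "z \<noteq> 0" using z by (simp add: generic_def)
  have q: "generic (z ^ 4)" using z by (rule generic_power) simp
  interpret D: model P p' unfolding P_def by (rule model_dual)
  have T0: "0 \<le> hT" "hT \<le> p'" using T by auto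
  have H2: "2 \<le> H" using p3 by simp
  define A where "A = rho rD a d"
  define B where "B = rho rD hT dT"
  define \<alpha> where "\<alpha> = hT - dT - a"
  have Q': "Q = p' + P" by (simp add: Q P_def)
  note heights = break_heights[OF p3 flat a d T dT xl xr P_def rD[folded P_def] Q' r'[folded P_def] a2 d2 h2 A_def B_def]
  note rDv = heights(1-4) and r'v = heights(5-11) and Ab = heights(12,13) and Bb = heights(14,15)
    and a1 = heights(17) and h1 = heights(18) and RA = heights(19) and RB = heights(20)
  have xlv: "A = (if bL then 1 else P - 1)" "a + A = end_h bL (Q - 1) + sg bL" "a = end_h bL H" "d = - sg bL" if xl
    using that xl heights(21) by auto
  have xrv: "B = (if bR then 1 else P - 1)" "hT + B = end_h bR (Q - 1) + 2 * sg bR" "hT - dT = end_h bR H" "dT = sg bR" if xr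
    using that xr heights(22) by auto
  define G where "G n = path_gf (inverse z) r H hT dT (Suc m) a d (int m + 1 - n)" for n
  have GP: "G (int n) = Phi (inverse z) p p' a d hT dT m n" for n by (simp add: G_def Phi_def)
  have G0: "G n = 0" if "n < 0 \<or> n > int m + 1" for n
    using that unfolding G_def by (auto intro: path_gf_neg path_gf_gt)
  have rDne: "rD (a - d) \<noteq> rD a"
    using r_dual[of a] r_dual[of "a - d"] a d ev by (auto simp: rD)
  have plain: "Phi z P Q (a + A) (- d) (hT + B) dT L' m
    = z powi ((int L' - int m)\<^sup>2 - (B - A)\<^sup>2) * (z powi ((int m)\<^sup>2 - \<alpha>\<^sup>2) * (\<Sum>k\<le>K. qbin (z ^ 4) k (Suc m) * G (int L' - int m - 2 * int k)))"
    if "L' \<le> K" for L' K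
  proof -
    have "Phi z P (p' + P) (lift D.r a d) (- d) (lift D.r hT dT) dT L' m
      = z powi ((int L' - int m)\<^sup>2 - (rho D.r hT dT - rho D.r a d)\<^sup>2)
        * (\<Sum>k\<le>K. qbin (z ^ 4) k (Suc m) * path_gf z D.r H hT dT (Suc m) a d (int L' - int m - 2 * int k))"
      by (rule D.Phi_insert_odd[OF z0 a(1,2) d _ T0 dT that]) (use rDne in \<open>simp add: rD P_def\<close>)
    moreover have "path_gf z D.r H hT dT (Suc m) a d S = z powi ((int m)\<^sup>2 - \<alpha>\<^sup>2) * G (int m + 1 - (int m + 1 - S))" for S
      using Phi_dual[OF z0 a d T(1,2) dT, of m S] by (simp add: P_def G_def \<alpha>_def)
    moreover have "D.r = rD" by (simp add: rD P_def)
    ultimately show ?thesis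
      using a1 h1 by (simp add: Q' A_def[symmetric] B_def[symmetric] sum_distrib_left algebra_simps)
  qed
  define l where "l = int L - int x"
  define RS where "RS = (\<Sum>n\<in>{n. n \<le> m + 1 \<and> even (l + int m - int n)}.
          gauss' (z ^ 4) ((l + int m - int n) div 2) (int m) * G (int n))"
  define w where "w = (if xr then 2 * sg bR * \<alpha> + 2 * int m else 0)"
  define \<beta> where "\<beta> = (B - (if xr then sg bR else 0)) - (A - (if xl then sg bL else 0))"
  have goal: "?main \<longleftrightarrow> Phi z P Q a2 d2 h2 dT L m
     = z powi ((int L - int m)\<^sup>2 - \<beta>\<^sup>2 + w) * (z powi ((int m)\<^sup>2 - \<alpha>\<^sup>2) * RS)"
  proof -
    have "rho r' h2 dT - rho r' a2 d2 - d2 = \<beta>" using RA RB by (simp add: \<beta>_def)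
    then show ?thesis
      unfolding RS_def sum_distrib_left GP l_def \<alpha>_def[symmetric] P_def[symmetric] w_def[symmetric]
      by (simp add: algebra_simps)
  qed
  have x2: "x \<le> 2" by (simp add: x)
  \<comment> \<open>In the excluded case the left side contains the Gaussian with top -1 and bottom
    0, which is 1, while no number \<open>k\<close> of particles matches it on the right.\<close>
  have RS: "RS = (\<Sum>k\<le>L. qbin (z ^ 4) k (Suc m) * G (l - int m - 2 * int k))" if "\<not> (x = 2 \<and> L = 0 \<and> m = 0)"
    unfolding RS_def
  proof (rule qbin_sum_odd[OF q, symmetric])
    fix n assume n: "n \<le> m + 1" "even (l + int m - int n)" "G (int n) \<noteq> 0"
    from bound[of n] n(3) have "n + x \<le> m + 1 \<or> m = 0 \<and> n = 0" by (simp add: GP)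
    then show "0 \<le> l + int m - int n"
    proof
      assume "n + x \<le> m + 1"
      then have "- 1 \<le> l + int m - int n" by (simp add: l_def)
      moreover have "l + int m - int n \<noteq> - 1" using n(2) by (metis odd_one even_minus)
      ultimately show ?thesis by linarith
    next
      assume mn: "m = 0 \<and> n = 0"
      have "l \<noteq> - 1" using n(2) mn by (auto)
      moreover have "l \<noteq> - 2" using that mn x2 by (auto simp: l_def)
      moreover have "- 2 \<le> l" using x2 by (simp add: l_def)
      ultimately show ?thesis using mn by auto
    qed
  qed (use G0 in \<open>auto simp: l_def\<close>)
  have RS0: "RS = 0" if "\<not> (x = 2 \<and> L = 0 \<and> m = 0)" "L < x"
  proof -
    have "G (l - int m - 2 * int k) = 0" for k using that(2) by (intro G0) (simp add: l_def)
    then show ?thesis unfolding RS[OF that(1)] by simp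
  qed
  have H': "1 \<le> Q - 1" "2 \<le> Q - 1" "4 \<le> Q - 1" using heights(16) by auto
  have EL: "Phi z P Q (end_h b (Q - 1)) (- sg b) hh dd (Suc k) m
     = z powi (2 * (int (Suc k) - int m - (if b then rho r' hh dd else P - rho r' hh dd)))
       * Phi z P Q (end_h b (Q - 1) + sg b) (sg b) hh dd k m" if "dd = 1 \<or> dd = - 1" for b hh dd k
  proof -
    have e: "int (Suc k) + 1 - int m = (int k + 1 - int m) + 1" by simp
    have "path_gf z r' (Q - 1) hh dd (Suc (Suc k)) (end_h b (Q - 1)) (- sg b) ((int k + 1 - int m) + 1)
      = z powi (2 * ((int k + 1 - int m) - (if b then rho r' hh dd else r' (Q - 1) + 1 - rho r' hh dd)))
        * path_gf z r' (Q - 1) hh dd (Suc k) (end_h b (Q - 1) + sg b) (sg b) (int k + 1 - int m)"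
      by (rule path_gf_ext_left) (use r'v H' that in \<open>auto simp: end_h_def sg_def\<close>)
    then show ?thesis unfolding Phi_def e r'[symmetric, folded P_def] by (simp add: r'v algebra_simps)
  qed
  have ER: "Phi z P Q aa dd (end_h b (Q - 1) + sg b) (sg b) (Suc k) m
     = z powi (2 * (int (Suc k) + 1 - end_dist b (Q - 1) aa))
       * Phi z P Q aa dd (end_h b (Q - 1) + 2 * sg b) (sg b) k m" if "dd = 1 \<or> dd = - 1" for b aa dd k
  proof -
    have e: "int (Suc k) + 1 - int m = (int k + 1 - int m) + 1" by simp
    have "path_gf z r' (Q - 1) (end_h b (Q - 1) + sg b) (sg b) (Suc (Suc k)) aa dd ((int k + 1 - int m) + 1)
      = z powi (2 * (int (Suc k) + 1 - end_dist b (Q - 1) aa))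
        * path_gf z r' (Q - 1) (end_h b (Q - 1) + 2 * sg b) (sg b) (Suc k) aa dd (int k + 1 - int m)"
      by (rule path_gf_ext_right[OF z0]) (use r'v H' that in \<open>auto simp: end_h_def sg_def\<close>)
    then show ?thesis unfolding Phi_def e r'[symmetric, folded P_def] .
  qed
  have mp: "z powi i * (z powi j * w) = z powi (i + j) * w" for i j w
    using z0 by (simp add: power_int_add)
  \<comment> \<open>Whatever prolongations take place, it suffices to know their total power
    \<open>W\<close> of \<open>z\<close> and to check one identity between exponents.\<close>
  have main: "Phi z P Q a2 d2 h2 dT L m = z powi W * Phi z P Q (a + A) (- d) (hT + B) dT L0 m \<Longrightarrow>
     W + ((int L0 - int m)\<^sup>2 - (B - A)\<^sup>2) = (int L - int m)\<^sup>2 - \<beta>\<^sup>2 + w \<Longrightarrow> L = L0 + x \<Longrightarrow> ?main" for W L0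
  proof -
    assume 1: "Phi z P Q a2 d2 h2 dT L m = z powi W * Phi z P Q (a + A) (- d) (hT + B) dT L0 m"
      and 2: "W + ((int L0 - int m)\<^sup>2 - (B - A)\<^sup>2) = (int L - int m)\<^sup>2 - \<beta>\<^sup>2 + w" and 3: "L = L0 + x"
    have l: "l = int L0" using 3 by (simp add: l_def)
    have "RS = (\<Sum>k\<le>L. qbin (z ^ 4) k (Suc m) * G (int L0 - int m - 2 * int k))"
      using RS 3 unfolding l by auto
    then show ?thesis unfolding goal 1 plain[of L0 L, OF le_add1[of L0 x, folded 3]] mp 2[symmetric] by (simp add: add.assoc)
  qed
  have zero: "Phi z P Q a2 d2 h2 dT L m = 0 \<Longrightarrow> \<not> (x = 2 \<and> L = 0 \<and> m = 0) \<Longrightarrow> L < x \<Longrightarrow> ?main"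
    unfolding goal using RS0 by simp
  have E_ne: "end_h b (Q - 1) \<noteq> y" if "2 \<le> y" "y \<le> Q - 2" for b y
    using that by (auto simp: end_h_def)
  have a1_in: "2 \<le> a + A" "a + A \<le> Q - 2" using a Ab by (auto simp: Q')
  have b1_in: "2 \<le> hT + B - dT" "hT + B - dT \<le> Q - 2" using T Bb by (auto simp: Q')
  have P0: "Phi z P Q aa dd hh ee 0 k = 0" if "ee = 1 \<or> ee = - 1" "aa \<noteq> hh - ee" for aa dd hh ee k
    using Phi_0[OF that(1), of z P Q aa dd hh k] that(2) by auto
  show ?main
  proof (cases xl)
    case nl: False
    show ?thesis
    proof (cases xr)
      case False
      show ?thesis
        by (rule main[of 0 L]) (use nl False a1 h1 in \<open>simp_all add: a2 d2 h2 x \<beta>_def w_def\<close>)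
    next
      case True
      note v = xrv[OF True]
      show ?thesis
      proof (cases L)
        case 0
        show ?thesis
          by (rule zero) (use 0 nl True v a1 E_ne[OF a1_in, of bR] P0[OF dT] in \<open>auto simp: a2 d2 h2 x\<close>)
      next
        case (Suc k)
        show ?thesis
        proof (rule main[of "2 * (int (Suc k) + 1 - end_dist bR (Q - 1) (a + A))" k])
          have "a2 = a + A" "d2 = - d" "h2 = end_h bR (Q - 1) + sg bR" using nl True a1 by (auto simp: a2 d2 h2)
          then show "Phi z P Q a2 d2 h2 dT L m = z powi (2 * (int (Suc k) + 1 - end_dist bR (Q - 1) (a + A))) * Phi z P Q (a + A) (- d) (hT + B) dT k m"
            using ER[of "- d" "a + A" bR k] d v Suc by auto
          show "2 * (int (Suc k) + 1 - end_dist bR (Q - 1) (a + A)) + ((int k - int m)\<^sup>2 - (B - A)\<^sup>2)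
            = (int L - int m)\<^sup>2 - \<beta>\<^sup>2 + w"
            using nl True unfolding \<beta>_def w_def \<alpha>_def v(1,3) Q' Suc
            by (cases bR) (simp_all add: end_h_def end_dist_def sg_def power2_eq_square algebra_simps)
          show "L = k + x" using Suc nl True by (simp add: x)
        qed
      qed
    qed
  next
    case l: True
    note vl = xlv[OF l]
    show ?thesis
    proof (cases xr)
      case False
      show ?thesis
      proof (cases L)
        case 0
        show ?thesis
          by (rule zero) (use 0 l False h1 E_ne[OF b1_in, of bL] P0[OF dT] in \<open>auto simp: a2 d2 h2 x\<close>)
      next
        case (Suc k)
        show ?thesis
        proof (rule main[of "2 * (int (Suc k) - int m - (if bL then B else P - B))" k])
          have "a2 = end_h bL (Q - 1)" "d2 = - sg bL" "h2 = hT + B" "rho r' h2 dT = B"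
            using l False h1 RB by (auto simp: a2 d2 h2)
          then show "Phi z P Q a2 d2 h2 dT L m = z powi (2 * (int (Suc k) - int m - (if bL then B else P - B))) * Phi z P Q (a + A) (- d) (hT + B) dT k m"
            using EL[OF dT, of bL "hT + B" k] vl Suc by auto
          show "2 * (int (Suc k) - int m - (if bL then B else P - B)) + ((int k - int m)\<^sup>2 - (B - A)\<^sup>2)
            = (int L - int m)\<^sup>2 - \<beta>\<^sup>2 + w"
            using l False unfolding \<beta>_def w_def \<alpha>_def vl(1) Suc
            by (cases bL) (simp_all add: end_h_def end_dist_def sg_def power2_eq_square algebra_simps)
          show "L = k + x" using Suc l False by (simp add: x)
        qed
      qed
    next
      case rr: True
      note vr = xrv[OF rr]
      have v2: "a2 = end_h bL (Q - 1)" "d2 = - sg bL" "h2 = end_h bR (Q - 1) + sg bR"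
        using l rr by (auto simp: a2 d2 h2)
      consider "L = 0" "m \<noteq> 0" | "L = 0" "m = 0" | "L = Suc 0" | k where "L = Suc (Suc k)"
        by (metis not0_implies_Suc)
      then show ?thesis
      proof cases
        case 1
        have "Phi z P Q a2 d2 h2 dT L m = 0"
          unfolding 1 Phi_0[OF dT] using 1 vr v2 r'v r'[folded P_def] H' by (auto simp: score_def end_h_def sg_def split: if_splits)
        then show ?thesis by (rule zero) (use 1 in \<open>auto simp: x l rr\<close>)
      next
        case 2
        \<comment> \<open>The exceptional term. A path of length 0 exists exactly if both ends lie
          at the same boundary, although it cannot be obtained by two prolongations; the Gaussian
          with top -1 and bottom 0 supplies it.\<close>
        have lhs: "Phi z P Q a2 d2 h2 dT L m = of_bool (bL = bR)"
          unfolding 2 Phi_0[OF dT] using vr v2 r'v r'[folded P_def] H' by (auto simp: score_def end_h_def sg_def split: if_splits)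
        have "{n. n \<le> m + 1 \<and> even (l + int m - int n)} = {0}"
          using 2 l rr by (auto simp: l_def x le_Suc_eq)
        then have "RS = G 0" unfolding RS_def using 2 by simp
        also have "\<dots> = Phi (inverse z) p p' a d hT dT 0 0" using GP[of 0] 2 by simp
        also have "\<dots> = of_bool (bL = bR)"
          unfolding Phi_0[OF dT] using vl vr xr[OF rr] flat r_1 r_top H2 by (auto simp: score_def end_h_def sg_def split: if_splits)
        finally have rs: "RS = of_bool (bL = bR)" .
        show ?thesis
        proof (cases "bL = bR")
          case True
          then have "\<beta> = 0" "\<alpha> = 0" "w = 0" using vl vr l rr 2 by (auto simp: \<beta>_def \<alpha>_def w_def)
          then show ?thesis unfolding goal lhs rs using 2 by simp
        next
          case False
          then show ?thesis unfolding goal lhs rs by simp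
        qed
      next
        case 3
        have "Phi z P Q a2 d2 h2 dT L m = 0"
          unfolding 3 v2 EL[OF dT] using P0[OF dT] vr H' by (auto simp: end_h_def sg_def)
        then show ?thesis by (rule zero) (use 3 in \<open>auto simp: x l rr\<close>)
      next
        case (4 k)
        have "rho r' h2 dT = B - sg bR" using rr RB by simp
        then have EL': "Phi z P Q a2 d2 h2 dT L m = z powi (2 * (int L - int m - (if bL then B - sg bR else P - (B - sg bR))))
           * Phi z P Q (a + A) (- d) h2 dT (Suc k) m"
          unfolding 4 v2(1,2) using EL[OF dT, of bL h2 "Suc k"] vl by simp
        have ER': "Phi z P Q (a + A) (- d) h2 dT (Suc k) m = z powi (2 * (int (Suc k) + 1 - end_dist bR (Q - 1) (a + A)))
           * Phi z P Q (a + A) (- d) (hT + B) dT k m"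
          unfolding v2 using ER[of "- d" "a + A" bR k] d vr by auto
        show ?thesis
        proof (rule main[of "2 * (int L - int m - (if bL then B - sg bR else P - (B - sg bR))) + 2 * (int (Suc k) + 1 - end_dist bR (Q - 1) (a + A))" k])
          show "Phi z P Q a2 d2 h2 dT L m = z powi (2 * (int L - int m - (if bL then B - sg bR else P - (B - sg bR))) + 2 * (int (Suc k) + 1 - end_dist bR (Q - 1) (a + A))) * Phi z P Q (a + A) (- d) (hT + B) dT k m"
            unfolding EL' ER' mp ..
          show "2 * (int L - int m - (if bL then B - sg bR else P - (B - sg bR))) + 2 * (int (Suc k) + 1 - end_dist bR (Q - 1) (a + A))
             + ((int k - int m)\<^sup>2 - (B - A)\<^sup>2) = (int L - int m)\<^sup>2 - \<beta>\<^sup>2 + w"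
            using l rr unfolding \<beta>_def w_def \<alpha>_def vl(1,3) vr(1,3) Q' 4
            by (cases bL; cases bR) (simp_all add: end_h_def end_dist_def sg_def power2_eq_square algebra_simps)
          show "L = k + x" using 4 l rr by (simp add: x)
        qed
      qed
    qed
  qed
qed

end

section \<open>Fermionic forms\<close>

text \<open>\<open>gpre\<close> and \<open>gpost\<close> are the values of the gamma recursion at a
  level before and after the extra operation at a break, and \<open>al\<close> is its first
  component. \<open>g j\<close> stands for the number of ends still at the boundary at level
  \<open>j\<close>; through it the sum of the two vectors is known at all indices from 1 to
  \<open>t - 1\<close>.\<close>

locale fermionic =
  fixes t :: nat and brk :: "nat \<Rightarrow> bool" and uL uR :: "nat \<Rightarrow> int"
    and al gpre gpost :: "nat \<Rightarrow> int" and g :: "nat \<Rightarrow> nat"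
  assumes brk_t: "\<And>j. t \<le> j \<Longrightarrow> \<not> brk j"
    and gpost_same: "\<And>j. \<not> brk j \<Longrightarrow> gpost j = gpre j"
    and gpost_brk: "\<And>j. brk j \<Longrightarrow> gpost j = - (al j)\<^sup>2 - gpre j"
    and g2: "\<And>j. g j \<le> 2" and g_mono: "\<And>j. g j \<le> g (Suc j)"
    and u_nonbreak: "\<And>j. Suc j < t \<Longrightarrow> \<not> brk (Suc j) \<Longrightarrow> uL (Suc j) + uR (Suc j) = int (g (Suc j)) - int (g j)"
    and u_break: "\<And>j. Suc j < t \<Longrightarrow> brk (Suc j) \<Longrightarrow> uL (Suc j) + uR (Suc j) = - int (g j)"
begin

definition argv :: "bool \<Rightarrow> int \<Rightarrow> nat \<Rightarrow> nat \<Rightarrow> nat \<Rightarrow> int" where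
  "argv b v k m n = (if b then int k + int m - int n else int k + int n) + v"

text \<open>Twice the top entry of the Gaussian at \<open>i\<close>. At \<open>i = t\<close> there
  is no Gaussian and only its parity matters.\<close>

definition arg :: "(nat \<Rightarrow> nat) \<Rightarrow> nat \<Rightarrow> int" where
  "arg \<mu> i = argv (brk i) (uL i + uR i) (\<mu> (i - 1)) (\<mu> i) (\<mu> (i + 1))"

definition Qf :: "nat \<Rightarrow> (nat \<Rightarrow> nat) \<Rightarrow> int" where
  "Qf j \<mu> = (\<Sum>i = j..<t. (if brk i then 1 else 2) * (int (\<mu> i))\<^sup>2 + (if brk i then 0 else - 2) * int (\<mu> i) * int (\<mu> (Suc i)))"

text \<open>Each dualisation exchanges the roles of the two vectors. For \<open>j = 0\<close> the
  number of breaks below \<open>i\<close> is the index of the zone of \<open>i\<close>, so that the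
  linear term becomes the one with \<open>flat\<close> and \<open>sharp\<close>.\<close>

definition wt :: "nat \<Rightarrow> nat \<Rightarrow> int" where
  "wt j i = (if even (card {k. j \<le> k \<and> k < i \<and> brk k}) then uR i else uL i)"

definition lin :: "nat \<Rightarrow> nat \<Rightarrow> (nat \<Rightarrow> nat) \<Rightarrow> int" where
  "lin j k \<mu> = (\<Sum>i = k..<t. wt j i * int (\<mu> i))"

text \<open>These are exponents of \<open>z\<close>. At a break \<open>j\<close>,
  \<open>Epre\<close> belongs to the model before dualisation and \<open>Epost\<close> to its dual;
  without a break they agree.\<close>

definition Epost :: "nat \<Rightarrow> (nat \<Rightarrow> nat) \<Rightarrow> int" where
  "Epost j \<mu> = Qf j \<mu> - (int (\<mu> j))\<^sup>2 - 2 * lin j (Suc j) \<mu> + gpost j"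

definition Epre :: "nat \<Rightarrow> (nat \<Rightarrow> nat) \<Rightarrow> int" where
  "Epre j \<mu> = (int (\<mu> j))\<^sup>2 - 2 * int (\<mu> j) * int (\<mu> (Suc j)) + Qf (Suc j) \<mu>
     - 2 * lin (Suc j) (Suc j) \<mu> + gpre j"

definition gprod :: "'a::field \<Rightarrow> nat \<Rightarrow> (nat \<Rightarrow> nat) \<Rightarrow> 'a" where
  "gprod z j \<mu> = (\<Prod>i = Suc j..<t. gauss' (z ^ 4) (arg \<mu> i div 2) (int (\<mu> i)))"

text \<open>The bound on successive entries holds for all nonvanishing terms by
  \<open>chain_bound\<close> and makes the set finite. The parity conditions include the index
  \<open>t\<close>, which fixes the parities of all entries, that of \<open>L\<close>
  included.\<close>

definition Wset :: "nat \<Rightarrow> nat \<Rightarrow> nat \<Rightarrow> (nat \<Rightarrow> nat) set" where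
  "Wset j L m = {\<mu>. \<mu> j = L \<and> \<mu> (Suc j) = m \<and> (\<forall>i. i < j \<or> t \<le> i \<longrightarrow> \<mu> i = 0)
     \<and> (\<forall>i\<in>{Suc j..t}. even (arg \<mu> i)) \<and> (\<forall>i\<in>{j..<t}. \<mu> (Suc i) \<le> \<mu> i + 1)}"

definition Fpre :: "nat \<Rightarrow> 'a::field \<Rightarrow> nat \<Rightarrow> nat \<Rightarrow> 'a" where
  "Fpre j z L m = (\<Sum>\<mu>\<in>Wset j L m. z powi Epre j \<mu> * gprod z j \<mu>)"

definition Fpost :: "nat \<Rightarrow> 'a::field \<Rightarrow> nat \<Rightarrow> nat \<Rightarrow> 'a" where
  "Fpost j z L m = (\<Sum>\<mu>\<in>Wset j L m. z powi Epost j \<mu> * gprod z j \<mu>)"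

lemma finite_Wset: "finite (Wset j L m)"
proof (rule finite_subset)
  have "\<mu> i \<le> L + i" if "\<mu> \<in> Wset j L m" for \<mu> i
  proof (cases "j \<le> i \<and> i < t")
    case True
    from True have "j \<le> i" by simp
    then have "i \<le> t \<Longrightarrow> \<mu> i \<le> L + i"
    proof (induction i rule: dec_induct)
      case base then show ?case using that by (simp add: Wset_def)
    next
      case (step i)
      then have "\<mu> (Suc i) \<le> \<mu> i + 1" using that by (auto simp: Wset_def)
      then show ?case using step by simp
    qed
    then show ?thesis using True by simp
  qed (use that in \<open>auto simp: Wset_def\<close>)
  then have "\<mu> i \<le> L + t" if "\<mu> \<in> Wset j L m" "i < t" for \<mu> i
    using that by (meson add_le_cancel_left le_trans less_imp_le)
  moreover have "\<mu> i = 0" if "\<mu> \<in> Wset j L m" "\<not> i < t" for \<mu> i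
    using that by (simp add: Wset_def)
  ultimately show "Wset j L m \<subseteq> {\<mu>. \<forall>i. (i \<in> {..<t} \<longrightarrow> \<mu> i \<in> {..L + t}) \<and> (i \<notin> {..<t} \<longrightarrow> \<mu> i = 0)}"
    by (intro subsetI CollectI allI conjI impI) (simp_all only: lessThan_iff atMost_iff)
qed (rule finite_set_of_finite_funs; simp)

lemma wt_nonbreak: "\<not> brk j \<Longrightarrow> wt j i = wt (Suc j) i"
proof -
  assume "\<not> brk j"
  then have "{k. j \<le> k \<and> k < i \<and> brk k} = {k. Suc j \<le> k \<and> k < i \<and> brk k}"
    by (auto simp: Suc_le_eq order.strict_iff_order)
  then show ?thesis by (simp add: wt_def)
qed

lemma wt_break: "brk j \<Longrightarrow> j < i \<Longrightarrow> wt j i = uL i + uR i - wt (Suc j) i"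
proof -
  assume "brk j" "j < i"
  then have "{k. j \<le> k \<and> k < i \<and> brk k} = insert j {k. Suc j \<le> k \<and> k < i \<and> brk k}"
    by (auto simp: Suc_le_eq order.strict_iff_order)
  moreover have "finite {k. Suc j \<le> k \<and> k < i \<and> brk k}" by simp
  ultimately show ?thesis by (simp add: wt_def)
qed

lemma wt_self: "wt j j = uR j"
proof -
  have "{k. j \<le> k \<and> k < j \<and> brk k} = {}" by auto
  then show ?thesis unfolding wt_def by (simp only: card.empty even_zero if_True)
qed

lemma Qf_Suc: "j < t \<Longrightarrow> Qf j \<mu> = (if brk j then 1 else 2) * (int (\<mu> j))\<^sup>2 + (if brk j then 0 else - 2) * int (\<mu> j) * int (\<mu> (Suc j)) + Qf (Suc j) \<mu>"
  unfolding Qf_def by (subst sum.atLeast_Suc_lessThan) auto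

lemma Epost_nonbreak: "j < t \<Longrightarrow> \<not> brk j \<Longrightarrow> Epost j \<mu> = Epre j \<mu>"
proof -
  assume j: "j < t" and b: "\<not> brk j"
  have "wt j = wt (Suc j)" using wt_nonbreak[OF b] by (simp add: fun_eq_iff)
  then show ?thesis
    using b gpost_same[OF b] unfolding Epost_def Epre_def Qf_Suc[OF j] lin_def
    by (simp add: algebra_simps)
qed

text \<open>Summation by parts turns the sum of each variable times its matrix row into the
  quadratic form. The left side is what inverting \<open>z\<close> in the Gaussians produces, up to
  a constant factor.\<close>

lemma arg_sum:
  assumes "\<mu> t = 0" "j < t"
  shows "(\<Sum>i = Suc j..<t. int (\<mu> i) * (arg \<mu> i - 2 * int (\<mu> i)))
    = int (\<mu> j) * int (\<mu> (Suc j)) - Qf (Suc j) \<mu> + (\<Sum>i = Suc j..<t. (uL i + uR i) * int (\<mu> i))"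
  using assms(2)
proof (induction "t - j" arbitrary: j)
  case (Suc d)
  show ?case
  proof (cases "Suc j < t")
    case True
    have "(\<Sum>i = Suc (Suc j)..<t. int (\<mu> i) * (arg \<mu> i - 2 * int (\<mu> i)))
       = int (\<mu> (Suc j)) * int (\<mu> (Suc (Suc j))) - Qf (Suc (Suc j)) \<mu> + (\<Sum>i = Suc (Suc j)..<t. (uL i + uR i) * int (\<mu> i))"
      by (rule Suc.hyps) (use Suc True in auto)
    moreover have "(\<Sum>i = Suc j..<t. f i) = f (Suc j) + (\<Sum>i = Suc (Suc j)..<t. f i)" for f :: "nat \<Rightarrow> int"
      using True by (rule sum.atLeast_Suc_lessThan)
    ultimately show ?thesis unfolding Qf_Suc[OF True] arg_def argv_def
      by (simp add: algebra_simps power2_eq_square)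
  next
    case False
    then have "Suc j = t" using Suc by simp
    then show ?thesis using assms by (simp add: Qf_def)
  qed
qed simp

lemma Epost_break:
  assumes j: "j < t" and b: "brk j" and \<mu>: "\<mu> t = 0"
  shows "Epost j \<mu> = (int (\<mu> j))\<^sup>2 - (al j)\<^sup>2 - Epre j \<mu> - 2 * (\<Sum>i = Suc j..<t. int (\<mu> i) * (arg \<mu> i - 2 * int (\<mu> i)))"
proof -
  have "lin j (Suc j) \<mu> = (\<Sum>i = Suc j..<t. (uL i + uR i) * int (\<mu> i) - wt (Suc j) i * int (\<mu> i))"
    unfolding lin_def
  proof (rule sum.cong[OF refl])
    fix i assume "i \<in> {Suc j..<t}"
    then have "wt j i = uL i + uR i - wt (Suc j) i" using wt_break[OF b] by simp
    then show "wt j i * int (\<mu> i) = (uL i + uR i) * int (\<mu> i) - wt (Suc j) i * int (\<mu> i)"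
      by (simp only: left_diff_distrib)
  qed
  then have "lin j (Suc j) \<mu> = (\<Sum>i = Suc j..<t. (uL i + uR i) * int (\<mu> i)) - lin (Suc j) (Suc j) \<mu>"
    by (simp add: sum_subtractf lin_def)
  then show ?thesis unfolding arg_sum[where \<mu> = \<mu>, OF \<mu> j] Epost_def Epre_def Qf_Suc[OF j] gpost_brk[OF b] using b
    by (simp add: algebra_simps)
qed

lemma Epre_rec:
  assumes "Suc j < t"
  shows "Epre j \<mu> = (int (\<mu> j) - int (\<mu> (Suc j)))\<^sup>2 - 2 * uR (Suc j) * int (\<mu> (Suc j))
     + (gpre j - gpost (Suc j)) + Epost (Suc j) \<mu>"
proof -
  have "lin (Suc j) (Suc j) \<mu> = uR (Suc j) * int (\<mu> (Suc j)) + lin (Suc j) (Suc (Suc j)) \<mu>"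
    unfolding lin_def using assms by (subst sum.atLeast_Suc_lessThan) (auto simp: wt_self)
  then show ?thesis unfolding Epre_def Epost_def
    by (simp add: algebra_simps power2_eq_square)
qed

lemma Fpost_nonbreak: "j < t \<Longrightarrow> \<not> brk j \<Longrightarrow> Fpost j z L m = Fpre j z L m"
  unfolding Fpost_def Fpre_def by (simp add: Epost_nonbreak)

lemma gprod_inverse:
  fixes z :: "'a::field"
  assumes z: "generic z" and ev: "\<forall>i\<in>{Suc j..<t}. even (arg \<mu> i)"
  shows "gprod (inverse z) j \<mu> = z powi (- 2 * (\<Sum>i = Suc j..<t. int (\<mu> i) * (arg \<mu> i - 2 * int (\<mu> i)))) * gprod z j \<mu>"
proof -
  have z0: "z \<noteq> 0" using z by (simp add: generic_def)
  have q: "generic (z ^ 4)" using z by (rule generic_power) simp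
  have 1: "gauss' ((inverse z) ^ 4) (arg \<mu> i div 2) (int (\<mu> i))
    = z powi (- 2 * (int (\<mu> i) * (arg \<mu> i - 2 * int (\<mu> i)))) * gauss' (z ^ 4) (arg \<mu> i div 2) (int (\<mu> i))"
    if "i \<in> {Suc j..<t}" for i
  proof -
    have "even (arg \<mu> i)" using ev that by simp
    then obtain k where k: "arg \<mu> i = 2 * k" by (elim evenE)
    have "(z ^ 4) powi x = z powi (4 * x)" for x
      using power_int_mult[of z 4 x] by (simp only: power_int_numeral)
    then show ?thesis using gauss'_inverse[OF q, of "arg \<mu> i div 2" "\<mu> i"] k
      by (simp add: power_inverse algebra_simps)
  qed
  have 2: "(\<Prod>i\<in>A. z powi f i) = z powi (\<Sum>i\<in>A. f i)" for A and f :: "nat \<Rightarrow> int"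
    by (induction A rule: infinite_finite_induct) (auto simp: z0 power_int_add)
  show ?thesis unfolding gprod_def sum_distrib_left 2[symmetric] prod.distrib[symmetric]
    by (rule prod.cong[OF refl 1])
qed

text \<open>The fermionic counterpart of \<open>path_gf_dual\<close>. Inverting \<open>z\<close>
  negates the exponent, and the powers split off from the inverted Gaussians restore the quadratic
  form; \<open>arg_sum\<close> shows that the two effects match.\<close>

lemma Fpost_break:
  fixes z :: "'a::field"
  assumes z: "generic z" and j: "j < t" and b: "brk j"
  shows "Fpost j z L m = z powi ((int L)\<^sup>2 - (al j)\<^sup>2) * Fpre j (inverse z) L m"
  unfolding Fpost_def Fpre_def sum_distrib_left
proof (rule sum.cong[OF refl])
  fix \<mu> assume \<mu>: "\<mu> \<in> Wset j L m"
  have z0: "z \<noteq> 0" using z by (simp add: generic_def)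
  have mp: "z powi i * (z powi j * w) = z powi (i + j) * w" for i j w
    using z0 by (simp add: power_int_add)
  have ev: "\<forall>i\<in>{Suc j..<t}. even (arg \<mu> i)" and \<mu>t: "\<mu> t = 0" and \<mu>j: "\<mu> j = L" using \<mu> by (auto simp: Wset_def)
  have inv: "inverse z powi k = z powi (- k)" for k by (simp add: power_int_inverse power_int_minus)
  show "z powi Epost j \<mu> * gprod z j \<mu> = z powi ((int L)\<^sup>2 - (al j)\<^sup>2) * (inverse z powi Epre j \<mu> * gprod (inverse z) j \<mu>)"
    unfolding gprod_inverse[OF z ev] inv mp Epost_break[OF j b, of \<mu>, OF \<mu>t] \<mu>j
    by (simp add: algebra_simps)
qed

text \<open>At level \<open>t - 1\<close> no summation variable is left, and the parity condition at
  \<open>t\<close> becomes one on \<open>L\<close>, as in \<open>base_step\<close>.\<close>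

lemma Fpre_base:
  assumes "0 < t"
  shows "Fpre (t - 1) z L m = z powi ((int L)\<^sup>2 + gpre (t - 1)) * of_bool (m = 0 \<and> even (int L + (uL t + uR t)))"
proof -
  define \<mu>0 where "\<mu>0 = (\<lambda>i::nat. 0::nat)(t - 1 := L)"
  have t: "Suc (t - 1) = t" using assms by simp
  have W: "Wset (t - 1) L m = (if m = 0 \<and> even (int L + (uL t + uR t)) then {\<mu>0} else {})"
  proof -
    have "\<mu> \<in> Wset (t - 1) L m \<longleftrightarrow> (m = 0 \<and> even (int L + (uL t + uR t))) \<and> \<mu> = \<mu>0" for \<mu>
    proof
      assume w: "\<mu> \<in> Wset (t - 1) L m"
      have "\<mu> i = \<mu>0 i" for i
      proof (cases "i = t - 1")
        case False
        then have "i < t - 1 \<or> t \<le> i" using assms by auto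
        then show ?thesis using w False by (auto simp: Wset_def \<mu>0_def)
      qed (use w in \<open>auto simp: Wset_def \<mu>0_def\<close>)
      then have "\<mu> = \<mu>0" by auto
      then show "(m = 0 \<and> even (int L + (uL t + uR t))) \<and> \<mu> = \<mu>0"
        using w brk_t[of t] assms by (auto simp: Wset_def arg_def argv_def \<mu>0_def t)
    next
      assume a: "(m = 0 \<and> even (int L + (uL t + uR t))) \<and> \<mu> = \<mu>0"
      have 1: "{Suc (t - 1)..t} = {t}" "{t - 1..<t} = {t - 1}" using assms by auto
      have v: "\<mu> (t - 1) = L" "\<mu> t = 0" "\<And>i. i \<noteq> t - 1 \<Longrightarrow> \<mu> i = 0" "m = 0"
        using a assms by (auto simp: \<mu>0_def)
      have "arg \<mu> t = int L + (uL t + uR t)"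
        using v(1,2) v(3)[of "Suc t"] brk_t[of t] by (simp add: arg_def argv_def)
      then have "\<forall>i\<in>{t}. even (arg \<mu> i)" using a by simp
      then show "\<mu> \<in> Wset (t - 1) L m"
        unfolding Wset_def mem_Collect_eq t 1 using v assms by auto
    qed
    then show ?thesis by auto
  qed
  have "Epre (t - 1) \<mu>0 = (int L)\<^sup>2 + gpre (t - 1)"
    using assms by (simp add: Epre_def Qf_def lin_def \<mu>0_def t)
  moreover have "gprod z (t - 1) \<mu>0 = 1" by (simp add: gprod_def t)
  ultimately show ?thesis unfolding Fpre_def W by simp
qed

lemma cong_ge:
  assumes "\<And>i. j \<le> i \<Longrightarrow> \<mu> i = \<nu> i"
  shows "Epost j \<mu> = Epost j \<nu>" "gprod z j \<mu> = gprod z j \<nu>" "i > j \<Longrightarrow> arg \<mu> i = arg \<nu> i"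
proof -
  have a: "arg \<mu> i = arg \<nu> i" if "i > j" for i
    using assms that by (simp add: arg_def)
  then show "i > j \<Longrightarrow> arg \<mu> i = arg \<nu> i" .
  show "Epost j \<mu> = Epost j \<nu>" unfolding Epost_def Qf_def lin_def using assms by simp
  show "gprod z j \<mu> = gprod z j \<nu>" unfolding gprod_def using assms a by (intro prod.cong) auto
qed

text \<open>Splitting off the first summation variable gives a recursion of the shape of
  \<open>nonbreak_step\<close> and \<open>break_step\<close>.\<close>

lemma Fpre_rec:
  fixes z :: "'a::field"
  assumes z: "z \<noteq> 0" and j: "Suc j < t" and m: "m \<le> L + 1"
  defines "v \<equiv> argv (brk (Suc j)) (uL (Suc j) + uR (Suc j)) L m"
  shows "Fpre j z L m = z powi ((int L - int m)\<^sup>2 - 2 * uR (Suc j) * int m + (gpre j - gpost (Suc j)))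
    * (\<Sum>n\<in>{n. n \<le> m + 1 \<and> even (v n)}. gauss' (z ^ 4) (v n div 2) (int m) * Fpost (Suc j) z m n)"
proof -
  let ?N = "{n. n \<le> m + 1 \<and> even (v n)}"
  let ?h = "\<lambda>\<mu>. z powi Epre j \<mu> * gprod z j \<mu>"
  have fN: "finite ?N" by (rule finite_subset[of _ "{..m + 1}"]) auto
  have mp: "z powi i * (z powi j * w) = z powi (i + j) * w" for i j w
    using z by (simp add: power_int_add)
  \<comment> \<open>Vectors of level \<open>Suc j\<close> vanish below that index, so the entry
    \<open>L\<close> at \<open>j\<close> is reset to 0.\<close>
  have mem: "\<mu> \<in> Wset j L m \<longleftrightarrow> \<mu> j = L \<and> \<mu>(j := 0) \<in> Wset (Suc j) m (\<mu> (Suc (Suc j))) \<and> \<mu> (Suc (Suc j)) \<in> ?N" for \<mu>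
  proof -
    have 1: "{Suc j..t} = insert (Suc j) {Suc (Suc j)..t}" "{j..<t} = insert j {Suc j..<t}" using j by auto
    have 2: "arg (\<mu>(j := 0)) i = arg \<mu> i" if "Suc (Suc j) \<le> i" for i
    proof -
      have ne: "i - 1 \<noteq> j" "i \<noteq> j" "i + 1 \<noteq> j" using that by auto
      show ?thesis unfolding arg_def fun_upd_other[OF ne(1)] fun_upd_other[OF ne(2)] fun_upd_other[OF ne(3)] ..
    qed
    have 3: "\<mu> j = L \<Longrightarrow> \<mu> (Suc j) = m \<Longrightarrow> arg \<mu> (Suc j) = v (\<mu> (Suc (Suc j)))" by (simp add: arg_def v_def)
    have 4: "(\<forall>i. i < Suc j \<or> t \<le> i \<longrightarrow> (\<mu>(j := 0)) i = 0) \<longleftrightarrow> (\<forall>i. i < j \<or> t \<le> i \<longrightarrow> \<mu> i = 0)"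
      using j by (auto simp: less_Suc_eq)
    have 5: "(\<forall>i\<in>{Suc (Suc j)..t}. even (arg (\<mu>(j := 0)) i)) \<longleftrightarrow> (\<forall>i\<in>{Suc (Suc j)..t}. even (arg \<mu> i))"
      using 2 by auto
    have 6: "(\<forall>i\<in>{Suc j..<t}. (\<mu>(j := 0)) (Suc i) \<le> (\<mu>(j := 0)) i + 1) \<longleftrightarrow> (\<forall>i\<in>{Suc j..<t}. \<mu> (Suc i) \<le> \<mu> i + 1)"
      by auto
    show ?thesis unfolding Wset_def mem_Collect_eq 4 5 6 1 ball_simps
      using 3 m j by auto
  qed
  have "Fpre j z L m = (\<Sum>n\<in>?N. \<Sum>\<mu>\<in>{\<mu> \<in> Wset j L m. \<mu> (Suc (Suc j)) = n}. ?h \<mu>)"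
    unfolding Fpre_def by (rule sum.group[symmetric]) (use finite_Wset fN mem in auto)
  also have "\<dots> = (\<Sum>n\<in>?N. z powi ((int L - int m)\<^sup>2 - 2 * uR (Suc j) * int m + (gpre j - gpost (Suc j)))
     * (gauss' (z ^ 4) (v n div 2) (int m) * Fpost (Suc j) z m n))"
  proof (rule sum.cong[OF refl])
    fix n assume n: "n \<in> ?N"
    have "(\<Sum>\<mu>\<in>{\<mu> \<in> Wset j L m. \<mu> (Suc (Suc j)) = n}. ?h \<mu>)
      = (\<Sum>\<nu>\<in>Wset (Suc j) m n. z powi ((int L - int m)\<^sup>2 - 2 * uR (Suc j) * int m + (gpre j - gpost (Suc j)))
     * (gauss' (z ^ 4) (v n div 2) (int m) * (z powi Epost (Suc j) \<nu> * gprod z (Suc j) \<nu>)))"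
    proof (rule sum.reindex_bij_witness[of _ "\<lambda>\<nu>. \<nu>(j := L)" "\<lambda>\<mu>. \<mu>(j := 0)"])
      fix \<mu> assume \<mu>: "\<mu> \<in> {\<mu> \<in> Wset j L m. \<mu> (Suc (Suc j)) = n}"
      then have \<mu>': "\<mu> j = L" "\<mu> (Suc j) = m" "\<mu> (Suc (Suc j)) = n" by (auto simp: Wset_def)
      show "(\<mu>(j := 0))(j := L) = \<mu>" using \<mu>' by auto
      show "\<mu>(j := 0) \<in> Wset (Suc j) m n" using \<mu> mem by auto
      have a: "Epost (Suc j) (\<mu>(j := 0)) = Epost (Suc j) \<mu>" "gprod z (Suc j) (\<mu>(j := 0)) = gprod z (Suc j) \<mu>"
        by (rule cong_ge; simp)+
      have b: "gprod z j \<mu> = gauss' (z ^ 4) (v n div 2) (int m) * gprod z (Suc j) \<mu>"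
        unfolding gprod_def using j \<mu>' by (subst prod.atLeast_Suc_lessThan) (auto simp: arg_def v_def)
      show "z powi ((int L - int m)\<^sup>2 - 2 * uR (Suc j) * int m + (gpre j - gpost (Suc j)))
         * (gauss' (z ^ 4) (v n div 2) (int m) * (z powi Epost (Suc j) (\<mu>(j := 0)) * gprod z (Suc j) (\<mu>(j := 0)))) = ?h \<mu>"
        unfolding a b Epre_rec[OF j] \<mu>' using z by (simp add: power_int_add)
    next
      fix \<nu> assume \<nu>: "\<nu> \<in> Wset (Suc j) m n"
      then have \<nu>': "\<nu> j = 0" "\<nu> (Suc (Suc j)) = n" by (auto simp: Wset_def)
      show "(\<nu>(j := L))(j := 0) = \<nu>" using \<nu>' by auto
      have "(\<nu>(j := L))(j := 0) = \<nu>" using \<nu>' by auto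
      then show "\<nu>(j := L) \<in> {\<mu> \<in> Wset j L m. \<mu> (Suc (Suc j)) = n}" using \<nu> \<nu>' n mem[of "\<nu>(j := L)"] by auto
    qed
    also have "\<dots> = z powi ((int L - int m)\<^sup>2 - 2 * uR (Suc j) * int m + (gpre j - gpost (Suc j)))
     * (gauss' (z ^ 4) (v n div 2) (int m) * Fpost (Suc j) z m n)"
      unfolding Fpost_def sum_distrib_left ..
    finally show "(\<Sum>\<mu>\<in>{\<mu> \<in> Wset j L m. \<mu> (Suc (Suc j)) = n}. ?h \<mu>)
      = z powi ((int L - int m)\<^sup>2 - 2 * uR (Suc j) * int m + (gpre j - gpost (Suc j)))
     * (gauss' (z ^ 4) (v n div 2) (int m) * Fpost (Suc j) z m n)" .
  qed
  finally show ?thesis unfolding sum_distrib_left .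
qed

text \<open>Downward induction on \<open>j\<close>. Unless the next two entries are both 0, the
  bound at \<open>Suc j\<close> makes twice the top entry at least -1, and parity excludes -1; a
  nonzero Gaussian with non-negative top forces top >= bottom, which is the bound at
  \<open>j\<close>. The alternative with two zeros is needed for the Gaussian with top -1 and bottom
  0.\<close>

lemma chain_bound:
  assumes z: "generic z" and "j < t" and "\<mu> t = 0"
    and ev: "\<forall>i\<in>{Suc j..t}. even (arg \<mu> i)"
    and ne: "\<forall>i\<in>{Suc j..<t}. gauss' (z ^ 4) (arg \<mu> i div 2) (int (\<mu> i)) \<noteq> 0"
  shows "\<mu> (Suc j) + g j \<le> \<mu> j + 1 \<or> \<mu> j = 0 \<and> \<mu> (Suc j) = 0"
  using assms(2-)
proof (induction "t - Suc j" arbitrary: j)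
  case 0
  then have "Suc j = t" by simp
  then show ?case using 0 g2[of j] by auto
next
  case (Suc d)
  have q: "generic (z ^ 4)" using z by (rule generic_power) simp
  have j: "Suc j < t" using Suc.hyps by simp
  have IH: "\<mu> (Suc (Suc j)) + g (Suc j) \<le> \<mu> (Suc j) + 1 \<or> \<mu> (Suc j) = 0 \<and> \<mu> (Suc (Suc j)) = 0"
    by (rule Suc.hyps(1)) (use Suc.hyps(2) Suc.prems j in auto)
  define A where "A = arg \<mu> (Suc j)"
  have evA: "even A" using Suc.prems(3) j by (auto simp: A_def)
  have neA: "gauss' (z ^ 4) (A div 2) (int (\<mu> (Suc j))) \<noteq> 0" using Suc.prems(4) j by (auto simp: A_def)
  have big: "2 * int (\<mu> (Suc j)) \<le> A" if "0 \<le> A"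
    using gauss'_small[OF q, of "A div 2" "\<mu> (Suc j)"] neA that evA by (cases "A div 2 < int (\<mu> (Suc j))") auto
  show ?case
  proof (cases "brk (Suc j)")
    case False
    have A: "A = int (\<mu> j) + int (\<mu> (Suc (Suc j))) + (int (g (Suc j)) - int (g j))"
      using False u_nonbreak[OF j False] by (simp add: A_def arg_def argv_def)
    have "0 \<le> A" using A g_mono[of j] by simp
    from big[OF this] A IH g2[of "Suc j"] g2[of j] show ?thesis by auto
  next
    case True
    have A: "A = int (\<mu> j) + int (\<mu> (Suc j)) - int (\<mu> (Suc (Suc j))) - int (g j)"
      using True u_break[OF j True] by (simp add: A_def arg_def argv_def)
    show ?thesis
    proof (cases "\<mu> (Suc j) = 0 \<and> \<mu> (Suc (Suc j)) = 0")
      case True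
      then show ?thesis using g2[of j] by auto
    next
      case False
      with IH have "\<mu> (Suc (Suc j)) + g (Suc j) \<le> \<mu> (Suc j) + 1" by auto
      then have "- 1 \<le> A" using A g_mono[of j] by simp
      moreover have "A \<noteq> - 1" using evA by auto
      ultimately have "0 \<le> A" by simp
      from big[OF this] A show ?thesis by auto
    qed
  qed
qed

lemma Fpre_bound:
  assumes z: "generic z" and j: "j < t" and ne: "Fpre j z L m \<noteq> 0"
  shows "m + g j \<le> L + 1 \<or> L = 0 \<and> m = 0"
proof -
  obtain \<mu> where \<mu>: "\<mu> \<in> Wset j L m" "gprod z j \<mu> \<noteq> 0"
    using ne unfolding Fpre_def by (metis (no_types, lifting) mult_eq_0_iff sum.neutral)
  have "\<mu> (Suc j) + g j \<le> \<mu> j + 1 \<or> \<mu> j = 0 \<and> \<mu> (Suc j) = 0"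
    by (rule chain_bound[OF z j]) (use \<mu> in \<open>auto simp: Wset_def gprod_def\<close>)
  then show ?thesis using \<mu> by (auto simp: Wset_def)
qed

end

section \<open>Climbing the continued fraction\<close>

primrec fg :: "(nat \<Rightarrow> bool) \<Rightarrow> int \<times> int \<Rightarrow> nat \<Rightarrow> int \<times> int" where
  "fg brk s 0 = s"
| "fg brk s (Suc j) = (if brk j then (fst (fg brk s j) + snd (fg brk s j), fst (fg brk s j))
     else (fst (fg brk s j), fst (fg brk s j) + snd (fg brk s j)))"

text \<open>The value into which a pair of height \<open>x\<close> and band count \<open>R\<close>
  at level \<open>j\<close> has grown at level 0. Insertion turns the pair into \<open>x + R\<close>
  and \<open>R\<close>, and a dualisation replaces \<open>R\<close> by \<open>x - R\<close>;
  \<open>fg\<close> collects the coefficients. The starting vector (1, 0) reads off heights and (0,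
  1) reads off band counts.\<close>

definition val :: "(nat \<Rightarrow> bool) \<Rightarrow> int \<times> int \<Rightarrow> nat \<Rightarrow> int \<Rightarrow> int \<Rightarrow> int" where
  "val brk s j x R = fst (fg brk s j) * x + snd (fg brk s j) * (if brk j then x - R else R)"

lemma val_step: "val brk s j (x + R) R = fst (fg brk s (Suc j)) * x + snd (fg brk s (Suc j)) * R"
  by (simp add: val_def algebra_simps)

declare fg.simps(2) [simp del]

lemma val_nonbreak: "\<not> brk j \<Longrightarrow> val brk s j x R = fst (fg brk s j) * x + snd (fg brk s j) * R"
  by (simp add: val_def)

text \<open>If the bands next to \<open>b\<close> are not both even, exactly one of those next to
  its image is odd: an even band has been placed between two adjacent odd ones, and a mixed pair
  stays mixed. At such heights the choice of the extra height is free by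
  \<open>chi_boundary\<close>.\<close>

lemma (in band_insertion) boundary_insert:
  assumes b: "1 \<le> b" "b \<le> H" and d: "d = 1 \<or> d = - 1" and ne: "r (b + 1) \<noteq> r (b - 1)"
  shows "r' (lift r (b + d) d - d + 1) - r' (lift r (b + d) d - d - 1) = 1"
proof -
  let ?V = "lift r (b + d) d" and ?x = "lift r b d"
  have V: "r' ?V = r (b + d)" using r'_lift[of "b + d" d] b d by auto
  note e = ahead_even[OF b d] ahead_odd[OF b d] behind_even[OF b d] behind_odd[OF b d] r'_x[OF b d] r'_xd[OF b d]
  have ne': "r (b + d) \<noteq> r b \<or> r (b - d) \<noteq> r b" using ne d by auto
  define y where "y = r' (?V - 2 * d)"
  have "r' ?V = r (b + d) \<and> (r (b + d) = r b \<and> y = r (b - d) \<or> r (b + d) \<noteq> r b \<and> y = r b)"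
  proof (cases "r (b + d) = r b")
    case True
    then have "?V - 2 * d = ?x - d" using e(1) by simp
    then show ?thesis using e(4) ne' True V unfolding y_def by metis
  next
    case False
    then have "?V - 2 * d = ?x" using e(2) by simp
    then show ?thesis using e(5) False V unfolding y_def by metis
  qed
  moreover have "r (b + 1) = r b \<or> r (b + 1) = r b + 1" "r b = r (b - 1) \<or> r b = r (b - 1) + 1"
    using rstep[of b] rstep[of "b - 1"] b by auto
  ultimately have "r (b + d) - y = d"
    using d ne by (elim disjE) auto
  moreover have "?V - d + d = ?V" "?V - d - d = ?V - 2 * d" by simp_all
  ultimately have *: "r' (?V - d + d) - r' (?V - d - d) = d"
    unfolding y_def using V by metis
  from d show ?thesis
  proof
    assume "d = 1" then show ?thesis using * by simp
  next
    assume "d = - 1" then show ?thesis using * by simp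
  qed
qed

context model
begin

lemma flat_ends:
  assumes "2 * p < p'"
  shows "r 2 = 0" "r (H - 1) = r H"
proof -
  have p3: "3 \<le> p'" using assms p by simp
  show "r 2 = 0" using assms p p3 by (subst r_inside) auto
  have "(H - 1) * p div p' = p - 1" using assms p p3 by (intro div_eqI) (auto simp: algebra_simps)
  then show "r (H - 1) = r H" using r_top p3 by (simp add: r_inside)
qed

lemma no_adjacent_odd:
  assumes "2 * p < p'" "1 \<le> h" "h + 1 \<le> H"
  shows "r (h + 1) \<le> r (h - 1) + 1"
proof -
  have "r (h + 1) * p' \<le> (h + 1) * p" "(h - 1) * p < (r (h - 1) + 1) * p'"
    using r_bounds[of "h + 1"] r_bounds[of "h - 1"] assms by auto
  then have "r (h + 1) * p' < (r (h - 1) + 2) * p'" using assms by (simp add: algebra_simps)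
  then show ?thesis using p by (simp add: mult_less_cancel_right)
qed

end

section \<open>The models at the levels from t - 1 down to 0\<close>

locale ladder =
  fixes t :: nat and brk :: "nat \<Rightarrow> bool" and sL sR :: nat and TL TR :: bool
  assumes t0: "0 < t" and brk_lt: "\<And>j. brk j \<Longrightarrow> j < t" and sLt: "sL < t" and sRt: "sR < t"
begin

text \<open>At a break equal to \<open>s\<close> the unit vector cancels against the first
  subtracted one, hence the strict inequality.\<close>

definition v :: "nat \<Rightarrow> nat \<Rightarrow> int" where
  "v s j = (if brk j then - of_bool (s < j) else of_bool (s = j))"

definition u :: "bool \<Rightarrow> nat \<Rightarrow> nat \<Rightarrow> int" where
  "u T s j = v s j + of_bool (\<not> T \<and> j = t)"

definition Dl :: "bool \<Rightarrow> nat \<Rightarrow> nat \<Rightarrow> int" where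
  "Dl T s j = (if T then - v s j else v s j - of_bool (j = t))"

fun gstep :: "nat \<Rightarrow> int \<times> int \<times> int \<Rightarrow> int \<times> int \<times> int" where
  "gstep j (\<alpha>, \<beta>, \<gamma>) =
     (let \<beta>' = \<beta> + Dl TL sL j - Dl TR sR j;
          \<gamma>' = \<gamma> + 2 * \<alpha> * Dl TR sR j;
          \<alpha>'' = \<alpha> + \<beta>';
          \<gamma>'' = \<gamma>' - \<beta>'\<^sup>2
      in if brk (j - 1) then (\<alpha>'', \<alpha>'' - \<beta>', - (\<alpha>''\<^sup>2) - \<gamma>'') else (\<alpha>'', \<beta>', \<gamma>''))"

definition gs :: "nat \<Rightarrow> int \<times> int \<times> int" where
  "gs j = foldr gstep [Suc j..<t + 1] (0, 0, 0)"

text \<open>The gamma recursion has a meaning for paths: \<open>al j\<close> is the difference of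
  the end heights at level \<open>j\<close>, and \<open>bpre j\<close> is the difference of their
  potentials, taken at the start for the reversed direction. \<open>stage\<close> records both
  facts.\<close>

definition "al j = fst (gs j)"
definition "be j = fst (snd (gs j))"
definition "gpost j = snd (snd (gs j))"
definition "bpre j = be (Suc j) + Dl TL sL (Suc j) - Dl TR sR (Suc j)"
definition "gpre j = (if j < t then gpost (Suc j) + 2 * al (Suc j) * Dl TR sR (Suc j) - (bpre j)\<^sup>2 else gpost j)"
definition "gr j = of_bool (sL \<le> j) + (of_bool (sR \<le> j) :: nat)"

lemma gs_t: "t \<le> j \<Longrightarrow> gs j = (0, 0, 0)"
  by (simp add: gs_def)

lemma gs_rec: "j < t \<Longrightarrow> gs j = gstep (Suc j) (gs (Suc j))"
  unfolding gs_def by (subst upt_conv_Cons) auto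

lemma gs_values:
  assumes "j < t"
  shows "al j = al (Suc j) + bpre j" "be j = (if brk j then al j - bpre j else bpre j)"
    "gpost j = (if brk j then - (al j)\<^sup>2 - gpre j else gpre j)"
  using gs_rec[OF assms] assms unfolding al_def be_def gpost_def gpre_def bpre_def
  by (cases "gs (Suc j)"; auto simp: Let_def al_def be_def gpost_def)+

sublocale fermionic t brk "u TL sL" "u TR sR" al gpre gpost gr
proof
  fix j
  show "t \<le> j \<Longrightarrow> \<not> brk j" using brk_lt[of j] by auto
  show "\<not> brk j \<Longrightarrow> gpost j = gpre j"
    using gs_values(3)[of j] by (cases "j < t") (auto simp: gpre_def)
  show "brk j \<Longrightarrow> gpost j = - (al j)\<^sup>2 - gpre j"
    using gs_values(3)[of j] brk_lt[of j] by auto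
  show "Suc j < t \<Longrightarrow> \<not> brk (Suc j) \<Longrightarrow> u TL sL (Suc j) + u TR sR (Suc j) = int (gr (Suc j)) - int (gr j)"
    by (auto simp: u_def v_def gr_def le_Suc_eq)
  show "Suc j < t \<Longrightarrow> brk (Suc j) \<Longrightarrow> u TL sL (Suc j) + u TR sR (Suc j) = - int (gr j)"
    by (auto simp: u_def v_def gr_def less_Suc_eq_le)
qed (auto simp: gr_def)

abbreviation "kap s \<equiv> fst (fg brk (1, 0) s) + snd (fg brk (1, 0) s)"

definition side :: "bool \<Rightarrow> int \<Rightarrow> int \<Rightarrow> int" where "side T w x = (if T then x else w - x)"

text \<open>Determines the extra height once the right end has left the boundary. If a break has
  been passed since, the end point lies between an even and an odd band and the final direction is
  irrelevant; otherwise that direction is known.\<close>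

definition right_info :: "nat \<Rightarrow> int \<Rightarrow> int \<Rightarrow> int \<Rightarrow> int \<Rightarrow> bool" where
  "right_info j p p' b dT \<longleftrightarrow> (j < sR \<longrightarrow>
     (if \<exists>i. j < i \<and> i \<le> sR \<and> brk i then odd_below p p' (b + 1) - odd_below p p' (b - 1) = 1 else dT = - sg TR))"

text \<open>Each level refers to the model before a possible dualisation at \<open>j\<close>, hence
  always \<open>2 * p < p'\<close>. An end with index at most \<open>j\<close> still waits at the
  boundary; one with a larger index has left it, and its height evaluates to the corresponding
  kappa, measured from the side on which it started. Here \<open>rho r a d + d\<close> is the
  potential of \<open>a\<close> for the reversed direction.\<close>

definition stage :: "nat \<Rightarrow> int \<Rightarrow> int \<Rightarrow> int \<Rightarrow> int \<Rightarrow> int \<Rightarrow> int \<Rightarrow> bool" where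
  "stage j p p' a d hT dT \<longleftrightarrow> model p p' \<and> 2 * p < p' \<and>
     (\<forall>s. val brk s j p' p = 2 * fst (fg brk s t) + snd (fg brk s t)) \<and>
     1 \<le> a \<and> a \<le> p' - 1 \<and> 1 \<le> a - d \<and> a - d \<le> p' - 1 \<and> (d = 1 \<or> d = - 1) \<and>
     odd_below p p' (a - d) = odd_below p p' a \<and>
     1 \<le> hT \<and> hT \<le> p' - 1 \<and> 1 \<le> hT - dT \<and> hT - dT \<le> p' - 1 \<and> (dT = 1 \<or> dT = - 1) \<and>
     hT - dT - a = al j \<and> rho (odd_below p p') hT dT - rho (odd_below p p') a d - d = bpre j \<and>
     (sL \<le> j \<longrightarrow> a = end_h TL (p' - 1) \<and> d = - sg TL) \<and>
     (j < sL \<longrightarrow> 2 \<le> a \<and> a \<le> p' - 2 \<and>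
        val brk (1, 0) j (side TL p' a) (side TL p (rho (odd_below p p') a d + d)) = kap sL) \<and>
     (sR \<le> j \<longrightarrow> hT = end_h TR (p' - 1) + sg TR \<and> dT = sg TR) \<and>
     (j < sR \<longrightarrow> val brk (1, 0) j (side TR p' (hT - dT)) (side TR p (rho (odd_below p p') hT dT)) = kap sR) \<and>
     right_info j p p' (hT - dT) dT"

definition paths_ok :: "'a::field itself \<Rightarrow> nat \<Rightarrow> int \<Rightarrow> int \<Rightarrow> int \<Rightarrow> int \<Rightarrow> int \<Rightarrow> int \<Rightarrow> bool" where
  "paths_ok ty j p p' a d hT dT \<longleftrightarrow> (\<forall>z::'a. generic z \<longrightarrow> (\<forall>L m. Phi z p p' a d hT dT L m = Fpre j z L m))"

lemma stage_base:
  "stage (t - 1) 1 3 (end_h TL 2) (- sg TL) (end_h TR 2 + sg TR) (sg TR)"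
  and paths_ok_base: "paths_ok TYPE('a::field) (t - 1) 1 3 (end_h TL 2) (- sg TL) (end_h TR 2 + sg TR) (sg TR)"
proof -
  have t1: "t - 1 < t" "Suc (t - 1) = t" using t0 by auto
  have nb: "\<not> brk t" using brk_lt[of t] by auto
  have vt: "v sL t = 0" "v sR t = 0" using sLt sRt nb by (auto simp: v_def)
  have r: "odd_below 1 3 1 = 0" "odd_below 1 3 2 = 0" "odd_below 1 3 0 = 0" "odd_below 1 3 3 = 0" by (auto simp: odd_below_def)
  have m: "model 1 3" by unfold_locales auto
  have bp: "bpre (t - 1) = of_bool (\<not> TR) - of_bool (\<not> TL)"
    unfolding bpre_def t1 using gs_t[of t] by (auto simp: be_def Dl_def vt)
  have al: "al (t - 1) = of_bool (\<not> TR) - of_bool (\<not> TL)"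
  proof -
    have "al t = 0" by (simp add: al_def gs_t)
    then show ?thesis using gs_values(1)[OF t1(1)] unfolding t1 bp by simp
  qed
  have va: "val brk s (t - 1) 3 1 = 2 * fst (fg brk s t) + snd (fg brk s t)" for s
    using val_step[of brk s "t - 1" 2 1] unfolding t1 by simp
  show "stage (t - 1) 1 3 (end_h TL 2) (- sg TL) (end_h TR 2 + sg TR) (sg TR)"
    unfolding stage_def right_info_def using m va al bp sLt sRt r by (auto simp: end_h_def sg_def rho_def)
  show "paths_ok TYPE('a::field) (t - 1) 1 3 (end_h TL 2) (- sg TL) (end_h TR 2 + sg TR) (sg TR)"
    unfolding paths_ok_def
  proof (intro allI impI)
    fix z :: 'a and L m assume z: "generic z"
    have "end_h TL 2 = lift (\<lambda>_. 0) 1 (- sg TL) + - sg TL" "end_h TR 2 + sg TR = lift (\<lambda>_. 0) (1 + sg TR) (sg TR)"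
      by (auto simp: end_h_def sg_def lift_def rho_def)
    then have "Phi z 1 3 (end_h TL 2) (- sg TL) (end_h TR 2 + sg TR) (sg TR) L m
      = z powi ((int L)\<^sup>2 - (of_bool (sg TR = - 1) - of_bool (- sg TL = 1))\<^sup>2) * of_bool (m = 0 \<and> even (L + of_bool (sg TR = - sg TL)))"
      using base_step[OF z, of "- sg TL" "sg TR" L m] sg_pm[of TL] sg_pm[of TR] by auto
    also have "\<dots> = Fpre (t - 1) z L m"
    proof -
      have 1: "even (int L + (u TL sL t + u TR sR t)) \<longleftrightarrow> even (L + of_bool (sg TR = - sg TL))"
        by (auto simp: u_def vt sg_def)
      have 2: "gpre (t - 1) = - (of_bool (sg TR = - 1) - of_bool (- sg TL = 1))\<^sup>2"
        using t1 bp gs_t[of t] by (auto simp: gpre_def t1 al_def gpost_def sg_def)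
      show ?thesis unfolding Fpre_base[OF t0] 1 2 by simp
    qed
    finally show "Phi z 1 3 (end_h TL 2) (- sg TL) (end_h TR 2 + sg TR) (sg TR) L m = Fpre (t - 1) z L m" .
  qed
qed

text \<open>Insertion adds to each end height its potential and to \<open>p'\<close> the number
  \<open>p\<close>, so every linear datum of \<open>stage\<close> is transported by
  \<open>val_step\<close>. The generating functions agree because \<open>nonbreak_step\<close> and
  \<open>Fpre_rec\<close> become the same recursion.\<close>

lemma stage_nonbreak:
  assumes st: "stage (Suc j) p p' a d hT dT" and ok: "paths_ok TYPE('a::field) (Suc j) p p' a d hT dT"
    and j: "Suc j < t" and nb: "\<not> brk (Suc j)"
  shows "\<exists>p p' a d hT dT. stage j p p' a d hT dT \<and> paths_ok TYPE('a) j p p' a d hT dT"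
proof -
  note S = st[unfolded stage_def]
  interpret model p p' using S by simp
  have pp: "2 * p < p'" and p3: "3 \<le> p'" and a: "1 \<le> a" "a \<le> H" and d: "d = 1 \<or> d = - 1" and ev: "r (a - d) = r a"
    and T: "1 \<le> hT" "hT \<le> H" "1 \<le> hT - dT" "hT - dT \<le> H" and dT: "dT = 1 \<or> dT = - 1"
    using S p by auto
  have Sv: "val brk s (Suc j) p' p = 2 * fst (fg brk s t) + snd (fg brk s t)" for s using S by blast
  have SL: "Suc j < sL \<Longrightarrow> val brk (1, 0) (Suc j) (side TL p' a) (side TL p (rho r a d + d)) = kap sL" using S by blast
  have SR: "Suc j < sR \<Longrightarrow> val brk (1, 0) (Suc j) (side TR p' (hT - dT)) (side TR p (rho r hT dT)) = kap sR" using S by blast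
  have SI: "right_info (Suc j) p p' (hT - dT) dT" using S by blast
  have SB: "hT - dT - a = al (Suc j)" "rho r hT dT - rho r a d - d = bpre (Suc j)" using S by auto
  note fe = flat_ends[OF pp]
  define fl where "fl = (sL = Suc j)"
  define fr where "fr = (sR = Suc j)"
  define ad where "ad = (if fl then - d else d)"
  define gT where "gT = (if fr then end_h TR H - sg TR else hT)"
  define eT where "eT = (if fr then - sg TR else dT)"
  define a1 where "a1 = lift r a ad + ad"
  define h1 where "h1 = lift r gT eT"
  define p1 where "p1 = p' + p"
  have L: "sL \<le> Suc j \<Longrightarrow> a = end_h TL H \<and> d = - sg TL" and R: "sR \<le> Suc j \<Longrightarrow> hT = end_h TR H + sg TR \<and> dT = sg TR"
    using S by auto
  have L2: "Suc j < sL \<Longrightarrow> 2 \<le> a \<and> a \<le> p' - 2" using S by auto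
  have ad': "ad = 1 \<or> ad = - 1" using d by (auto simp: ad_def)
  have eT': "eT = 1 \<or> eT = - 1" using dT by (auto simp: eT_def sg_def)
  have flat: "r (end_h T H - sg T) = r (end_h T H)" "r (end_h T H + sg T) = r (end_h T H)" for T
    using fe r_0 r_1 r_top by (auto simp: end_h_def sg_def)
  have ev': "r (a - ad) = r a"
  proof (cases fl)
    case True
    then show ?thesis using L flat[of TL] by (auto simp: ad_def fl_def)
  qed (use ev in \<open>simp add: ad_def\<close>)
  have gT': "0 \<le> gT" "gT \<le> p'" "gT \<le> H + 1" using T p by (auto simp: gT_def end_h_def sg_def)
  have b_eq: "gT - eT = hT - dT" using R by (auto simp: gT_def eT_def fr_def)
  interpret B: band_insertion 1 r "odd_below p p1" H "p1 - 1" gT eT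
    unfolding p1_def by (rule band_insertion) (use gT' eT' in auto)
  let ?r1 = "odd_below p p1"
  have m1: "model p p1" unfolding p1_def by (rule model_insert)
  have a1x: "1 \<le> a1" "a1 \<le> p1 - 1" "1 \<le> a1 - ad" "a1 - ad \<le> p1 - 1" "?r1 (a1 - ad) = ?r1 a1" "?r1 a1 = r a"
    unfolding a1_def using B.x_in[OF a ad'] B.xd_in[OF a ad'] B.r'_x[OF a ad'] B.r'_xd[OF a ad'] by auto
  have h1r: "?r1 h1 = r gT" unfolding h1_def using B.r'_lift[OF gT'(1,3) eT'] by simp
  define Ra where "Ra = rho r a ad + ad"
  define Rb where "Rb = rho r gT eT"
  have Ra1: "rho ?r1 a1 ad + ad = Ra" using a1x by (simp add: Ra_def rho_def)
  have Rb1: "rho ?r1 h1 eT = Rb" using h1r by (simp add: Rb_def rho_def)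
  have a1e: "a1 = a + Ra" by (simp add: a1_def Ra_def lift_def)
  have b1e: "h1 - eT = hT - dT + Rb" using b_eq by (simp add: h1_def Rb_def lift_def)
  have rg: "0 \<le> r gT" "r gT \<le> p - 1" using B.r_mono[of 0 gT] B.r_mono[of gT "H + 1"] gT' r_0 r_top by auto
  have Rb_bd: "0 \<le> Rb" "Rb \<le> p" using rg by (auto simp: Rb_def rho_def)
  have Ra_bd: "0 \<le> Ra" "Ra \<le> p"
    using B.r_mono[of 0 a] B.r_mono[of a "H + 1"] a r_0 r_top ad' by (auto simp: Ra_def rho_def)
  have v1: "v s (Suc j) = of_bool (s = Suc j)" for s using nb by (simp add: v_def)
  have Dls: "Dl T s (Suc j) = - sg T * of_bool (s = Suc j)" for T s using j by (simp add: Dl_def v1 sg_def)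
  have us: "u T s (Suc j) = of_bool (s = Suc j)" for T s using j by (simp add: u_def v1)
  have RaL: "Ra = rho r a d + d + sg TL * of_bool fl"
    using L r_1 r_top by (auto simp: Ra_def ad_def fl_def rho_def end_h_def sg_def)
  have RbR: "Rb = rho r hT dT + sg TR * of_bool fr"
    using R fe r_0 r_1 r_top by (auto simp: Rb_def gT_def eT_def fr_def rho_def end_h_def sg_def)
  have bS: "be (Suc j) = rho r hT dT - rho r a d - d" "al (Suc j) = hT - dT - a"
    using SB gs_values(2)[of "Suc j"] j nb by auto
  have bp: "bpre j = Rb - Ra" unfolding bpre_def Dls bS RaL RbR by (simp add: fl_def fr_def)
  have alj: "al j = h1 - eT - a1" using gs_values(1)[of j] j bS bp by (simp add: a1e b1e)
  have vm: "val brk s j p1 p = 2 * fst (fg brk s t) + snd (fg brk s t)" for s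
    using Sv[of s] val_step[of brk s j p' p] by (simp add: p1_def val_nonbreak[where brk = brk, OF nb])
  have aL: "sL \<le> j \<Longrightarrow> a1 = end_h TL (p1 - 1) \<and> ad = - sg TL"
  proof -
    assume "sL \<le> j"
    then have "a = end_h TL H" "d = - sg TL" "\<not> fl" using L by (auto simp: fl_def)
    then show ?thesis using r_1 r_top by (auto simp: a1_def ad_def lift_def rho_def end_h_def sg_def p1_def)
  qed
  have hR: "sR \<le> j \<Longrightarrow> h1 = end_h TR (p1 - 1) + sg TR \<and> eT = sg TR"
  proof -
    assume "sR \<le> j"
    then have "hT = end_h TR H + sg TR" "dT = sg TR" "\<not> fr" using R by (auto simp: fr_def)
    then show ?thesis using fe r_top by (auto simp: h1_def gT_def eT_def lift_def rho_def end_h_def sg_def p1_def)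
  qed
  have grownL: "j < sL \<Longrightarrow> 2 \<le> a1 \<and> a1 \<le> p1 - 2 \<and> val brk (1, 0) j (side TL p1 a1) (side TL p (rho ?r1 a1 ad + ad)) = kap sL"
  proof -
    assume js: "j < sL"
    show ?thesis
    proof (cases fl)
      case True
      then have "a = end_h TL H" "Ra = (if TL then 1 else p - 1)" using L r_1 r_top by (auto simp: fl_def Ra_def ad_def rho_def end_h_def sg_def)
      moreover have "val brk (1, 0) j (1 + 1) 1 = kap sL" using True val_step[of brk "(1,0)" j 1 1] by (simp add: fl_def)
      ultimately show ?thesis using p p3 unfolding Ra1 unfolding a1e by (auto simp: side_def end_h_def p1_def)
    next
      case False
      then have "Suc j < sL" using js by (auto simp: fl_def)
      then have "2 \<le> a" "a \<le> p' - 2" "val brk (1, 0) (Suc j) (side TL p' a) (side TL p (rho r a d + d)) = kap sL" using SL L2 by auto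
      moreover have "Ra = rho r a d + d" using RaL False by simp
      moreover have "side TL p1 (a + Ra) = side TL p' a + side TL p Ra" by (simp add: side_def p1_def)
      moreover have "Ra \<le> p" "0 \<le> Ra" using Ra_bd by auto
      ultimately show ?thesis unfolding Ra1 unfolding a1e using val_step[of brk "(1,0)" j "side TL p' a" "side TL p Ra"]
        by (simp add: val_nonbreak[where brk = brk, OF nb] p1_def)
    qed
  qed
  have grownR: "j < sR \<Longrightarrow> val brk (1, 0) j (side TR p1 (h1 - eT)) (side TR p (rho ?r1 h1 eT)) = kap sR"
  proof -
    assume js: "j < sR"
    show ?thesis
    proof (cases fr)
      case True
      then have "hT - dT = end_h TR H" "Rb = (if TR then 1 else p - 1)" using R r_0 r_top by (auto simp: fr_def Rb_def gT_def eT_def rho_def end_h_def sg_def)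
      moreover have "val brk (1, 0) j (1 + 1) 1 = kap sR" using True val_step[of brk "(1,0)" j 1 1] by (simp add: fr_def)
      ultimately show ?thesis using p p3 unfolding Rb1 unfolding b1e by (auto simp: side_def end_h_def p1_def)
    next
      case False
      then have "Suc j < sR" using js by (auto simp: fr_def)
      then have "val brk (1, 0) (Suc j) (side TR p' (hT - dT)) (side TR p (rho r hT dT)) = kap sR" using SR by auto
      moreover have "Rb = rho r hT dT" using RbR False by simp
      moreover have "side TR p1 (hT - dT + Rb) = side TR p' (hT - dT) + side TR p Rb" by (simp add: side_def p1_def)
      ultimately show ?thesis unfolding Rb1 unfolding b1e using val_step[of brk "(1,0)" j "side TR p' (hT - dT)" "side TR p Rb"]
        by (simp add: val_nonbreak[where brk = brk, OF nb])
    qed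
  qed
  have ri: "right_info j p p1 (h1 - eT) eT"
    unfolding right_info_def
  proof (intro impI)
    assume js: "j < sR"
    have ex: "(\<exists>i. j < i \<and> i \<le> sR \<and> brk i) \<longleftrightarrow> (\<exists>i. Suc j < i \<and> i \<le> sR \<and> brk i)"
      using nb by (metis Suc_lessI Suc_lessD)
    show "if \<exists>i. j < i \<and> i \<le> sR \<and> brk i then ?r1 (h1 - eT + 1) - ?r1 (h1 - eT - 1) = 1 else eT = - sg TR"
    proof (cases fr)
      case True
      then show ?thesis unfolding ex by (auto simp: fr_def eT_def)
    next
      case False
      then have "Suc j < sR" using js by (auto simp: fr_def)
      then have i: "if \<exists>i. Suc j < i \<and> i \<le> sR \<and> brk i then r (hT - dT + 1) - r (hT - dT - 1) = 1 else dT = - sg TR"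
        using SI by (simp add: right_info_def)
      have "h1 - eT = lift r (hT - dT + dT) dT - dT" using False by (simp add: h1_def gT_def eT_def)
      then have "r (hT - dT + 1) - r (hT - dT - 1) = 1 \<Longrightarrow> ?r1 (h1 - eT + 1) - ?r1 (h1 - eT - 1) = 1"
        using B.boundary_insert[OF T(3,4) dT] by simp
      then show ?thesis using i False unfolding ex by (auto simp: eT_def)
    qed
  qed
  have h1x: "1 \<le> h1 \<and> h1 \<le> p1 - 1 \<and> 1 \<le> h1 - eT \<and> h1 - eT \<le> p1 - 1"
  proof -
    have "1 \<le> h1 \<and> h1 \<le> p1 - 1"
      using eT' rg gT' b_eq T by (auto simp: h1_def lift_def rho_def p1_def)
    then show ?thesis unfolding b1e using T Rb_bd by (auto simp: p1_def)
  qed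
  have "stage j p p1 a1 ad h1 eT"
    unfolding stage_def using m1 pp p vm a1x(1-5) ad' h1x eT' alj bp Ra1 Rb1 aL grownL hR grownR ri
    by (auto simp: p1_def)
  moreover have "paths_ok TYPE('a) j p p1 a1 ad h1 eT"
    unfolding paths_ok_def
  proof (intro allI impI)
    fix z :: 'a and L m assume z: "generic z"
    then have z0: "z \<noteq> 0" by (simp add: generic_def)
    show "Phi z p p1 a1 ad h1 eT L m = Fpre j z L m"
    proof (cases "m \<le> L + 1")
      case m: True
      have "Phi z p (p' + p) (lift r a ad + ad) ad (lift r gT eT) eT L m
        = z powi ((int L - int m)\<^sup>2 - (rho r gT eT - rho r a ad - ad)\<^sup>2
            - (if fr then 2 * (int m + 1 - end_dist TR H a) else 0))
          * (\<Sum>n\<in>{n. n \<le> m + 1 \<and> even (L + n + (of_bool fl + of_bool fr))}.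
              gauss' (z ^ 4) ((int L + int n + int (of_bool fl + of_bool fr)) div 2) (int m) * Phi z p p' a d hT dT m n)"
      proof (rule nonbreak_step[OF z _ a d _ _ dT ad_def ev' gT_def eT_def])
        show "fl \<Longrightarrow> a = end_h TL H \<and> d = - sg TL \<and> r (a - sg TL) = r a \<and> r (a + sg TL) = r a \<and> hT \<noteq> a - sg TL"
          using L flat[of TL] T by (auto simp: fl_def end_h_def sg_def)
        show "fr \<Longrightarrow> hT = end_h TR H + sg TR \<and> dT = sg TR \<and> r (end_h TR H + sg TR) = r (end_h TR H)"
          using R flat by (auto simp: fr_def)
        show "fr \<Longrightarrow> \<not> fl \<Longrightarrow> a \<noteq> end_h TR H \<or> d = - sg TR"
          using L L2 p3 by (cases "sL \<le> Suc j"; cases TL; cases TR) (auto simp: end_h_def sg_def)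
      qed (use p3 T in auto)
      also have "\<dots> = Fpre j z L m"
      proof -
        \<comment> \<open>For a turned right end, the end point lies at the boundary, so the term
          with \<open>end_dist\<close> splits into the linear term in \<open>m\<close> and twice the
          product of \<open>al\<close> and \<open>Dl\<close> from the gamma recursion.\<close>
        have e1: "(int L - int m)\<^sup>2 - (rho r gT eT - rho r a ad - ad)\<^sup>2 - (if fr then 2 * (int m + 1 - end_dist TR H a) else 0)
          = (int L - int m)\<^sup>2 - 2 * u TR sR (Suc j) * int m + (gpre j - gpost (Suc j))"
        proof -
          have "gpre j - gpost (Suc j) = 2 * (hT - dT - a) * Dl TR sR (Suc j) - (Rb - Ra)\<^sup>2"
            using j by (simp add: gpre_def bp bS)
          moreover have "fr \<Longrightarrow> hT - dT = end_h TR H" using R by (auto simp: fr_def)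
          ultimately show ?thesis unfolding us Dls Rb_def[symmetric]
            using p by (cases fr) (auto simp: fr_def[symmetric] Ra_def end_dist_def end_h_def sg_def algebra_simps)
        qed
        have e2: "argv (brk (Suc j)) (u TL sL (Suc j) + u TR sR (Suc j)) L m n = int L + int n + int (of_bool fl + of_bool fr)" for n
          using nb by (simp add: argv_def us fl_def fr_def)
        have e3: "Fpost (Suc j) z m n = Phi z p p' a d hT dT m n" for n
          using Fpost_nonbreak[OF j nb] ok z by (simp add: paths_ok_def)
        have e4: "even (int L + int n + int (of_bool fl + of_bool fr)) \<longleftrightarrow> even (L + n + (of_bool fl + of_bool fr))" for n
          by presburger
        show ?thesis unfolding Fpre_rec[OF z0 j m] e1 e2 e3 e4 ..
      qed
      finally show ?thesis by (simp add: p1_def a1_def h1_def)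
    next
      case False
      then have "Phi z p p1 a1 ad h1 eT L m = 0" unfolding Phi_def by (intro path_gf_neg) auto
      moreover have "Wset j L m = {}" using False j by (auto simp: Wset_def)
      ultimately show ?thesis by (simp add: Fpre_def)
    qed
  qed
  ultimately show ?thesis by blast
qed

end

context ladder
begin

text \<open>The pair (p, p') becomes (p' - p, 2p' - p), for which again the second number exceeds
  twice the first. Dualising replaces each potential by the end height minus the potential, and then
  insertion acts as before.\<close>

lemma stage_break:
  assumes st: "stage (Suc j) p p' a d hT dT" and ok: "paths_ok TYPE('a::field) (Suc j) p p' a d hT dT"
    and j: "Suc j < t" and br: "brk (Suc j)"
  shows "\<exists>p p' a d hT dT. stage j p p' a d hT dT \<and> paths_ok TYPE('a) j p p' a d hT dT"
proof -
  note S = st[unfolded stage_def]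
  interpret model p p' using S by simp
  have pp: "2 * p < p'" and p3: "3 \<le> p'" and a: "1 \<le> a" "a \<le> H" "1 \<le> a - d" "a - d \<le> H" and d: "d = 1 \<or> d = - 1" and ev: "r (a - d) = r a"
    and T: "1 \<le> hT" "hT \<le> H" "1 \<le> hT - dT" "hT - dT \<le> H" and dT: "dT = 1 \<or> dT = - 1"
    using S p by auto
  have Sv: "val brk s (Suc j) p' p = 2 * fst (fg brk s t) + snd (fg brk s t)" for s using S by blast
  have SL: "Suc j < sL \<Longrightarrow> val brk (1, 0) (Suc j) (side TL p' a) (side TL p (rho r a d + d)) = kap sL" using S by blast
  have SR: "Suc j < sR \<Longrightarrow> val brk (1, 0) (Suc j) (side TR p' (hT - dT)) (side TR p (rho r hT dT)) = kap sR" using S by blast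
  have SB: "hT - dT - a = al (Suc j)" "rho r hT dT - rho r a d - d = bpre (Suc j)" using S by auto
  note fe = flat_ends[OF pp]
  define P where "P = p' - p"
  define Q where "Q = p' + P"
  define rD where "rD = odd_below P p'"
  define r1 where "r1 = odd_below P Q"
  define xl where "xl = (sL \<le> j)"
  define xr where "xr = (sR \<le> j)"
  define a2 where "a2 = (if xl then end_h TL (Q - 1) else lift rD a d)"
  define d2 where "d2 = (if xl then - sg TL else - d)"
  define h2 where "h2 = (if xr then end_h TR (Q - 1) + sg TR else lift rD hT dT)"
  have L: "sL \<le> Suc j \<Longrightarrow> a = end_h TL H \<and> d = - sg TL" and R: "sR \<le> Suc j \<Longrightarrow> hT = end_h TR H + sg TR \<and> dT = sg TR"
    using S by auto
  interpret D: model P p' unfolding P_def by (rule model_dual)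
  interpret M': model P Q unfolding Q_def by (rule D.model_insert)
  have T0: "0 \<le> hT" "hT \<le> p'" using T by auto
  interpret B: band_insertion 1 rD r1 "p' - 1" "Q - 1" hT dT
    unfolding rD_def r1_def Q_def by (rule D.band_insertion[OF _ T0 dT]) simp
  have PQ: "2 * P < Q" "3 \<le> Q" using p pp p3 by (auto simp: P_def Q_def)
  note fe' = M'.flat_ends[OF PQ(1), folded r1_def]
  have r1v: "r1 0 = 0" "r1 1 = 0" "r1 Q = P - 1" "r1 (Q - 1) = P - 1" using M'.r_0 M'.r_1 M'.r_top by (auto simp: r1_def)
  have rDr: "rD h = h - 1 - r h" if "1 \<le> h" "h \<le> H" for h using r_dual[OF that] by (simp add: rD_def P_def)
  have rhoD: "rho rD h e = h - e - rho r h e" if "1 \<le> h" "h \<le> H" "e = 1 \<or> e = - 1" for h e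
    using rDr[OF that(1,2)] that(3) by (auto simp: rho_def)
  define A where "A = rho rD a d"
  define Bb where "Bb = rho rD hT dT"
  have Ae: "A = a - (rho r a d + d)" using rhoD[OF a(1,2) d] by (simp add: A_def)
  have Be: "Bb = hT - dT - rho r hT dT" using rhoD[OF T(1,2) dT] by (simp add: Bb_def)
  define Ra where "Ra = A - (if xl then sg TL else 0)"
  define Rb where "Rb = Bb - (if xr then sg TR else 0)"
  define x :: nat where "x = of_bool xl + of_bool xr"
  have xx: "x = gr j" by (simp add: x_def xl_def xr_def gr_def)
  have xl': "xl \<Longrightarrow> a = end_h TL H \<and> d = - sg TL" and xr': "xr \<Longrightarrow> hT = end_h TR H + sg TR \<and> dT = sg TR"
    using L R by (auto simp: xl_def xr_def)
  note heights = break_heights[OF p3 fe a d T dT xl' xr' P_def rD_def Q_def r1_def a2_def d2_def h2_def A_def Bb_def]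
  have bs: "rho r1 h2 dT = Rb" "rho r1 a2 d2 + d2 = Ra" "2 \<le> lift rD a d \<and> lift rD a d \<le> Q - 2"
    using heights(12-15,17,19,20) a by (auto simp: Ra_def Rb_def Q_def)
  note defs = rD_def[unfolded P_def] Q_def[unfolded P_def] r1_def[unfolded P_def]
  note step = break_step[OF _ p3 fe a d ev T dT xl' xr' x_def _ defs a2_def d2_def h2_def, folded P_def]
  have vm: "val brk s j Q P = 2 * fst (fg brk s t) + snd (fg brk s t)" for s
    using Sv[of s] val_step[of brk s j p' P] br by (simp add: Q_def val_def P_def)
  have rl: "r1 (lift rD a d) = rD a" "r1 (lift rD a d + d) = rD a" using B.r'_lift[of a d] a d by auto
  have a1e: "lift rD a d = a + A" by (simp add: lift_def A_def)
  have h1e: "lift rD hT dT - dT = hT - dT + Bb" by (simp add: lift_def Bb_def)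
  have a2x: "1 \<le> a2" "a2 \<le> Q - 1" "1 \<le> a2 - d2" "a2 - d2 \<le> Q - 1" "r1 (a2 - d2) = r1 a2" "d2 = 1 \<or> d2 = - 1"
  proof -
    have "1 \<le> a2 \<and> a2 \<le> Q - 1 \<and> 1 \<le> a2 - d2 \<and> a2 - d2 \<le> Q - 1 \<and> r1 (a2 - d2) = r1 a2 \<and> (d2 = 1 \<or> d2 = - 1)"
    proof (cases xl)
      case True
      then show ?thesis using fe' r1v PQ by (auto simp: a2_def d2_def end_h_def sg_def)
    next
      case False
      then show ?thesis using rl bs(3) d by (auto simp: a2_def d2_def)
    qed
    then show "1 \<le> a2" "a2 \<le> Q - 1" "1 \<le> a2 - d2" "a2 - d2 \<le> Q - 1" "r1 (a2 - d2) = r1 a2" "d2 = 1 \<or> d2 = - 1" by auto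
  qed
  have Bb_bd: "0 \<le> Bb" "Bb \<le> P"
    using B.r_mono[of 0 hT] B.r_mono[of hT H] T D.r_0 D.r_top dT by (auto simp: Bb_def rho_def rD_def)
  have h2x: "1 \<le> h2 \<and> h2 \<le> Q - 1 \<and> 1 \<le> h2 - dT \<and> h2 - dT \<le> Q - 1"
  proof (cases xr)
    case True
    then show ?thesis using R PQ p3 by (auto simp: h2_def xr_def end_h_def sg_def)
  next
    case False
    have "1 \<le> lift rD hT dT \<and> lift rD hT dT \<le> Q - 1"
      using B.x_in[OF T(1,2) dT] by simp
    then show ?thesis using False h1e T Bb_bd by (auto simp: h2_def Q_def)
  qed
  have vs: "v s (Suc j) = - of_bool (s \<le> j)" for s using br by (simp add: v_def less_Suc_eq_le)
  have Dls: "Dl T s (Suc j) = sg T * of_bool (s \<le> j)" for T s using j by (simp add: Dl_def vs sg_def)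
  have us: "u T s (Suc j) = - of_bool (s \<le> j)" for T s using j by (simp add: u_def vs)
  have bS: "be (Suc j) = Bb - A" "al (Suc j) = hT - dT - a"
    using SB gs_values(2)[of "Suc j"] j br by (auto simp: Ae Be)
  have bp: "bpre j = Rb - Ra" unfolding bpre_def Dls bS Ra_def Rb_def by (simp add: xl_def xr_def)
  have b2e: "h2 - dT = hT - dT + Rb"
  proof (cases xr)
    case True
    then have "hT = end_h TR H + sg TR" "dT = sg TR" using R by (auto simp: xr_def)
    then show ?thesis using True fe r_top by (auto simp: h2_def Rb_def Be rho_def end_h_def sg_def Q_def P_def)
  qed (use h1e in \<open>simp add: h2_def Rb_def\<close>)
  have a2e: "a2 = a + Ra"
  proof (cases xl)
    case True
    then have "a = end_h TL H" "d = - sg TL" using L by (auto simp: xl_def)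
    then show ?thesis using True r_1 r_top by (auto simp: a2_def Ra_def Ae rho_def end_h_def sg_def Q_def P_def)
  qed (use a1e in \<open>simp add: a2_def Ra_def\<close>)
  have alj: "al j = h2 - dT - a2" using gs_values(1)[of j] j bS bp by (simp add: a2e b2e)
  have aL: "sL \<le> j \<Longrightarrow> a2 = end_h TL (Q - 1) \<and> d2 = - sg TL" by (simp add: a2_def d2_def xl_def)
  have hR: "sR \<le> j \<Longrightarrow> h2 = end_h TR (Q - 1) + sg TR \<and> dT = sg TR" using R by (simp add: h2_def xr_def)
  have grownL: "j < sL \<Longrightarrow> 2 \<le> a2 \<and> a2 \<le> Q - 2 \<and> val brk (1, 0) j (side TL Q a2) (side TL P Ra) = kap sL"
  proof -
    assume js: "j < sL"
    then have nx: "\<not> xl" "Ra = A" by (auto simp: xl_def Ra_def)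
    have "val brk (1, 0) j (side TL Q a2) (side TL P Ra) = kap sL"
    proof (cases "sL = Suc j")
      case True
      then have "a = end_h TL H" "A = (if TL then 1 else P - 1)" using L r_1 r_top by (auto simp: Ae rho_def end_h_def sg_def P_def)
      moreover have "val brk (1, 0) j (1 + 1) 1 = kap sL" using True val_step[of brk "(1,0)" j 1 1] by simp
      ultimately show ?thesis unfolding a2e nx by (auto simp: side_def end_h_def Q_def)
    next
      case False
      then have "val brk (1, 0) (Suc j) (side TL p' a) (side TL p (rho r a d + d)) = kap sL" using js SL by simp
      moreover have "side TL p' a - side TL p (rho r a d + d) = side TL P A" by (simp add: side_def P_def Ae)
      moreover have "side TL Q (a + A) = side TL p' a + side TL P A" by (simp add: side_def Q_def)
      ultimately show ?thesis unfolding a2e nx using val_step[of brk "(1,0)" j "side TL p' a" "side TL P A"] br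
        by (simp add: val_def)
    qed
    then show ?thesis using bs(3) nx by (simp add: a2_def)
  qed
  have grownR: "j < sR \<Longrightarrow> val brk (1, 0) j (side TR Q (h2 - dT)) (side TR P Rb) = kap sR"
  proof -
    assume js: "j < sR"
    then have nx: "\<not> xr" "Rb = Bb" by (auto simp: xr_def Rb_def)
    show ?thesis
    proof (cases "sR = Suc j")
      case True
      then have "hT - dT = end_h TR H" "Bb = (if TR then 1 else P - 1)" using R fe r_top by (auto simp: Be rho_def end_h_def sg_def P_def)
      moreover have "val brk (1, 0) j (1 + 1) 1 = kap sR" using True val_step[of brk "(1,0)" j 1 1] by simp
      ultimately show ?thesis unfolding b2e nx by (auto simp: side_def end_h_def Q_def)
    next
      case False
      then have "val brk (1, 0) (Suc j) (side TR p' (hT - dT)) (side TR p (rho r hT dT)) = kap sR" using js SR by simp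
      moreover have "side TR p' (hT - dT) - side TR p (rho r hT dT) = side TR P Bb" by (simp add: side_def P_def Be)
      moreover have "side TR Q (hT - dT + Bb) = side TR p' (hT - dT) + side TR P Bb" by (simp add: side_def Q_def)
      ultimately show ?thesis unfolding b2e nx using val_step[of brk "(1,0)" j "side TR p' (hT - dT)" "side TR P Bb"] br
        by (simp add: val_def)
    qed
  qed
  have ri: "right_info j P Q (h2 - dT) dT"
    unfolding right_info_def
  proof (intro impI)
    assume js: "j < sR"
    then have ex: "\<exists>i. j < i \<and> i \<le> sR \<and> brk i" using br by (intro exI[of _ "Suc j"]) auto
    define b where "b = hT - dT"
    have b: "1 \<le> b" "b \<le> H" using T by (auto simp: b_def)
    \<comment> \<open>As \<open>2 * p < p'\<close>, no two odd bands are adjacent, so in the dual no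
      two even bands are; this also holds at the boundary, where the outermost band inside the strip
      is even before dualisation.\<close>
    have "rD (b + 1) \<noteq> rD (b - 1)"
    proof -
      consider "b = 1" | "b = H" "b \<noteq> 1" | "2 \<le> b" "b + 1 \<le> H" using b by linarith
      then show ?thesis
      proof cases
        case 1
        then show ?thesis using rDr[of 2] p3 fe D.r_0 by (simp add: rD_def)
      next
        case 2
        then show ?thesis using rDr[of "H - 1"] p3 fe r_top D.r_top by (simp add: rD_def P_def)
      next
        case 3
        then show ?thesis using rDr[of "b + 1"] rDr[of "b - 1"] no_adjacent_odd[OF pp, of b] by simp
      qed
    qed
    moreover have "h2 - dT = lift rD (b + dT) dT - dT" using js by (simp add: h2_def xr_def b_def)
    ultimately have "r1 (h2 - dT + 1) - r1 (h2 - dT - 1) = 1" using B.boundary_insert[OF b dT] by simp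
    then show "if \<exists>i. j < i \<and> i \<le> sR \<and> brk i then odd_below P Q (h2 - dT + 1) - odd_below P Q (h2 - dT - 1) = 1 else dT = - sg TR"
      using ex by (simp add: r1_def)
  qed
  have Ra1: "rho r1 a2 d2 + d2 = Ra" and Rb1: "rho r1 h2 dT = Rb" using bs by auto
  have "stage j P Q a2 d2 h2 dT"
    unfolding stage_def r1_def[symmetric] using M'.model_axioms PQ vm a2x h2x dT alj bp aL grownL hR grownR ri
    unfolding Ra1 Rb1 using Ra1 by auto
  moreover have "paths_ok TYPE('a) j P Q a2 d2 h2 dT"
    unfolding paths_ok_def
  proof (intro allI impI)
    fix z :: 'a and L m assume z: "generic z"
    then have z0: "z \<noteq> 0" by (simp add: generic_def)
    have PF: "Phi (inverse z) p p' a d hT dT m n = Fpre (Suc j) (inverse z) m n" for m n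
      using ok generic_inverse[OF z] by (simp add: paths_ok_def)
    show "Phi z P Q a2 d2 h2 dT L m = Fpre j z L m"
    proof (cases "m \<le> L + 1")
      case m: True
      have "Phi z P Q a2 d2 h2 dT L m
        = z powi ((int L - int m)\<^sup>2 - (rho r1 h2 dT - rho r1 a2 d2 - d2)\<^sup>2
        + (if xr then 2 * sg TR * (hT - dT - a) + 2 * int m else 0))
        * (\<Sum>n\<in>{n. n \<le> m + 1 \<and> even (int L - int x + int m - int n)}.
          gauss' (z ^ 4) ((int L - int x + int m - int n) div 2) (int m)
          * (z powi ((int m)\<^sup>2 - (hT - dT - a)\<^sup>2) * Phi (inverse z) p p' a d hT dT m n))"
      proof (rule step[OF z])
        \<comment> \<open>The vanishing that the path recursion requires is read off from the
          fermionic side of the previous level; this is why the two sides are compared level by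
          level.\<close>
        fix m n assume "Phi (inverse z) p p' a d hT dT m n \<noteq> 0"
        then have "n + gr (Suc j) \<le> m + 1 \<or> m = 0 \<and> n = 0"
          unfolding PF by (rule Fpre_bound[OF generic_inverse[OF z] j])
        then show "n + x \<le> m + 1 \<or> m = 0 \<and> n = 0" using g_mono[of j] xx by auto
      qed
      also have "\<dots> = Fpre j z L m"
      proof -
        have e1: "(int L - int m)\<^sup>2 - (rho r1 h2 dT - rho r1 a2 d2 - d2)\<^sup>2 + (if xr then 2 * sg TR * (hT - dT - a) + 2 * int m else 0)
          = (int L - int m)\<^sup>2 - 2 * u TR sR (Suc j) * int m + (gpre j - gpost (Suc j))"
        proof -
          have "gpre j - gpost (Suc j) = 2 * (hT - dT - a) * Dl TR sR (Suc j) - (Rb - Ra)\<^sup>2"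
            using j by (simp add: gpre_def bp bS)
          moreover have "rho r1 h2 dT - rho r1 a2 d2 - d2 = Rb - Ra" using Ra1 Rb1 by simp
          ultimately show ?thesis unfolding us Dls by (simp add: xr_def)
        qed
        have e2: "argv (brk (Suc j)) (u TL sL (Suc j) + u TR sR (Suc j)) L m n = int L - int x + int m - int n" for n
          using br by (simp add: argv_def us x_def xl_def xr_def)
        have e3: "Fpost (Suc j) z m n = z powi ((int m)\<^sup>2 - (hT - dT - a)\<^sup>2) * Phi (inverse z) p p' a d hT dT m n" for n
          unfolding PF Fpost_break[OF z j br] bS ..
        show ?thesis unfolding Fpre_rec[OF z0 j m] e1 e2 e3 ..
      qed
      finally show ?thesis .
    next
      case False
      then have "Phi z P Q a2 d2 h2 dT L m = 0" unfolding Phi_def by (intro path_gf_neg) auto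
      moreover have "Wset j L m = {}" using False j by (auto simp: Wset_def)
      ultimately show ?thesis by (simp add: Fpre_def)
    qed
  qed
  ultimately show ?thesis by blast
qed

theorem stage_ex:
  assumes "j < t"
  shows "\<exists>p p' a d hT dT. stage j p p' a d hT dT \<and> paths_ok TYPE('a::field) j p p' a d hT dT"
  using assms
proof (induction "t - 1 - j" arbitrary: j)
  case 0
  then have "j = t - 1" by simp
  then show ?case using stage_base paths_ok_base by blast
next
  case (Suc n)
  then have j: "Suc j < t" by simp
  have "\<exists>p p' a d hT dT. stage (Suc j) p p' a d hT dT \<and> paths_ok TYPE('a) (Suc j) p p' a d hT dT"
    by (rule Suc.hyps(1)) (use Suc j in auto)
  then show ?case using stage_break[OF _ _ j] stage_nonbreak[OF _ _ j] by blast
qed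

end

section \<open>Reduction of the path characters\<close>

text \<open>\<open>d\<close> is the direction in which the first entry is entered and
  \<open>w\<close> selects the scoring vertices entered in that direction. The last entry is the
  extra height and does not count as a vertex.\<close>

fun score_count :: "(int \<Rightarrow> int) \<Rightarrow> int \<Rightarrow> int \<Rightarrow> int list \<Rightarrow> int" where
  "score_count r w d (x # y # xs) = of_bool (d = w) * score r x d (y - x) + score_count r w (y - x) (y # xs)"
| "score_count r w d _ = 0"

text \<open>Double counting: the coordinate added at a scoring vertex is the number of earlier steps
  opposite to the step into it. Here these pairs are collected by their step instead of by their
  vertex.\<close>

fun rec_wt :: "(int \<Rightarrow> int) \<Rightarrow> int list \<Rightarrow> int" where
  "rec_wt r (x # y # xs) = score_count r (x - y) (y - x) (y # xs) + rec_wt r (y # xs)"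
| "rec_wt r _ = 0"

fun valid_ext :: "int \<Rightarrow> int list \<Rightarrow> bool" where
  "valid_ext H (x # y # xs) \<longleftrightarrow> 1 \<le> x \<and> x \<le> H \<and> \<bar>y - x\<bar> = 1 \<and> valid_ext H (y # xs)"
| "valid_ext H [c] \<longleftrightarrow> 0 \<le> c \<and> c \<le> H"
| "valid_ext H [] \<longleftrightarrow> False"

lemma paths_0: "paths p' a b 0 = (if a = b \<and> 1 \<le> a \<and> a \<le> p' - 1 then {[a]} else {})"
proof -
  have "h \<in> paths p' a b 0 \<longleftrightarrow> (a = b \<and> 1 \<le> a \<and> a \<le> p' - 1) \<and> h = [a]" for h
  proof
    assume "h \<in> paths p' a b 0"
    then show "(a = b \<and> 1 \<le> a \<and> a \<le> p' - 1) \<and> h = [a]"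
      by (cases h) (auto simp: paths_def)
  qed (auto simp: paths_def)
  then show ?thesis by auto
qed

lemma paths_Suc: "paths p' a b (Suc L) = (if 1 \<le> a \<and> a \<le> p' - 1 then (#) a ` (\<Union>e\<in>{1, - 1}. paths p' (a + e) b L) else {})"
proof -
  have "h \<in> paths p' a b (Suc L) \<longleftrightarrow> 1 \<le> a \<and> a \<le> p' - 1 \<and> (\<exists>g. h = a # g \<and> (g \<in> paths p' (a + 1) b L \<or> g \<in> paths p' (a - 1) b L))" for h
  proof (cases h)
    case (Cons x g)
    have 1: "(\<forall>i\<le>Suc L. Q ((x # g) ! i)) \<longleftrightarrow> Q x \<and> (\<forall>i\<le>L. Q (g ! i))" for Q
      by (metis (no_types, lifting) Suc_le_mono le0 not0_implies_Suc nth_Cons_0 nth_Cons_Suc)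
    have 2: "(\<forall>i<Suc L. \<bar>(x # g) ! (i + 1) - (x # g) ! i\<bar> = 1) \<longleftrightarrow> \<bar>g ! 0 - x\<bar> = 1 \<and> (\<forall>i<L. \<bar>g ! (i + 1) - g ! i\<bar> = 1)"
      by (simp add: All_less_Suc2)
    show ?thesis unfolding paths_def mem_Collect_eq Cons using 1[of "\<lambda>y. 1 \<le> y \<and> y \<le> p' - 1"] 2 by auto
  qed (auto simp: paths_def)
  then show ?thesis by (auto simp: image_iff)
qed

lemma finite_paths: "finite (paths p' a b L)"
  by (induction L arbitrary: a) (auto simp: paths_0 paths_Suc)

lemma sum_paths_Suc:
  "(\<Sum>h\<in>paths p' a b (Suc L). f h) = (if 1 \<le> a \<and> a \<le> p' - 1 then \<Sum>e\<in>{1, - 1}. \<Sum>h\<in>paths p' (a + e) b L. f (a # h) else 0)"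
proof -
  have dis: "paths p' (a + 1) b L \<inter> paths p' (a + - 1) b L = {}" by (auto simp: paths_def)
  have "(\<Sum>h\<in>(#) a ` (\<Union>e\<in>{1, - 1}. paths p' (a + e) b L). f h) = (\<Sum>h\<in>(\<Union>e\<in>{1, - 1}. paths p' (a + e) b L). f (a # h))"
    by (subst sum.reindex) (auto simp: inj_on_def)
  also have "\<dots> = (\<Sum>e\<in>{1, - 1}. \<Sum>h\<in>paths p' (a + e) b L. f (a # h))"
    by (rule sum.UNION_disjoint) (use dis finite_paths in auto)
  finally show ?thesis by (simp add: paths_Suc)
qed

lemma path_Cons: "h \<in> paths p' a b L \<Longrightarrow> \<exists>g. h = a # g"
  by (cases h) (auto simp: paths_def)

context model
begin

lemma rho_step:
  assumes "1 \<le> x" "x \<le> H" "d = 1 \<or> d = - 1" "e = 1 \<or> e = - 1"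
  shows "rho r (x + e) e = rho r x d + d * score r x d e"
  using assms r_step[of x] r_step[of "x - 1"] by (auto simp: rho_def score_def)

text \<open>Telescoping of \<open>rho_step\<close> along the path. This is what allows the recursion
  of \<open>path_gf\<close> to know both counts from their sum.\<close>

lemma score_count_diff:
  assumes "valid_ext H g" "g = x # ys" "ys \<noteq> []" "d = 1 \<or> d = - 1"
  shows "score_count r 1 d g - score_count r (- 1) d g
    = rho r (last g) (last g - last (butlast g)) - rho r x d"
  using assms
proof (induction g arbitrary: x ys d rule: induct_list012)
  case (3 x' y xs)
  then have x: "x' = x" "ys = y # xs" "1 \<le> x" "x \<le> H" by auto
  have yd: "y - x = 1 \<or> y - x = - 1" using "3.prems"(1) x by auto
  have rd: "rho r (x + (y - x)) (y - x) = rho r x d + d * score r x d (y - x)"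
    by (rule rho_step) (use x yd "3.prems"(4) in auto)
  have sd: "of_bool (d = 1) * score r x d (y - x) - of_bool (d = - 1) * score r x d (y - x) = d * score r x d (y - x)"
    using "3.prems"(4) by auto
  show ?case
  proof (cases xs)
    case Nil
    then show ?thesis using rd sd x by simp
  next
    case (Cons z zs)
    have "score_count r 1 (y - x) (y # xs) - score_count r (- 1) (y - x) (y # xs)
      = rho r (last (y # xs)) (last (y # xs) - last (butlast (y # xs))) - rho r y (y - x)"
      by (rule "3.IH"(2)) (use 3 x yd Cons in auto)
    then show ?thesis using rd sd x Cons by simp
  qed
qed auto

lemma path_gf_eq_sum:
  assumes c: "c - b = 1 \<or> c - b = - 1" "0 \<le> c" "c \<le> H" and d: "d = 1 \<or> d = - 1" and z: "z \<noteq> 0"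
  shows "path_gf z r H c (c - b) (Suc L) a d S
    = (\<Sum>h\<in>paths p' a b L. if score_count r 1 d (h @ [c]) + score_count r (- 1) d (h @ [c]) = S
        then (z ^ 4) powi rec_wt r (h @ [c]) else 0)"
  using d
proof (induction L arbitrary: a d S)
  case 0
  have "path_gf z r H c (c - b) (Suc 0) a d S = of_bool (1 \<le> a \<and> a \<le> H \<and> c = a + (c - b) \<and> S = score r a d (c - b))"
  proof (cases "S \<le> 1")
    case True
    then have "path_gf z r H c (c - b) (Suc 0) a d S = Phi z p p' a d c (c - b) 0 (nat (1 - S))"
      by (simp add: Phi_def)
    then show ?thesis using Phi_0[OF c(1), of z p p' a d c "nat (1 - S)"] True by auto
  next
    case False
    then show ?thesis using score_cases[of r a d "c - b"] by (auto simp: path_gf_gt)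
  qed
  then show ?case using 0 by (auto simp: paths_0)
next
  case (Suc L)
  have val: "valid_ext H (h @ [c])" if "h \<in> paths p' a' b L'" for h a' L'
    using that
  proof (induction L' arbitrary: a' h)
    case 0
    then show ?case using c by (auto simp: paths_0 split: if_splits)
  next
    case (Suc L')
    then have "1 \<le> a' \<and> a' \<le> H \<and> (\<exists>e\<in>{1, - 1}. \<exists>g\<in>paths p' (a' + e) b L'. h = a' # g)"
      by (auto simp: paths_Suc split: if_splits)
    then obtain e g where g: "h = a' # g" "g \<in> paths p' (a' + e) b L'" "e = 1 \<or> e = - 1" "1 \<le> a'" "a' \<le> H"
      by blast
    with path_Cons obtain g' where "g = (a' + e) # g'" by blast
    then show ?case using g Suc.IH[OF g(2)] by auto
  qed
  have lastb: "last (butlast (h @ [c])) = b" if "h \<in> paths p' a' b L'" for h a' L'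
  proof -
    have "length h = L' + 1" "h ! L' = b" using that by (auto simp: paths_def)
    then show ?thesis using last_conv_nth[of h] by force
  qed
  have "z powi (2 * (S - score r a d e - e * (rho r c (c - b) - rho r (a + e) e))) * path_gf z r H c (c - b) (Suc L) (a + e) e (S - score r a d e)
    = (\<Sum>h\<in>paths p' (a + e) b L. if score_count r 1 d ((a # h) @ [c]) + score_count r (- 1) d ((a # h) @ [c]) = S
        then (z ^ 4) powi rec_wt r ((a # h) @ [c]) else 0)" if e: "e \<in> {1, - 1}" for e
  proof -
    have e': "e = 1 \<or> e = - 1" using e by auto
    show ?thesis unfolding Suc.IH[OF e'] sum_distrib_left
    proof (rule sum.cong[OF refl])
      fix h assume h: "h \<in> paths p' (a + e) b L"
      with path_Cons obtain g where g: "h = (a + e) # g" by blast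
      let ?u = "score_count r 1 e (h @ [c])" and ?l = "score_count r (- 1) e (h @ [c])"
      have s: "score_count r w d ((a # h) @ [c]) = of_bool (d = w) * score r a d e + score_count r w e (h @ [c])" for w
        by (simp add: g)
      have w: "rec_wt r ((a # h) @ [c]) = score_count r (- e) e (h @ [c]) + rec_wt r (h @ [c])"
        by (simp add: g)
      have tot: "score_count r 1 d ((a # h) @ [c]) + score_count r (- 1) d ((a # h) @ [c]) = score r a d e + (?u + ?l)"
        unfolding s using Suc.prems by auto
      have diff: "?u - ?l = rho r c (c - b) - rho r (a + e) e"
        using score_count_diff[OF val[OF h], of "a + e" "g @ [c]" e] e' lastb[OF h] g by simp
      have z4: "(z ^ 4) powi k = z powi (4 * k)" for k
        using power_int_mult[of z 4 k] by (simp only: power_int_numeral)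
      show "z powi (2 * (S - score r a d e - e * (rho r c (c - b) - rho r (a + e) e)))
          * (if ?u + ?l = S - score r a d e then (z ^ 4) powi rec_wt r (h @ [c]) else 0)
        = (if score_count r 1 d ((a # h) @ [c]) + score_count r (- 1) d ((a # h) @ [c]) = S
        then (z ^ 4) powi rec_wt r ((a # h) @ [c]) else 0)"
      proof (cases "?u + ?l = S - score r a d e")
        case True
        have "2 * (S - score r a d e - e * (rho r c (c - b) - rho r (a + e) e)) = 4 * score_count r (- e) e (h @ [c])"
        proof -
          have "S - score r a d e = ?u + ?l" "rho r c (c - b) - rho r (a + e) e = ?u - ?l" using True diff by simp_all
          then have "2 * (S - score r a d e - e * (rho r c (c - b) - rho r (a + e) e)) = 2 * (?u + ?l - e * (?u - ?l))" by (simp only:)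
          then show ?thesis using e' by (elim disjE) simp_all
        qed
        then show ?thesis unfolding tot w z4 using True z by (simp add: power_int_add algebra_simps)
      next
        case False
        then show ?thesis unfolding tot by auto
      qed
    qed
  qed
  note summand = this
  show ?case
  proof (cases "1 \<le> a \<and> a \<le> H")
    case True
    then show ?thesis unfolding sum_paths_Suc path_gf.simps(2)[of _ _ _ _ _ "Suc L"] if_P[OF True]
      by (intro sum.cong refl summand)
  next
    case False
    show ?thesis unfolding sum_paths_Suc path_gf.simps(2)[of _ _ _ _ _ "Suc L"] if_not_P[OF False] ..
  qed
qed

lemma even_band_iff: "0 \<le> h \<Longrightarrow> h \<le> p' - 2 \<Longrightarrow> even_band p p' h \<longleftrightarrow> r h = r (h + 1)"
  by (simp add: even_band_def r_inside)

lemma score_count_sum: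
  assumes "valid_ext H g" "length g \<ge> 2"
  shows "score_count r w d g = of_bool (d = w) * score r (g ! 0) d (g ! 1 - g ! 0)
    + (\<Sum>k = 1..<length g - 1. of_bool (scoring p p' g k \<and> g ! k - g ! (k - 1) = w))"
  using assms
proof (induction g arbitrary: d rule: induct_list012)
  case (3 x y xs)
  let ?P = "\<lambda>g k. of_bool (scoring p p' g k \<and> g ! k - g ! (k - 1) = w) :: int"
  show ?case
  proof (cases xs)
    case Nil
    then show ?thesis by simp
  next
    case (Cons z zs)
    have v: "valid_ext H (y # z # zs)" using 3 Cons by simp
    then have y: "1 \<le> y" "y \<le> H" "\<bar>z - y\<bar> = 1" "0 \<le> z" "z \<le> H"
      by (cases zs; auto)+
    have xy: "y - x = 1 \<or> y - x = - 1" using "3.prems"(1) by auto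
    have sc: "(scoring p p' (x # y # z # zs) 1) \<longleftrightarrow> score r y (y - x) (z - y) = 1"
    proof -
      have zc: "z = y + 1 \<or> z = y - 1" using y by auto
      have eb: "even_band p p' (min y z) \<longleftrightarrow> r y = r z"
        using zc
      proof
        assume "z = y + 1" then show ?thesis using even_band_iff[of y] y by simp
      next
        assume "z = y - 1" then show ?thesis using even_band_iff[of z] y by (simp add: min_def) metis
      qed
      have lhs: "scoring p p' (x # y # z # zs) 1 \<longleftrightarrow> (if z - y = y - x then r y \<noteq> r z else r y = r z)"
        by (simp add: scoring_def straight_def Let_def eb)
      show ?thesis
      proof (cases "z - y = y - x")
        case True
        then have "y + (y - x) = z" by simp
        then show ?thesis unfolding lhs score_def using True by (simp only: if_True) auto
      next
        case False
        then have "x = z" using zc xy by auto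
        then show ?thesis unfolding lhs score_def using False by auto
      qed
    qed
    have shift: "?P (x # y # xs) (Suc k) = ?P (y # xs) k" if "1 \<le> k" for k
      using that by (cases k) (auto simp: scoring_def straight_def)
    have "(\<Sum>k = 1..<length (x # y # xs) - 1. ?P (x # y # xs) k) = ?P (x # y # xs) 1 + (\<Sum>k = 2..<length (x # y # xs) - 1. ?P (x # y # xs) k)"
      using Cons by (subst sum.atLeast_Suc_lessThan) (auto simp: numeral_2_eq_2)
    also have "(\<Sum>k = 2..<length (x # y # xs) - 1. ?P (x # y # xs) k) = (\<Sum>k = 1..<length (y # xs) - 1. ?P (x # y # xs) (Suc k))"
      using sum.shift_bounds_Suc_ivl[of "?P (x # y # xs)" 1 "length (y # xs) - 1"] Cons by (simp add: numeral_2_eq_2)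
    also have "\<dots> = (\<Sum>k = 1..<length (y # xs) - 1. ?P (y # xs) k)"
      by (intro sum.cong refl shift) auto
    finally have S: "(\<Sum>k = 1..<length (x # y # xs) - 1. ?P (x # y # xs) k) = ?P (x # y # xs) 1 + (\<Sum>k = 1..<length (y # xs) - 1. ?P (y # xs) k)" .
    have P1: "?P (x # y # xs) 1 = of_bool (y - x = w) * score r y (y - x) (z - y)"
      using sc score_cases[of r y "y - x" "z - y"] Cons by auto
    have "score_count r w (y - x) (y # xs) = of_bool (y - x = w) * score r ((y # xs) ! 0) (y - x) ((y # xs) ! 1 - (y # xs) ! 0)
      + (\<Sum>k = 1..<length (y # xs) - 1. ?P (y # xs) k)"
      by (rule "3.IH"(2)) (use 3 v Cons in auto)
    then show ?thesis unfolding S P1 using Cons by simp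
  qed
qed auto

lemma rec_wt_eq:
  assumes "valid_ext H g"
  shows "rec_wt r g = (\<Sum>i = 1..<length g - 1. vertex_wt p p' g i)"
  using assms
proof (induction g rule: induct_list012)
  case (3 x y xs)
  have v: "valid_ext H (y # xs)" using 3 by simp
  define e where "e = y - x"
  have e: "e = 1 \<or> e = - 1" using "3.prems"(1) by (auto simp: e_def)
  show ?case
  proof (cases xs)
    case Nil
    then show ?thesis by simp
  next
    case (Cons z zs)
    let ?g = "x # y # xs" and ?g' = "y # xs"
    have shift: "vertex_wt p p' ?g (Suc k) = vertex_wt p p' ?g' k + of_bool (scoring p p' ?g' k \<and> ?g' ! k - ?g' ! (k - 1) = - e)"
      if k: "k \<in> {1..<length ?g' - 1}" for k
    proof -
      have s: "scoring p p' ?g (Suc k) \<longleftrightarrow> scoring p p' ?g' k"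
        using k by (cases k) (auto simp: scoring_def straight_def)
      have n: "?g ! Suc k = ?g' ! k" "?g ! (Suc k - 1) = ?g' ! (k - 1)" "?g ! 0 = y - e" "?g' ! 0 = y"
        using k by (auto simp: e_def nth_Cons')
      have step: "?g' ! k - ?g' ! (k - 1) = 1 \<or> ?g' ! k - ?g' ! (k - 1) = - 1"
      proof -
        have "\<bar>g ! Suc i - g ! i\<bar> = 1" if "valid_ext H g" "Suc i < length g" for g i
          using that
        proof (induction g arbitrary: i rule: induct_list012)
          case (3 x y zs)
          then show ?case by (cases i) auto
        qed auto
        from this[OF v, of "k - 1"] k have "\<bar>?g' ! Suc (k - 1) - ?g' ! (k - 1)\<bar> = 1" by auto
        then show ?thesis using k by auto
      qed
      \<comment> \<open>Dropping the first step lowers exactly that coordinate which counts the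
        steps in its direction.\<close>
      have d1: "(int (Suc k) - (Y - (y - e))) div 2 = (int k - (Y - y)) div 2 + of_bool (e = - 1)" for Y
        using e by auto
      have d2: "(int (Suc k) + (Y - (y - e))) div 2 = (int k + (Y - y)) div 2 + of_bool (e = 1)" for Y
        using e by auto
      show ?thesis unfolding vertex_wt_def s n d1 d2 using step e by auto
    qed
    have v1: "vertex_wt p p' ?g 1 = 0" using e by (auto simp: vertex_wt_def e_def)
    have "(\<Sum>i = 1..<length ?g - 1. vertex_wt p p' ?g i) = vertex_wt p p' ?g 1 + (\<Sum>i = 2..<length ?g - 1. vertex_wt p p' ?g i)"
      using Cons by (subst sum.atLeast_Suc_lessThan) (auto simp: numeral_2_eq_2)
    also have "(\<Sum>i = 2..<length ?g - 1. vertex_wt p p' ?g i) = (\<Sum>k = 1..<length ?g' - 1. vertex_wt p p' ?g (Suc k))"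
      using sum.shift_bounds_Suc_ivl[of "vertex_wt p p' ?g" 1 "length ?g' - 1"] Cons by (simp add: numeral_2_eq_2)
    also have "\<dots> = (\<Sum>k = 1..<length ?g' - 1. vertex_wt p p' ?g' k + of_bool (scoring p p' ?g' k \<and> ?g' ! k - ?g' ! (k - 1) = - e))"
      by (rule sum.cong[OF refl shift])
    also have "\<dots> = rec_wt r ?g' + (\<Sum>k = 1..<length ?g' - 1. of_bool (scoring p p' ?g' k \<and> ?g' ! k - ?g' ! (k - 1) = - e))"
      unfolding sum.distrib by (subst "3.IH"(2)) (use v in auto)
    also have "(\<Sum>k = 1..<length ?g' - 1. of_bool (scoring p p' ?g' k \<and> ?g' ! k - ?g' ! (k - 1) = - e)) = score_count r (- e) e ?g'"
      using score_count_sum[OF v, of "- e" e] Cons e by auto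
    finally show ?thesis unfolding v1 by (simp add: e_def)
  qed
qed auto

lemma path_valid_ext:
  assumes "h \<in> paths p' a b L" "c - b = 1 \<or> c - b = - 1" "0 \<le> c" "c \<le> H"
  shows "valid_ext H (h @ [c])"
  using assms(1)
proof (induction L arbitrary: a h)
  case 0
  then show ?case using assms by (auto simp: paths_0 split: if_splits)
next
  case (Suc L)
  then have "1 \<le> a \<and> a \<le> H \<and> (\<exists>e\<in>{1, - 1}. \<exists>g\<in>paths p' (a + e) b L. h = a # g)"
    by (auto simp: paths_Suc split: if_splits)
  then obtain e g where g: "h = a # g" "g \<in> paths p' (a + e) b L" "e = 1 \<or> e = - 1" "1 \<le> a" "a \<le> H"
    by blast
  with path_Cons obtain g' where "g = (a + e) # g'" by blast
  then show ?case using g Suc.IH[OF g(2)] by auto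
qed

text \<open>The weight ignores vertex 0, so the entering direction \<open>d\<close> may be chosen at
  will: it only shifts the score of that vertex, and the sum over all \<open>m\<close> forgets the
  number of scoring vertices.\<close>

lemma chi_eq_path_gf:
  assumes c: "c - b = 1 \<or> c - b = - 1" "0 \<le> c" "c \<le> H" and d: "d = 1 \<or> d = - 1" and z: "z \<noteq> 0"
  shows "chi p p' a b c L (z ^ 4) = (\<Sum>m\<le>L + 1. path_gf z r H c (c - b) (Suc L) a d (int L + 1 - int m))"
proof -
  let ?tot = "\<lambda>h. score_count r 1 d (h @ [c]) + score_count r (- 1) d (h @ [c])"
  have bd: "0 \<le> score_count r w d g \<and> score_count r 1 d g + score_count r (- 1) d g \<le> int (length g) - 1"
    if "g \<noteq> []" "d = 1 \<or> d = - 1" for g d w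
    using that
  proof (induction g arbitrary: d w rule: induct_list012)
    case (3 x y zs)
    have s: "0 \<le> score_count r w k (y # zs)" for k w
    proof -
      have "0 \<le> score r x d e" for x d e using score_cases[of r x d e] by auto
      then show ?thesis by (induction r w k "y # zs" arbitrary: y zs rule: score_count.induct) auto
    qed
    have t: "score_count r 1 k (y # zs) + score_count r (- 1) k (y # zs) \<le> int (length (y # zs)) - 1" for k
    proof (induction zs arbitrary: y k)
      case (Cons z zs)
      have "of_bool (k = 1) * score r y k (z - y) + of_bool (k = - 1) * score r y k (z - y) \<le> 1"
        using score_cases[of r y k "z - y"] by auto
      then show ?case using Cons[of "z - y" z] by simp
    qed simp
    have "0 \<le> score r x d (y - x)" "of_bool (d = 1) * score r x d (y - x) + of_bool (d = - 1) * score r x d (y - x) \<le> 1"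
      using score_cases[of r x d "y - x"] by auto
    then show ?case using s[of w "y - x"] t[of "y - x"] by simp
  qed auto
  have "(\<Sum>m\<le>L + 1. path_gf z r H c (c - b) (Suc L) a d (int L + 1 - int m))
    = (\<Sum>h\<in>paths p' a b L. \<Sum>m\<le>L + 1. if ?tot h = int L + 1 - int m then (z ^ 4) powi rec_wt r (h @ [c]) else 0)"
    unfolding path_gf_eq_sum[OF c d z] by (rule sum.swap)
  also have "\<dots> = (\<Sum>h\<in>paths p' a b L. (z ^ 4) powi path_wt p p' c h)"
  proof (rule sum.cong[OF refl])
    fix h assume h: "h \<in> paths p' a b L"
    then have l: "length h = L + 1" by (simp add: paths_def)
    have t: "0 \<le> ?tot h" "?tot h \<le> int L + 1"
      using bd[of "h @ [c]" d 1] bd[of "h @ [c]" d "- 1"] d l by auto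
    define m0 where "m0 = nat (int L + 1 - ?tot h)"
    have m0: "?tot h = int L + 1 - int m \<longleftrightarrow> m = m0" for m using t by (auto simp: m0_def)
    have "rec_wt r (h @ [c]) = path_wt p p' c h"
      unfolding path_wt_def rec_wt_eq[OF path_valid_ext[OF h c]]
      by (rule sum.cong) (auto simp: l)
    moreover have "m0 \<le> L + 1" using t by (simp add: m0_def)
    ultimately show "(\<Sum>m\<le>L + 1. if ?tot h = int L + 1 - int m then (z ^ 4) powi rec_wt r (h @ [c]) else 0) = (z ^ 4) powi path_wt p p' c h"
      unfolding m0 by simp
  qed
  finally show ?thesis by (simp add: chi_def)
qed

text \<open>Exchanging the extra height changes the last vertex from straight to peak or back, and
  at the same time changes the parity of the band ahead; its scoring status stays the same.\<close>

lemma chi_boundary: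
  assumes b: "1 \<le> b" "b + 1 \<le> H" and r: "r (b + 1) - r (b - 1) = 1"
    and c: "c = b + 1 \<or> c = b - 1" and c': "c' = b + 1 \<or> c' = b - 1"
  shows "chi p p' a b c L q = chi p p' a b c' L q"
  unfolding chi_def
proof (rule sum.cong[OF refl])
  fix h assume h: "h \<in> paths p' a b L"
  have l: "length h = L + 1" and hL: "h ! L = b" using h by (auto simp: paths_def)
  have ne: "even_band p p' (b - 1) \<longleftrightarrow> \<not> even_band p p' b"
  proof -
    have "even_band p p' b \<longleftrightarrow> r b = r (b + 1)" "even_band p p' (b - 1) \<longleftrightarrow> r (b - 1) = r b"
      using even_band_iff[of b] even_band_iff[of "b - 1"] b by simp_all
    moreover have "r (b - 1) = r b \<longleftrightarrow> r b \<noteq> r (b + 1)"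
      using r r_step[of b] r_step[of "b - 1"] b by (simp; linarith)
    ultimately show ?thesis by simp
  qed
  have "vertex_wt p p' (h @ [c]) i = vertex_wt p p' (h @ [c']) i" if i: "i \<in> {1..L}" for i
  proof -
    have n: "(h @ [k]) ! j = h ! j" if "j \<le> L" for j k using that l by (simp add: nth_append)
    have "scoring p p' (h @ [c]) i \<longleftrightarrow> scoring p p' (h @ [c']) i"
    proof (cases "i = L")
      case False
      then have "i + 1 \<le> L" "i \<le> L" "i - 1 \<le> L" using i by auto
      then show ?thesis by (simp add: scoring_def straight_def n del: One_nat_def)
    next
      case True
      have L1: "(h @ [k]) ! Suc L = k" for k using l by (metis nth_append_length Suc_eq_plus1)
      have "\<forall>k<L. \<bar>h ! (k + 1) - h ! k\<bar> = 1" using h by (simp add: paths_def)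
      moreover have "L - 1 < L" using i True by simp
      ultimately have "\<bar>h ! (L - 1 + 1) - h ! (L - 1)\<bar> = 1" by blast
      then have st: "b - h ! (L - 1) = 1 \<or> b - h ! (L - 1) = - 1" using i True hL by auto
      have "scoring p p' (h @ [k]) L \<longleftrightarrow> (if k - b = b - h ! (L - 1) then \<not> even_band p p' (min b k) else even_band p p' (min b k))" for k
        by (auto simp: scoring_def straight_def n L1 hL Let_def)
      then show ?thesis unfolding True using st c c' ne by auto
    qed
    moreover have "i \<le> L" "i - 1 \<le> L" "0 \<le> L" using i by auto
    ultimately show ?thesis by (simp add: vertex_wt_def n)
  qed
  note vw = this
  have "path_wt p p' c h = path_wt p p' c' h"
    unfolding path_wt_def l by (rule sum.cong[OF refl], rule vw) simp
  then show "q powi path_wt p p' c h = q powi path_wt p p' c' h" by simp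
qed

end

context ladder
begin

text \<open>The model is produced by climbing, not given; its parameters and end heights are read
  off from \<open>val\<close> and are identified with the given ones later. \<open>f\<close> is the
  direction towards the extra height, and it is only pinned down where the choice would
  matter.\<close>

lemma ladder_chi:
  "\<exists>p p' a b f. model p p' \<and> (brk 0 \<longleftrightarrow> p' < 2 * p) \<and>
     p' = 2 * fst (fg brk (1, 0) t) + snd (fg brk (1, 0) t) \<and> p = 2 * fst (fg brk (0, 1) t) + snd (fg brk (0, 1) t) \<and>
     a = side TL p' (kap sL) \<and> b = side TR p' (kap sR) \<and> b - a = al 0 \<and>
     (if \<exists>i. 0 < i \<and> i \<le> sR \<and> brk i then 2 \<le> b \<and> b \<le> p' - 2 \<and> odd_below p p' (b + 1) - odd_below p p' (b - 1) = 1
      else f = (if sR = 0 then sg TR else - sg TR)) \<and> (f = 1 \<or> f = - 1) \<and>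
     (\<forall>z::'a::field. generic z \<longrightarrow> (\<forall>L. chi p p' a b (b + f) L (z ^ 4) = (\<Sum>m\<le>L + 1. Fpost 0 z L m)))"
proof -
  obtain p p' a d hT dT where st: "stage 0 p p' a d hT dT" and ok: "paths_ok TYPE('a) 0 p p' a d hT dT"
    using stage_ex[OF t0] by blast
  note S = st[unfolded stage_def]
  interpret model p p' using S by blast
  have pp: "2 * p < p'" and a: "1 \<le> a" "a \<le> H" "1 \<le> a - d" "a - d \<le> H" and d: "d = 1 \<or> d = - 1"
    and T: "1 \<le> hT" "hT \<le> H" "1 \<le> hT - dT" "hT - dT \<le> H" and dT: "dT = 1 \<or> dT = - 1"
    and al0: "hT - dT - a = al 0"
    using S by blast+
  have Sv: "val brk s 0 p' p = 2 * fst (fg brk s t) + snd (fg brk s t)" for s using S by blast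
  have L0: "sL \<le> 0 \<Longrightarrow> a = end_h TL H \<and> d = - sg TL" and R0: "sR \<le> 0 \<Longrightarrow> hT = end_h TR H + sg TR \<and> dT = sg TR" using S by blast+
  have L1: "0 < sL \<Longrightarrow> val brk (1, 0) 0 (side TL p' a) (side TL p (rho r a d + d)) = kap sL" using S by blast
  have R1: "0 < sR \<Longrightarrow> val brk (1, 0) 0 (side TR p' (hT - dT)) (side TR p (rho r hT dT)) = kap sR" using S by blast
  have RI: "right_info 0 p p' (hT - dT) dT" using S by blast
  define pf where "pf = (if brk 0 then p' - p else p)"
  define b where "b = hT - dT"
  have m: "model pf p'" using model_dual model_axioms by (simp add: pf_def)
  have b0: "brk 0 \<longleftrightarrow> p' < 2 * pf" using pp p by (auto simp: pf_def)
  have p1: "p' = 2 * fst (fg brk (1, 0) t) + snd (fg brk (1, 0) t)" using Sv[of "(1, 0)"] by (simp add: val_def)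
  have p2: "pf = 2 * fst (fg brk (0, 1) t) + snd (fg brk (0, 1) t)" using Sv[of "(0, 1)"] by (simp add: val_def pf_def)
  have side2: "side T w (side T w x) = x" for T w x by (simp add: side_def)
  have av: "a = side TL p' (kap sL)"
  proof (cases "sL = 0")
    case True
    then show ?thesis using L0 by (auto simp: side_def end_h_def)
  next
    case False
    then have "side TL p' a = kap sL" using L1 by (simp add: val_def)
    then show ?thesis using side2[of TL p' a] by simp
  qed
  have bv: "b = side TR p' (kap sR)"
  proof (cases "sR = 0")
    case True
    then show ?thesis using R0 by (auto simp: side_def end_h_def b_def)
  next
    case False
    then have "side TR p' b = kap sR" using R1 by (simp add: val_def b_def)
    then show ?thesis using side2[of TR p' b] by simp
  qed
  have fl: "r 2 = 0" "r (H - 1) = r H" using flat_ends[OF pp] by auto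
  have info: "if \<exists>i. 0 < i \<and> i \<le> sR \<and> brk i then 2 \<le> b \<and> b \<le> p' - 2 \<and> odd_below pf p' (b + 1) - odd_below pf p' (b - 1) = 1
      else dT = (if sR = 0 then sg TR else - sg TR)"
  proof (cases "\<exists>i. 0 < i \<and> i \<le> sR \<and> brk i")
    case True
    then have "0 < sR" by auto
    then have bd: "r (b + 1) - r (b - 1) = 1" using RI True unfolding right_info_def b_def by presburger
    have "b \<noteq> 1" using bd fl r_0 by auto
    moreover have "b \<noteq> H" using bd fl r_top by auto
    ultimately have b2: "2 \<le> b" "b \<le> p' - 2" using T by (auto simp: b_def)
    have "odd_below (p' - p) p' (b + 1) - odd_below (p' - p) p' (b - 1) = 1"
      using r_dual[of "b + 1"] r_dual[of "b - 1"] b2 bd by simp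
    then show ?thesis using True b2 bd by (simp add: pf_def)
  next
    case False
    then show ?thesis using RI R0 unfolding right_info_def by auto
  qed
  have ch: "chi pf p' a b (b + dT) L (z ^ 4) = (\<Sum>m\<le>L + 1. Fpost 0 z L m)" if z: "generic z" for z :: 'a and L
  proof -
    have z0: "z \<noteq> 0" using z by (simp add: generic_def)
    have hb: "b + dT = hT" by (simp add: b_def)
    have c: "hT - b = 1 \<or> hT - b = - 1" "0 \<le> hT" "hT \<le> H" using T dT by (auto simp: b_def)
    have db: "hT - b = dT" by (simp add: b_def)
    show ?thesis
    proof (cases "brk 0")
      case False
      have "chi p p' a b hT L (z ^ 4) = (\<Sum>m\<le>L + 1. Phi z p p' a d hT dT L m)"
        unfolding Phi_def using chi_eq_path_gf[OF c d z0, of a L] unfolding db .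
      also have "\<dots> = (\<Sum>m\<le>L + 1. Fpost 0 z L m)"
        using ok z by (simp add: paths_ok_def Fpost_nonbreak[OF t0 False])
      finally show ?thesis using False by (simp add: pf_def hb)
    next
      case True
      \<comment> \<open>A break at 0 calls for one last dualisation, without insertion: level 0 has
        \<open>2 * p < p'\<close>, while the final model has the opposite inequality.\<close>
      have "chi (p' - p) p' a b hT L (z ^ 4) = (\<Sum>m\<le>L + 1. path_gf z (odd_below (p' - p) p') H hT dT (Suc L) a d (int L + 1 - int m))"
        using model.chi_eq_path_gf[OF model_dual c d z0, of a L] unfolding db .
      also have "\<dots> = (\<Sum>m\<le>L + 1. z powi ((int L)\<^sup>2 - (hT - dT - a)\<^sup>2) * path_gf (inverse z) r H hT dT (Suc L) a d (int m))"
        by (rule sum.cong[OF refl]) (simp add: Phi_dual[OF z0 a d T(1,2) dT])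
      also have "\<dots> = (\<Sum>m\<le>L + 1. z powi ((int L)\<^sup>2 - (hT - dT - a)\<^sup>2) * Phi (inverse z) p p' a d hT dT L m)"
        by (rule sum.reindex_bij_witness[of _ "\<lambda>m. L + 1 - m" "\<lambda>m. L + 1 - m"]) (auto simp: Phi_def of_nat_diff)
      also have "\<dots> = (\<Sum>m\<le>L + 1. Fpost 0 z L m)"
        using ok generic_inverse[OF z] by (simp add: paths_ok_def Fpost_break[OF z t0 True] al0)
      finally show ?thesis using True by (simp add: pf_def hb)
    qed
  qed
  have ab: "b - a = al 0" using al0 by (simp add: b_def)
  show ?thesis
    by (rule exI[of _ pf], rule exI[of _ p'], rule exI[of _ a], rule exI[of _ b], rule exI[of _ dT], intro conjI allI impI)
      (fact m b0 p1 p2 av bv ab info dT ch)+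
qed

section \<open>Parities of the summation variables\<close>

definition row :: "(nat \<Rightarrow> int) \<Rightarrow> nat \<Rightarrow> int" where
  "row x i = (if brk i then x i + x (Suc i) else 2 * x i - x (Suc i)) - x (i - 1)"

lemma Dl_parity: "even (Dl TL sL j - Dl TR sR j - (u TL sL j + u TR sR j))"
proof -
  have e: "even (Dl T s j - u T s j)" for T s by (auto simp: Dl_def u_def)
  have "Dl TL sL j - Dl TR sR j - (u TL sL j + u TR sR j) = (Dl TL sL j - u TL sL j) - (Dl TR sR j - u TR sR j) - 2 * u TR sR j"
    by simp
  also have "even \<dots>" by (rule dvd_diff[OF dvd_diff[OF e e] dvd_triv_left])
  finally show ?thesis .
qed

text \<open>Eliminating the second component from the gamma recursion leaves, modulo 2, the linear
  system that defines Q. So Q is the parity of \<open>al\<close>: path lengths are congruent to the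
  differences of the end heights.\<close>

lemma row_al:
  assumes "1 \<le> i" "i \<le> t"
  shows "even (row al i - (u TL sL i + u TR sR i))"
proof -
  obtain j where j: "i = Suc j" "j < t" using assms by (cases i) auto
  have 1: "al j = al (Suc j) + (be (Suc j) + Dl TL sL (Suc j) - Dl TR sR (Suc j))"
    using gs_values(1)[OF j(2)] by (simp add: bpre_def)
  have 2: "even (be (Suc j) - (if brk (Suc j) then al (Suc (Suc j)) else al (Suc j) - al (Suc (Suc j))))"
  proof (cases "Suc j < t")
    case True
    then show ?thesis using gs_values(1,2)[OF True] by auto
  next
    case False
    then show ?thesis using brk_lt[of "Suc j"] by (auto simp: be_def al_def gs_t)
  qed
  let ?X = "if brk (Suc j) then al (Suc (Suc j)) else al (Suc j) - al (Suc (Suc j))"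
  let ?U = "u TL sL i + u TR sR i"
  have "row al i - ?U = - (be (Suc j) - ?X) - (Dl TL sL i - Dl TR sR i - ?U) - 2 * ?U"
    unfolding row_def j(1) using 1 by simp
  moreover have "even (- (be (Suc j) - ?X) - (Dl TL sL i - Dl TR sR i - ?U) - 2 * ?U)"
    by (rule dvd_diff[OF dvd_diff[OF iffD2[OF dvd_minus_iff 2] Dl_parity] dvd_triv_left])
  ultimately show ?thesis by metis
qed

text \<open>Row \<open>i\<close> contains the entry \<open>i - 1\<close> with coefficient -1, so
  solutions modulo 2 that vanish from \<open>t\<close> on are determined from the top index
  downwards and must agree with \<open>al\<close>.\<close>

lemma row_parity:
  assumes x: "\<And>i. t \<le> i \<Longrightarrow> x i = 0"
  shows "(\<forall>i\<in>{1..t}. even (row x i - (u TL sL i + u TR sR i))) \<longleftrightarrow> (\<forall>j<t. even (x j - al j))"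
proof
  assume r: "\<forall>i\<in>{1..t}. even (row x i - (u TL sL i + u TR sR i))"
  have al_t: "al i = 0" if "t \<le> i" for i using that by (simp add: al_def gs_t)
  have "even (x j - al j) \<and> even (x (Suc j) - al (Suc j))" if "j \<le> t" for j
    using that
  proof (induction j rule: inc_induct)
    case base
    then show ?case using x al_t by simp
  next
    case (step n)
    have "even (row x (Suc n) - (u TL sL (Suc n) + u TR sR (Suc n)))" "even (row al (Suc n) - (u TL sL (Suc n) + u TR sR (Suc n)))"
      using r row_al[of "Suc n"] step by auto
    then have "even (row x (Suc n) - row al (Suc n))" by (simp add: even_diff)
    moreover have "row x (Suc n) - row al (Suc n) = (if brk (Suc n) then (x (Suc n) - al (Suc n)) + (x (Suc (Suc n)) - al (Suc (Suc n)))
        else 2 * (x (Suc n) - al (Suc n)) - (x (Suc (Suc n)) - al (Suc (Suc n)))) - (x n - al n)"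
      by (simp add: row_def)
    ultimately have "even (x n - al n)" using step.IH by (auto split: if_splits)
    then show ?case using step.IH by simp
  qed
  then show "\<forall>j<t. even (x j - al j)" by auto
next
  assume e: "\<forall>j<t. even (x j - al j)"
  have e': "even (x j - al j)" for j
    using e x by (cases "j < t") (auto simp: al_def gs_t)
  show "\<forall>i\<in>{1..t}. even (row x i - (u TL sL i + u TR sR i))"
  proof
    fix i assume i: "i \<in> {1..t}"
    have "row x i - row al i = (if brk i then (x i - al i) + (x (Suc i) - al (Suc i))
        else 2 * (x i - al i) - (x (Suc i) - al (Suc i))) - (x (i - 1) - al (i - 1))"
      by (simp add: row_def)
    moreover have "even \<dots>" using e' by simp
    ultimately have "even (row x i - row al i)" by simp
    moreover have "even (row al i - (u TL sL i + u TR sR i))" using row_al[of i] i by simp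
    ultimately have "even ((row x i - row al i) + (row al i - (u TL sL i + u TR sR i)))" by (rule dvd_add)
    moreover have "(row x i - row al i) + (row al i - (u TL sL i + u TR sR i)) = row x i - (u TL sL i + u TR sR i)" by simp
    ultimately show "even (row x i - (u TL sL i + u TR sR i))" by metis
  qed
qed

lemma arg_row: "arg \<mu> i = 2 * int (\<mu> i) - (row (\<lambda>j. int (\<mu> j)) i - (u TL sL i + u TR sR i))"
  by (simp add: arg_def argv_def row_def)

lemma arg_parity:
  assumes "\<And>i. t \<le> i \<Longrightarrow> \<mu> i = 0"
  shows "(\<forall>i\<in>{Suc 0..t}. even (arg \<mu> i)) \<longleftrightarrow> (\<forall>j<t. even (int (\<mu> j) - al j))"
proof -
  have "even (arg \<mu> i) \<longleftrightarrow> even (row (\<lambda>j. int (\<mu> j)) i - (u TL sL i + u TR sR i))" for i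
    unfolding arg_row by simp
  then show ?thesis using row_parity[of "\<lambda>j. int (\<mu> j)"] assms by simp
qed

text \<open>The set of all vectors with the right parities is infinite in general, but a nonzero
  term satisfies \<open>chain_bound\<close> at every level and therefore comes from one of finitely
  many finite sets \<open>Wset\<close>.\<close>

lemma sum_Fpost:
  fixes z :: "'a::field"
  assumes z: "generic z" and L: "even (int L - al 0)"
  defines "M \<equiv> {m. (\<forall>j. j \<notin> {1..<t} \<longrightarrow> m j = 0) \<and> (\<forall>j\<in>{1..<t}. even (int (m j) - al j))}"
    and "tm \<equiv> \<lambda>m. z powi Epost 0 (m(0 := L)) * gprod z 0 (m(0 := L))"
  shows "finite {m \<in> M. tm m \<noteq> 0}" and "(\<Sum>m\<le>L + 1. Fpost 0 z L m) = (\<Sum>m | m \<in> M \<and> tm m \<noteq> 0. tm m)"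
proof -
  let ?W = "\<Union>k\<le>L + 1. Wset 0 L k"
  let ?t = "\<lambda>\<mu>. z powi Epost 0 \<mu> * gprod z 0 \<mu>"
  have fW: "finite ?W" using finite_Wset by auto
  have z0: "z \<noteq> 0" using z by (simp add: generic_def)
  have MW: "m(0 := L) \<in> ?W" if m: "m \<in> M" "tm m \<noteq> 0" for m
  proof -
    define \<mu> where "\<mu> = m(0 := L)"
    have \<mu>0: "\<mu> 0 = L" and \<mu>m: "j \<noteq> 0 \<Longrightarrow> \<mu> j = m j" for j by (simp_all add: \<mu>_def)
    have tm: "gprod z 0 \<mu> \<noteq> 0" using m(2) by (simp add: tm_def \<mu>_def)
    have s: "t \<le> i \<Longrightarrow> \<mu> i = 0" for i using m(1) t0 \<mu>m[of i] by (auto simp: M_def)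
    have par: "\<forall>j<t. even (int (\<mu> j) - al j)"
    proof (intro allI impI)
      fix j assume "j < t"
      then show "even (int (\<mu> j) - al j)" using m(1) L \<mu>0 \<mu>m[of j] by (cases "j = 0") (auto simp: M_def simp del: even_diff)
    qed
    have ev: "\<forall>i\<in>{Suc 0..t}. even (arg \<mu> i)" by (rule iffD2[OF arg_parity[of \<mu>, OF s] par])
    have ne: "\<forall>i\<in>{Suc 0..<t}. gauss' (z ^ 4) (arg \<mu> i div 2) (int (\<mu> i)) \<noteq> 0"
      using tm by (auto simp: gprod_def)
    have bd: "\<mu> (Suc j) \<le> \<mu> j + 1" if "j < t" for j
    proof -
      have "\<mu> (Suc j) + gr j \<le> \<mu> j + 1 \<or> \<mu> j = 0 \<and> \<mu> (Suc j) = 0"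
        by (rule chain_bound[OF z that]) (use s ev ne in auto)
      then show ?thesis by auto
    qed
    have "\<mu> \<in> Wset 0 L (\<mu> (Suc 0))" unfolding Wset_def using s ev bd \<mu>0 by auto
    moreover have "\<mu> (Suc 0) \<le> L + 1" using bd[OF t0] \<mu>0 by simp
    ultimately show ?thesis unfolding \<mu>_def by blast
  qed
  have WM: "\<mu>(0 := 0) \<in> M \<and> \<mu> 0 = L" if \<mu>: "\<mu> \<in> ?W" for \<mu>
  proof -
    have s: "t \<le> i \<Longrightarrow> \<mu> i = 0" for i using \<mu> by (auto simp: Wset_def)
    have "\<forall>i\<in>{Suc 0..t}. even (arg \<mu> i)" using \<mu> unfolding Wset_def by blast
    moreover have "(\<forall>i\<in>{Suc 0..t}. even (arg \<mu> i)) \<longleftrightarrow> (\<forall>j<t. even (int (\<mu> j) - al j))"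
      by (rule arg_parity) (rule s)
    ultimately have "\<forall>j<t. even (int (\<mu> j) - al j)" by metis
    then show ?thesis using s \<mu> by (auto simp: M_def Wset_def simp del: even_diff)
  qed
  have inj: "inj_on (\<lambda>m. m(0 := L)) {m \<in> M. tm m \<noteq> 0}"
  proof (rule inj_onI)
    fix m n assume mn: "m \<in> {m \<in> M. tm m \<noteq> 0}" "n \<in> {m \<in> M. tm m \<noteq> 0}" "m(0 := L) = n(0 := L)"
    then have "m 0 = 0" "n 0 = 0" by (auto simp: M_def)
    then show "m = n" using mn(3) by (metis fun_upd_triv fun_upd_upd)
  qed
  show "finite {m \<in> M. tm m \<noteq> 0}"
    by (rule finite_imageD[OF finite_subset[OF _ fW] inj]) (use MW in auto)
  have dj: "\<forall>i\<in>{..L + 1}. \<forall>j\<in>{..L + 1}. i \<noteq> j \<longrightarrow> Wset 0 L i \<inter> Wset 0 L j = {}"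
    by (auto simp: Wset_def)
  have "(\<Sum>m\<le>L + 1. Fpost 0 z L m) = (\<Sum>\<mu>\<in>?W. ?t \<mu>)"
    unfolding Fpost_def by (rule sum.UNION_disjoint[symmetric, OF _ _ dj]) (simp_all add: finite_Wset)
  also have "\<dots> = (\<Sum>\<mu>\<in>{\<mu> \<in> ?W. ?t \<mu> \<noteq> 0}. ?t \<mu>)"
    by (rule sum.mono_neutral_right) (use fW in auto)
  also have "\<dots> = (\<Sum>m | m \<in> M \<and> tm m \<noteq> 0. tm m)"
  proof (rule sum.reindex_bij_witness[of _ "\<lambda>m. m(0 := L)" "\<lambda>\<mu>. \<mu>(0 := 0)"])
    fix \<mu> assume \<mu>: "\<mu> \<in> {\<mu> \<in> ?W. ?t \<mu> \<noteq> 0}"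
    then have w: "\<mu>(0 := 0) \<in> M" "\<mu> 0 = L" using WM by blast+
    show e: "(\<mu>(0 := 0))(0 := L) = \<mu>" using w by auto
    show "\<mu>(0 := 0) \<in> {m. m \<in> M \<and> tm m \<noteq> 0}" using w \<mu> unfolding tm_def e by auto
    show "tm (\<mu>(0 := 0)) = ?t \<mu>" unfolding tm_def e ..
  next
    fix m assume m: "m \<in> {m. m \<in> M \<and> tm m \<noteq> 0}"
    then have "m 0 = 0" by (auto simp: M_def)
    then show "(m(0 := L))(0 := 0) = m" by auto
    show "m(0 := L) \<in> {\<mu> \<in> ?W. ?t \<mu> \<noteq> 0}" using m MW by (auto simp: tm_def)
  qed
  finally show "(\<Sum>m\<le>L + 1. Fpost 0 z L m) = (\<Sum>m | m \<in> M \<and> tm m \<noteq> 0. tm m)" .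
qed

end

section \<open>Continued fraction data\<close>

definition cf_brk :: "nat list \<Rightarrow> nat \<Rightarrow> bool" where
  "cf_brk cs j \<longleftrightarrow> (\<exists>k\<in>{1..length cs - 1}. int j = cf_tk cs k)"

text \<open>The recurrence of the \<open>y\<close> with arbitrary initial pair, indices shifted as
  in \<open>cf_y\<close>. The pair (1, 0) gives the numerators of the convergents and (0, 1) the
  denominators.\<close>

fun gy :: "nat list \<Rightarrow> int \<times> int \<Rightarrow> nat \<Rightarrow> int" where
  "gy cs s 0 = snd s"
| "gy cs s (Suc 0) = fst s"
| "gy cs s (Suc (Suc k)) = int (cs ! k) * gy cs s (Suc k) + gy cs s k"

lemma cf_y_gy: "cf_y cs k = gy cs (1, 0) k"
  by (induction cs k rule: cf_y.induct) auto

lemma gy_Cons: "gy (c # cs) (x, y) (Suc k) = gy cs (int c * x + y, x) k"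
  by (induction cs "(int c * x + y, x)" k rule: gy.induct) auto

lemma gy_linear: "gy cs (x, y) k = x * gy cs (1, 0) k + y * gy cs (0, 1) k"
  by (induction cs "(x, y)" k rule: gy.induct) (auto simp: algebra_simps)

lemma gy_nonneg: "0 \<le> x \<Longrightarrow> 0 \<le> y \<Longrightarrow> 0 \<le> gy cs (x, y) k"
  by (induction cs "(x, y)" k rule: gy.induct) auto

abbreviation cf_num :: "nat list \<Rightarrow> int" where "cf_num cs \<equiv> gy cs (1, 0) (Suc (length cs))"
abbreviation cf_den :: "nat list \<Rightarrow> int" where "cf_den cs \<equiv> gy cs (0, 1) (Suc (length cs))"

lemma cf_num_Cons: "cf_num (c # cs) = int c * cf_num cs + cf_den cs"
  unfolding length_Cons gy_Cons by (subst gy_linear) simp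

lemma cf_den_Cons: "cf_den (c # cs) = cf_num cs"
  unfolding length_Cons gy_Cons by simp

lemma cf_val_quotient:
  assumes "cs \<noteq> []" "\<forall>c\<in>set cs. 1 \<le> c"
  shows "0 < cf_num cs \<and> 0 < cf_den cs \<and> cf_val cs = of_int (cf_num cs) / of_int (cf_den cs)"
  using assms
proof (induction cs rule: cf_val.induct)
  case 1
  then show ?case by simp
next
  case (2 x)
  then show ?case by simp
next
  case (3 x y xs)
  define A where "A = cf_num (y # xs)"
  define B where "B = cf_den (y # xs)"
  have AB: "0 < A" "0 < B" "cf_val (y # xs) = of_int A / of_int B"
    using 3 unfolding A_def B_def by simp_all
  have "cf_val (x # y # xs) = of_nat x + of_int B / of_int A" using AB by simp
  also have "\<dots> = of_int (int x * A + B) / of_int A" using AB by (simp add: field_simps)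
  finally have "cf_val (x # y # xs) = of_int (int x * A + B) / of_int A" .
  moreover have "0 < int x * A + B" using AB by (simp add: add_nonneg_pos)
  ultimately show ?case
    unfolding cf_num_Cons[of x "y # xs"] cf_den_Cons[of x "y # xs"] A_def[symmetric] B_def[symmetric] using AB by blast
qed

locale contfrac =
  fixes cs :: "nat list"
  assumes ne: "cs \<noteq> []" and pos: "\<forall>i<length cs - 1. 1 \<le> cs ! i" and last2: "2 \<le> last cs"
begin

abbreviation "N j \<equiv> card {k. k < j \<and> cf_brk cs k}"

lemma tk_Suc: "cf_tk cs (Suc k) = cf_tk cs k + int (cs ! k)"
  by (simp add: cf_tk_def)

lemma tk_0: "cf_tk cs 0 = - 1"
  by (simp add: cf_tk_def)

lemma nth_pos: "k < length cs \<Longrightarrow> 1 \<le> cs ! k"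
  using pos last2 ne by (cases "k = length cs - 1") (auto simp: last_conv_nth)

lemma tk_less: "i < k \<Longrightarrow> k \<le> length cs \<Longrightarrow> cf_tk cs i < cf_tk cs k"
proof (induction k)
  case (Suc k)
  then show ?case using nth_pos[of k] by (cases "i = k") (auto simp: tk_Suc)
qed simp

lemma tk_le: "i \<le> k \<Longrightarrow> k \<le> length cs \<Longrightarrow> cf_tk cs i \<le> cf_tk cs k"
  using tk_less[of i k] by (cases "i = k") auto

lemma tk_less_iff: "i \<le> length cs \<Longrightarrow> k \<le> length cs \<Longrightarrow> cf_tk cs i < cf_tk cs k \<longleftrightarrow> i < k"
  using tk_less[of i k] tk_le[of k i] by (metis linorder_not_less)

lemma tk_length: "cf_tk cs (length cs) = int (cf_t cs) + 1"
proof -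
  have "2 \<le> sum_list cs" using member_le_sum_list[of "last cs" cs] last2 ne by simp
  moreover have "(\<Sum>i<length cs. int (cs ! i)) = int (sum_list cs)"
    by (simp add: sum_list_sum_nth atLeast0LessThan)
  ultimately show ?thesis by (simp add: cf_tk_def cf_t_def of_nat_diff)
qed

lemma tk_last: "cf_tk cs (length cs - 1) < int (cf_t cs)"
  using tk_Suc[of "length cs - 1"] tk_length last2 ne by (simp add: last_conv_nth)

lemma brk_less: "cf_brk cs j \<Longrightarrow> j < cf_t cs"
  using tk_le[of _ "length cs - 1"] tk_last by (force simp: cf_brk_def)

text \<open>The number of breaks below \<open>j\<close> is the zone of \<open>j\<close>. Within a
  zone the first component of \<open>fg\<close> is constant and the second grows by it at each step;
  at a break their sum is the next \<open>y\<close>. Thus the components interpolate linearly, as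
  kappa does.\<close>

lemma fg_gy:
  assumes "j \<le> cf_t cs"
  shows "N j < length cs \<and> cf_tk cs (N j) < int j \<and> int j \<le> cf_tk cs (Suc (N j)) \<and>
    fst (fg (cf_brk cs) s j) = gy cs s (Suc (N j)) \<and>
    snd (fg (cf_brk cs) s j) = gy cs s (N j) + (int j - 1 - cf_tk cs (N j)) * gy cs s (Suc (N j))"
  using assms
proof (induction j)
  case 0
  then show ?case using ne nth_pos[of 0] by (simp add: tk_0 tk_Suc)
next
  case (Suc j)
  then have IH: "N j < length cs" "cf_tk cs (N j) < int j" "int j \<le> cf_tk cs (Suc (N j))"
    "fst (fg (cf_brk cs) s j) = gy cs s (Suc (N j))"
    "snd (fg (cf_brk cs) s j) = gy cs s (N j) + (int j - 1 - cf_tk cs (N j)) * gy cs s (Suc (N j))"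
    by auto
  have iff: "cf_brk cs j \<longleftrightarrow> int j = cf_tk cs (Suc (N j))"
  proof
    assume "cf_brk cs j"
    then obtain k where k: "k \<in> {1..length cs - 1}" "int j = cf_tk cs k" unfolding cf_brk_def by blast
    then have "N j < k" using IH(1,2) tk_less_iff[of "N j" k] by auto
    moreover have "k \<le> length cs" using k by auto
    then have "k \<le> Suc (N j)" using IH(1,3) k(2) tk_less_iff[of "Suc (N j)" k] by auto
    ultimately have "k = Suc (N j)" by simp
    then show "int j = cf_tk cs (Suc (N j))" using k by metis
  next
    assume e: "int j = cf_tk cs (Suc (N j))"
    have "Suc (N j) \<noteq> length cs"
    proof
      assume "Suc (N j) = length cs"
      then have "int j = int (cf_t cs) + 1" using e tk_length by metis
      then show False using Suc.prems by simp
    qed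
    then have "Suc (N j) \<in> {1..length cs - 1}" using IH(1) by auto
    then show "cf_brk cs j" unfolding cf_brk_def[of cs j] using e by blast
  qed
  show ?case
  proof (cases "cf_brk cs j")
    case True
    then have "{k. k < Suc j \<and> cf_brk cs k} = insert j {k. k < j \<and> cf_brk cs k}" by (auto simp: less_Suc_eq)
    then have N: "N (Suc j) = Suc (N j)" by simp
    have e: "int j = cf_tk cs (Suc (N j))" using True iff by blast
    have lt: "Suc (N j) < length cs"
    proof (rule ccontr)
      assume "\<not> Suc (N j) < length cs"
      then have "Suc (N j) = length cs" using IH(1) by simp
      then have "int j = int (cf_t cs) + 1" using e tk_length by metis
      then show False using Suc.prems by simp
    qed
    have e': "int (cs ! N j) = int j - cf_tk cs (N j)" using e tk_Suc[of "N j"] by simp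
    have "fst (fg (cf_brk cs) s j) + snd (fg (cf_brk cs) s j) = gy cs s (Suc (Suc (N j)))"
      unfolding IH(4,5) gy.simps(3) e' by (simp add: algebra_simps)
    then show ?thesis unfolding N fg.simps(2) using True IH(4) lt e nth_pos[OF lt] tk_Suc[of "Suc (N j)"] by simp
  next
    case False
    then have "{k. k < Suc j \<and> cf_brk cs k} = {k. k < j \<and> cf_brk cs k}" by (auto simp: less_Suc_eq)
    then have N: "N (Suc j) = N j" by simp
    show ?thesis unfolding N fg.simps(2) using False IH iff by (simp add: algebra_simps)
  qed
qed

lemma zone_eq: "j \<le> cf_t cs \<Longrightarrow> zone cs j = N j"
  unfolding zone_def
proof (rule the_equality)
  assume j: "j \<le> cf_t cs"
  note f = fg_gy[OF j, of "(1, 0)"]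
  show "N j < length cs \<and> cf_tk cs (N j) < int j \<and> int j \<le> cf_tk cs (N j + 1)" using f by simp
  fix k assume k: "k < length cs \<and> cf_tk cs k < int j \<and> int j \<le> cf_tk cs (k + 1)"
  have f': "N j < length cs" "cf_tk cs (N j) < int j" "int j \<le> cf_tk cs (Suc (N j))" using f by blast+
  have "cf_tk cs k < cf_tk cs (Suc (N j))" using f'(3) k by (metis order_less_le_trans)
  moreover have "cf_tk cs (N j) < cf_tk cs (Suc k)" using f'(2) k by (metis order_less_le_trans Suc_eq_plus1)
  ultimately have "k < Suc (N j)" "N j < Suc k"
    using f'(1) k tk_less_iff[of k "Suc (N j)"] tk_less_iff[of "N j" "Suc k"] by (metis Suc_leI less_imp_le)+
  then show "k = N j" by simp
qed

lemma kappa_eq: "j \<le> cf_t cs \<Longrightarrow> kappa cs j = fst (fg (cf_brk cs) (1, 0) j) + snd (fg (cf_brk cs) (1, 0) j)"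
  using fg_gy[of j "(1, 0)"] by (simp add: kappa_def zone_eq cf_y_gy Let_def algebra_simps)

text \<open>The combination evaluates the pair 2 and 1, that is, the one-height model from which the
  climb starts. The last partial quotient is used up exactly, since \<open>cf_tk\<close> at the
  length of the list is one more than \<open>cf_t\<close>.\<close>

lemma fg_end: "2 * fst (fg (cf_brk cs) s (cf_t cs)) + snd (fg (cf_brk cs) s (cf_t cs)) = gy cs s (Suc (length cs))"
proof -
  let ?n = "N (cf_t cs)"
  note f = fg_gy[OF order_refl, of s]
  have n: "length cs = Suc (length cs - 1)" using ne by simp
  have "cf_tk cs (length cs - 1) < cf_tk cs (Suc ?n)" using f tk_last by linarith
  then have "length cs - 1 < Suc ?n" using f tk_less_iff[of "length cs - 1" "Suc ?n"] by auto
  moreover have "?n < length cs" using f by blast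
  ultimately have e: "length cs = Suc ?n" by linarith
  have "int (cf_t cs) + 1 = cf_tk cs ?n + int (cs ! ?n)" using tk_length tk_Suc[of ?n] unfolding e by simp
  then have c: "int (cs ! ?n) = int (cf_t cs) + 1 - cf_tk cs ?n" by simp
  show ?thesis unfolding e using f by (simp add: c algebra_simps)
qed

lemma brk_0_tk: "cf_brk cs 0 \<Longrightarrow> 2 \<le> length cs \<and> cf_tk cs 1 = 0"
proof -
  assume "cf_brk cs 0"
  then obtain k where k: "k \<in> {1..length cs - 1}" "0 = cf_tk cs k" unfolding cf_brk_def by auto
  have "cf_tk cs 0 < cf_tk cs 1" "cf_tk cs 1 \<le> cf_tk cs k" using k tk_less[of 0 1] tk_le[of 1 k] by auto
  then show ?thesis using k by (auto simp: tk_0)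
qed

lemma not_brk_tk:
  assumes s: "s < cf_t cs" and nb: "\<not> (\<exists>i. 0 < i \<and> i \<le> s \<and> cf_brk cs i)"
    and k: "1 \<le> k" "k \<le> length cs" and tk: "0 \<le> cf_tk cs k" "cf_brk cs 0 \<or> k \<noteq> 1 \<Longrightarrow> 0 < cf_tk cs k"
  shows "int s < cf_tk cs k"
proof (cases "k = length cs")
  case True
  then show ?thesis using tk_length s by simp
next
  case False
  define i where "i = nat (cf_tk cs k)"
  have i: "int i = cf_tk cs k" using tk by (simp add: i_def)
  then have b: "cf_brk cs i" unfolding cf_brk_def using False k by (intro bexI[of _ k]) auto
  then have "0 < i" using tk i by (cases "i = 0") auto
  then show ?thesis using nb b i by (metis linorder_not_less of_nat_less_iff)
qed

lemma fg_no_break: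
  "\<not> (\<exists>i. 0 < i \<and> i < s \<and> cf_brk cs i) \<Longrightarrow> fg (cf_brk cs) (1, 0) s = (1, int s)"
proof (induction s)
  case (Suc s)
  then have "fg (cf_brk cs) (1, 0) s = (1, int s)" by auto
  moreover have "cf_brk cs s \<Longrightarrow> s = 0" using Suc.prems by auto
  ultimately show ?case by (auto simp: fg.simps(2))
qed simp

section \<open>The tridiagonal matrices and the inverse of C-hat\<close>

lemma Cmat_eq: "Cmat cs i j = (if Suc j = i then - 1 else 0) + (if j = i then (if cf_brk cs i then 1 else 2) else 0)
    + (if j = Suc i then (if cf_brk cs i then 1 else - 1) else 0)"
  unfolding Cmat_def cf_brk_def Let_def by simp

lemma Chat_mult_eq:
  assumes i: "i \<le> cf_t cs" and x: "\<And>j. cf_t cs \<le> j \<Longrightarrow> x j = 0"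
  shows "Chat_mult cs x i = (if cf_brk cs i then x i + x (Suc i) else 2 * x i - x (Suc i)) - (if i = 0 then 0 else x (i - 1))"
proof -
  let ?T = "{..<Suc (Suc (cf_t cs))}"
  have 1: "(\<Sum>j\<in>?T. (if Suc j = i then - 1 else 0) * x j) = - (if i = 0 then 0 else x (i - 1))"
  proof (cases i)
    case (Suc i')
    have "(\<Sum>j\<in>?T. (if Suc j = i then - 1 else 0) * x j) = (\<Sum>j\<in>?T. if j = i' then - x j else 0)"
      by (rule sum.cong) (auto simp: Suc)
    also have "\<dots> = - x i'" using i Suc by simp
    finally show ?thesis by (simp add: Suc)
  qed simp
  have 2: "(\<Sum>j\<in>?T. (if j = k then d else 0) * x j) = d * x k" if "k \<in> ?T" for k d
  proof -
    have "(\<Sum>j\<in>?T. (if j = k then d else 0) * x j) = (\<Sum>j\<in>?T. if j = k then d * x j else 0)"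
      by (rule sum.cong) auto
    then show ?thesis using that by simp
  qed
  have T: "i \<in> ?T" "Suc i \<in> ?T" using i by auto
  have "Chat_mult cs x i = (\<Sum>j\<in>?T. Cmat cs i j * x j)"
    unfolding Chat_mult_def using x by (intro sum.mono_neutral_left) auto
  also have "\<dots> = (\<Sum>j\<in>?T. (if Suc j = i then - 1 else 0) * x j) + (\<Sum>j\<in>?T. (if j = i then (if cf_brk cs i then 1 else 2) else 0) * x j)
      + (\<Sum>j\<in>?T. (if j = Suc i then (if cf_brk cs i then 1 else - 1) else 0) * x j)"
    unfolding Cmat_eq distrib_right sum.distrib ..
  also have "\<dots> = - (if i = 0 then 0 else x (i - 1)) + (if cf_brk cs i then 1 else 2) * x i + (if cf_brk cs i then 1 else - 1) * x (Suc i)"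
    unfolding 1 2[OF T(1)] 2[OF T(2)] ..
  finally show ?thesis by simp
qed

text \<open>Starting from the zero entries at \<open>t\<close> and beyond, row \<open>i\<close>
  determines the entry \<open>i - 1\<close>.\<close>

lemma back_substitution:
  "\<exists>x. (\<forall>j. cf_t cs \<le> j \<longrightarrow> x j = (0::int)) \<and> (\<forall>i\<in>{1..cf_t cs}. Chat_mult cs x i = w i)"
proof -
  let ?row = "\<lambda>x i. (if cf_brk cs i then x i + x (Suc i) else 2 * x i - x (Suc i)) - x (i - 1) :: int"
  have "\<exists>x. (\<forall>j. cf_t cs \<le> j \<longrightarrow> x j = (0::int)) \<and> (\<forall>i. s < i \<and> i \<le> cf_t cs \<longrightarrow> ?row x i = w i)" if "s \<le> cf_t cs" for s
    using that
  proof (induction s rule: inc_induct)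
    case base
    then show ?case by (intro exI[of _ "\<lambda>_. 0"]) auto
  next
    case (step n)
    then obtain x where x: "\<forall>j. cf_t cs \<le> j \<longrightarrow> x j = 0" "\<forall>i. Suc n < i \<and> i \<le> cf_t cs \<longrightarrow> ?row x i = w i" by blast
    define y where "y = x(n := ?row x (Suc n) + x n - w (Suc n))"
    have y: "y j = x j" if "j \<noteq> n" for j using that by (simp add: y_def)
    have "\<forall>j. cf_t cs \<le> j \<longrightarrow> y j = 0" using x(1) y step.hyps by (metis linorder_not_less)
    moreover have "?row y i = w i" if i: "n < i" "i \<le> cf_t cs" for i
    proof (cases "i = Suc n")
      case True
      have "y n = ?row x (Suc n) + x n - w (Suc n)" by (simp add: y_def)
      then show ?thesis using y[of "Suc n"] y[of "Suc (Suc n)"] True by simp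
    next
      case False
      then have "i - 1 \<noteq> n" "i \<noteq> n" "Suc i \<noteq> n" using i by auto
      moreover have "Suc n < i" using i False by simp
      ultimately have "?row x i = w i" "y (i - 1) = x (i - 1)" "y i = x i" "y (Suc i) = x (Suc i)"
        using x(2) y i by blast+
      then show ?thesis by metis
    qed
    ultimately show ?case by blast
  qed
  from this[of 0] obtain x where x: "\<forall>j. cf_t cs \<le> j \<longrightarrow> x j = 0" "\<forall>i. 0 < i \<and> i \<le> cf_t cs \<longrightarrow> ?row x i = w i" by blast
  have "Chat_mult cs x i = w i" if "i \<in> {1..cf_t cs}" for i
    using Chat_mult_eq[of i x] x that by auto
  then show ?thesis using x(1) by blast
qed

lemma Chat_mult_inj:
  assumes x: "\<And>j. cf_t cs \<le> j \<Longrightarrow> x j = 0" and y: "\<And>j. cf_t cs \<le> j \<Longrightarrow> y j = 0"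
    and e: "\<And>i. i \<in> {1..cf_t cs} \<Longrightarrow> Chat_mult cs x i = Chat_mult cs y i"
  shows "x j = y j"
proof (cases "j \<le> cf_t cs")
  case True
  then have "x j = y j \<and> x (Suc j) = y (Suc j)"
  proof (induction j rule: inc_induct)
    case base
    then show ?case using x y by simp
  next
    case (step n)
    have xy: "x (Suc n) = y (Suc n)" "x (Suc (Suc n)) = y (Suc (Suc n))" using step.IH by auto
    have n: "Suc n \<le> cf_t cs" "Suc n \<in> {1..cf_t cs}" using step.hyps by auto
    show ?case using e[OF n(2)] by (simp add: Chat_mult_eq n x y xy split: if_splits)
  qed
  then show ?thesis ..
next
  case False
  then show ?thesis using x y by simp
qed

text \<open>Back substitution provides the columns of a right inverse. Applying C-hat to the product
  in the other order shows by injectivity that it is a left inverse too, and injectivity also gives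
  uniqueness, so the definite description denotes it.\<close>

lemma Chat_inv_props:
  shows "\<not> (i < cf_t cs \<and> j \<in> {1..cf_t cs}) \<Longrightarrow> Chat_inv cs i j = 0"
    and "i \<in> {1..cf_t cs} \<Longrightarrow> k \<in> {1..cf_t cs} \<Longrightarrow> (\<Sum>j<cf_t cs. Cmat cs i j * Chat_inv cs j k) = of_bool (i = k)"
proof -
  let ?t = "cf_t cs"
  let ?P = "\<lambda>D. (\<forall>i j. \<not> (i < ?t \<and> j \<in> {1..?t}) \<longrightarrow> D i j = 0)
     \<and> (\<forall>i\<in>{1..?t}. \<forall>k\<in>{1..?t}. (\<Sum>j<?t. Cmat cs i j * D j k) = of_bool (i = k))
     \<and> (\<forall>i<?t. \<forall>k<?t. (\<Sum>j = 1..?t. D i j * Cmat cs j k) = of_bool (i = k))"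
  have "\<forall>k. \<exists>x. (\<forall>j. ?t \<le> j \<longrightarrow> x j = 0) \<and> (\<forall>i\<in>{1..?t}. Chat_mult cs x i = of_bool (i = k))"
    by (intro allI back_substitution)
  from choice[OF this] obtain X where X': "\<forall>k. (\<forall>j. ?t \<le> j \<longrightarrow> X k j = 0) \<and> (\<forall>i\<in>{1..?t}. Chat_mult cs (X k) i = of_bool (i = k))"
    by (rule exE)
  have X: "?t \<le> j \<Longrightarrow> X k j = 0" "i \<in> {1..?t} \<Longrightarrow> Chat_mult cs (X k) i = of_bool (i = k)" for k j i
    using X' by blast+
  define D where "D i k = (if k \<in> {1..?t} then X k i else 0)" for i k
  have D0: "\<forall>i j. \<not> (i < ?t \<and> j \<in> {1..?t}) \<longrightarrow> D i j = 0" using X(1) by (auto simp: D_def)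
  have DR: "\<forall>i\<in>{1..?t}. \<forall>k\<in>{1..?t}. (\<Sum>j<?t. Cmat cs i j * D j k) = of_bool (i = k)"
    using X(2) by (simp add: D_def Chat_mult_def)
  have DL: "(\<Sum>j = 1..?t. D i j * Cmat cs j k) = of_bool (i = k)" if "k < ?t" for i k
  proof (rule Chat_mult_inj[where x = "\<lambda>i. \<Sum>j = 1..?t. D i j * Cmat cs j k" and y = "\<lambda>i. of_bool (i = k)" and j = i])
    fix l assume l: "l \<in> {1..?t}"
    have "Chat_mult cs (\<lambda>i. \<Sum>j = 1..?t. D i j * Cmat cs j k) l = (\<Sum>m<?t. \<Sum>j = 1..?t. Cmat cs l m * D m j * Cmat cs j k)"
      unfolding Chat_mult_def sum_distrib_left mult.assoc ..
    also have "\<dots> = (\<Sum>j = 1..?t. (\<Sum>m<?t. Cmat cs l m * D m j) * Cmat cs j k)"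
      unfolding sum_distrib_right by (rule sum.swap)
    also have "\<dots> = (\<Sum>j = 1..?t. if l = j then Cmat cs j k else 0)"
      using DR l by (intro sum.cong) auto
    also have "\<dots> = Cmat cs l k" using l by simp
    also have "\<dots> = (\<Sum>j<?t. if j = k then Cmat cs l j else 0)" using that by simp
    also have "\<dots> = Chat_mult cs (\<lambda>i. of_bool (i = k)) l"
      unfolding Chat_mult_def by (rule sum.cong) auto
    finally show "Chat_mult cs (\<lambda>i. \<Sum>j = 1..?t. D i j * Cmat cs j k) l = Chat_mult cs (\<lambda>i. of_bool (i = k)) l" .
  qed (use D0 that in auto)
  have ex: "?P D" using D0 DR DL by blast
  have un: "E = D" if E: "?P E" for E
  proof (intro ext)
    fix i k
    have E0: "\<And>i j. \<not> (i < ?t \<and> j \<in> {1..?t}) \<Longrightarrow> E i j = 0"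
      and ER: "\<And>i k. i \<in> {1..?t} \<Longrightarrow> k \<in> {1..?t} \<Longrightarrow> (\<Sum>j<?t. Cmat cs i j * E j k) = of_bool (i = k)"
      using E by blast+
    show "E i k = D i k"
    proof (cases "k \<in> {1..?t}")
      case True
      show ?thesis
        by (rule Chat_mult_inj[where x = "\<lambda>i. E i k" and y = "\<lambda>i. D i k" and j = i])
          (use E0 D0 ER[OF _ True] DR True in \<open>auto simp: Chat_mult_def\<close>)
    next
      case False
      then show ?thesis using E0 D0 by metis
    qed
  qed
  have "Chat_inv cs = D" unfolding Chat_inv_def Let_def by (rule the_equality) (use ex un in blast)+
  then show "\<not> (i < ?t \<and> j \<in> {1..?t}) \<Longrightarrow> Chat_inv cs i j = 0"
    and "i \<in> {1..?t} \<Longrightarrow> k \<in> {1..?t} \<Longrightarrow> (\<Sum>j<?t. Cmat cs i j * Chat_inv cs j k) = of_bool (i = k)"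
    using D0 DR by metis+
qed

lemma Chat_mult_inv:
  assumes i: "i \<in> {1..cf_t cs}"
  shows "Chat_mult cs (\<lambda>j. \<Sum>k = 1..cf_t cs. Chat_inv cs j k * w k) i = w i"
proof -
  let ?t = "cf_t cs"
  have "Chat_mult cs (\<lambda>j. \<Sum>k = 1..?t. Chat_inv cs j k * w k) i = (\<Sum>j<?t. \<Sum>k = 1..?t. Cmat cs i j * Chat_inv cs j k * w k)"
    unfolding Chat_mult_def sum_distrib_left mult.assoc ..
  also have "\<dots> = (\<Sum>k = 1..?t. (\<Sum>j<?t. Cmat cs i j * Chat_inv cs j k) * w k)"
    unfolding sum_distrib_right by (rule sum.swap)
  also have "\<dots> = (\<Sum>k = 1..?t. if i = k then w k else 0)"
    using Chat_inv_props(2)[OF i] by (intro sum.cong) auto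
  also have "\<dots> = w i" using i by simp
  finally show ?thesis .
qed

text \<open>The two entries that couple neighbouring indices are -1 and -1 away from a break, while
  at a break they are 1 and -1 and cancel.\<close>

lemma sum_Cmat:
  assumes x: "\<And>j. cf_t cs \<le> j \<Longrightarrow> x j = 0"
  shows "(\<Sum>i<cf_t cs. \<Sum>j<cf_t cs. x i * Cmat cs i j * x j)
    = (\<Sum>i<cf_t cs. (if cf_brk cs i then 1 else 2) * (x i)\<^sup>2 + (if cf_brk cs i then 0 else - 2) * x i * x (Suc i))"
proof -
  let ?t = "cf_t cs"
  let ?b = "\<lambda>i. x i * (if i = 0 then 0 else x (i - 1))"
  have "(\<Sum>i<Suc ?t. ?b i) = (\<Sum>i<?t. x (Suc i) * x i)"
    unfolding sum.lessThan_Suc_shift by simp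
  then have shift: "(\<Sum>i<?t. ?b i) = (\<Sum>i<?t. x i * x (Suc i))" using x[of ?t] by (simp add: mult.commute)
  have "(\<Sum>i<?t. \<Sum>j<?t. x i * Cmat cs i j * x j) = (\<Sum>i<?t. x i * Chat_mult cs x i)"
    unfolding Chat_mult_def sum_distrib_left mult.assoc ..
  also have "\<dots> = (\<Sum>i<?t. x i * (if cf_brk cs i then x i + x (Suc i) else 2 * x i - x (Suc i)) - ?b i)"
    by (rule sum.cong) (auto simp: Chat_mult_eq[OF _ x] algebra_simps)
  also have "\<dots> = (\<Sum>i<?t. x i * (if cf_brk cs i then x i + x (Suc i) else 2 * x i - x (Suc i)) - x i * x (Suc i))"
    unfolding sum_subtractf shift ..
  also have "\<dots> = (\<Sum>i<?t. (if cf_brk cs i then 1 else 2) * (x i)\<^sup>2 + (if cf_brk cs i then 0 else - 2) * x i * x (Suc i))"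
    by (rule sum.cong) (auto simp: algebra_simps power2_eq_square)
  finally show ?thesis .
qed

end

section \<open>From the ladder to the data of the continued fraction\<close>

locale cf_ladder = contfrac cs for cs :: "nat list" +
  fixes sL sR :: nat and TL TR :: bool
  assumes sL: "sL < cf_t cs" and sR: "sR < cf_t cs"
begin

sublocale ladder "cf_t cs" "cf_brk cs" sL sR TL TR
  by unfold_locales (use sL sR brk_less in auto)

lemma vvec_eq:
  assumes i: "1 \<le> i" "i \<le> cf_t cs"
  shows "vvec cs s i = v s i"
proof -
  let ?K = "{k. k \<le> length cs \<and> int s \<le> cf_tk cs k \<and> cf_tk cs k < int (cf_t cs)}"
  have "(\<Sum>k\<in>?K. evec (cf_tk cs k) i) = of_bool (cf_brk cs i \<and> s \<le> i)"
  proof (cases "cf_brk cs i")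
    case True
    then obtain l where l: "l \<in> {1..length cs - 1}" "int i = cf_tk cs l" unfolding cf_brk_def by blast
    have "(\<Sum>k\<in>?K. evec (cf_tk cs k) i) = (\<Sum>k\<in>?K. if k = l then 1 else 0)"
    proof (rule sum.cong[OF refl])
      fix k assume k: "k \<in> ?K"
      have ll: "l \<le> length cs" using l by auto
      have "int i = cf_tk cs k \<longleftrightarrow> k = l"
        using l(2) k tk_less_iff[of k l] tk_less_iff[of l k] ll by (metis (no_types, lifting) linorder_neqE_nat mem_Collect_eq order_less_irrefl)
      then show "evec (cf_tk cs k) i = (if k = l then 1 else 0)" using i by (simp add: evec_def)
    qed
    also have "\<dots> = of_bool (l \<in> ?K)" by simp
    also have "l \<in> ?K \<longleftrightarrow> s \<le> i" using l brk_less[OF True] by auto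
    finally show ?thesis using True by simp
  next
    case False
    have "evec (cf_tk cs k) i = 0" if k: "k \<in> ?K" for k
    proof (rule ccontr)
      assume "evec (cf_tk cs k) i \<noteq> 0"
      then have e: "int i = cf_tk cs k" by (simp add: evec_def split: if_splits)
      \<comment> \<open>The first and the last of the numbers \<open>cf_tk\<close> are -1 and
        \<open>t + 1\<close>, so neither is an index of a vector; the others are the breaks.\<close>
      have "k \<noteq> 0"
      proof
        assume "k = 0"
        then have "int i = - 1" using e tk_0 by metis
        then show False by simp
      qed
      moreover have "k \<noteq> length cs"
      proof
        assume "k = length cs"
        then have "int i = int (cf_t cs) + 1" using e tk_length by metis
        then show False using i by simp
      qed
      ultimately have "k \<in> {1..length cs - 1}" using k by auto
      then have "cf_brk cs i" unfolding cf_brk_def using e by blast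
      then show False using False by simp
    qed
    then show ?thesis using False by simp
  qed
  then show ?thesis using i by (auto simp: vvec_def v_def evec_def)
qed

lemma uvec_eq: "1 \<le> i \<Longrightarrow> i \<le> cf_t cs \<Longrightarrow> uvec cs T s i = u T s i"
  by (auto simp: uvec_def u_def vvec_eq evec_def)

lemma Delta_eq: "1 \<le> i \<Longrightarrow> i \<le> cf_t cs \<Longrightarrow> Delta cs T s i = Dl T s i"
  by (auto simp: Delta_def Dl_def vvec_eq evec_def)

lemma gamma_eq: "gamma cs (Delta cs TL sL) (Delta cs TR sR) = gpost 0"
proof -
  have "gamma_step cs (Delta cs TL sL) (Delta cs TR sR) j x = gstep j x" if j: "j \<in> set [1..<cf_t cs + 1]" for j x
  proof -
    obtain \<alpha> \<beta> \<gamma> where x: "x = (\<alpha>, \<beta>, \<gamma>)" by (cases x)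
    have j': "1 \<le> j" "j \<le> cf_t cs" using j by auto
    have b: "(\<exists>k\<in>{1..length cs - 1}. int j = cf_tk cs k + 1) \<longleftrightarrow> cf_brk cs (j - 1)"
      unfolding cf_brk_def by (rule bex_cong[OF refl]) (use j' in \<open>auto simp: of_nat_diff\<close>)
    show ?thesis unfolding x gamma_step.simps gstep.simps b Delta_eq[OF j'] ..
  qed
  then have "foldr (gamma_step cs (Delta cs TL sL) (Delta cs TR sR)) [1..<cf_t cs + 1] (0, 0, 0) = foldr gstep [1..<cf_t cs + 1] (0, 0, 0)"
    by (intro foldr_cong) auto
  then show ?thesis by (simp only: gamma_def gpost_def gs_def One_nat_def)
qed

lemma row_Chat_mult:
  assumes "1 \<le> i" "i \<le> cf_t cs" "\<And>j. cf_t cs \<le> j \<Longrightarrow> x j = 0"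
  shows "Chat_mult cs x i = row x i"
  using Chat_mult_eq[of i x] assms by (simp add: row_def)

lemma Qvec_al:
  assumes j: "j < cf_t cs"
  shows "even ((\<Sum>k = 1..cf_t cs. Chat_inv cs j k * (uvec cs TL sL k + uvec cs TR sR k)) - al j)"
proof -
  let ?x = "\<lambda>j. \<Sum>k = 1..cf_t cs. Chat_inv cs j k * (uvec cs TL sL k + uvec cs TR sR k)"
  have x0: "?x j = 0" if "cf_t cs \<le> j" for j
    by (rule sum.neutral) (use that Chat_inv_props(1) in auto)
  have "even (row ?x i - (u TL sL i + u TR sR i))" if i: "i \<in> {1..cf_t cs}" for i
  proof -
    have i': "1 \<le> i" "i \<le> cf_t cs" using i by auto
    have "Chat_mult cs ?x i = row ?x i" by (rule row_Chat_mult[OF i']) (rule x0)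
    moreover have "Chat_mult cs ?x i = uvec cs TL sL i + uvec cs TR sR i" by (rule Chat_mult_inv[OF i])
    ultimately have "row ?x i = u TL sL i + u TR sR i" unfolding uvec_eq[OF i'] by simp
    then show ?thesis by simp
  qed
  then show ?thesis using row_parity[of ?x, OF x0] j by blast
qed

lemma exponent_eq:
  assumes m: "\<And>j. j \<notin> {1..<cf_t cs} \<Longrightarrow> m j = 0"
  shows "exponent4 cs L (uvec cs TL sL) (uvec cs TR sR) (gpost 0) m = Epost 0 (m(0 := L))"
proof -
  let ?\<mu> = "m(0 := L)"
  have mh: "mhat L m j = int (?\<mu> j)" for j by (simp add: mhat_def)
  have 0: "?\<mu> j = 0" if "cf_t cs \<le> j" for j using that m[of j] t0 by simp
  have 1: "(\<Sum>i<cf_t cs. \<Sum>j<cf_t cs. int (?\<mu> i) * Cmat cs i j * int (?\<mu> j)) = Qf 0 ?\<mu>"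
    unfolding Qf_def atLeast0LessThan by (rule sum_Cmat) (use 0 in simp)
  have 2: "(\<Sum>j = 1..<cf_t cs. (flat cs (uvec cs TL sL) j + sharp cs (uvec cs TR sR) j) * int (m j)) = lin 0 (Suc 0) ?\<mu>"
    unfolding lin_def One_nat_def
  proof (rule sum.cong[OF refl])
    fix j assume "j \<in> {Suc 0..<cf_t cs}"
    then have j: "1 \<le> j" "j \<le> cf_t cs" by auto
    have "flat cs (uvec cs TL sL) j + sharp cs (uvec cs TR sR) j = wt 0 j"
      using zone_eq[OF j(2)] by (simp add: flat_def sharp_def wt_def uvec_eq[OF j])
    then show "(flat cs (uvec cs TL sL) j + sharp cs (uvec cs TR sR) j) * int (m j) = wt 0 j * int (?\<mu> j)"
      using j by simp
  qed
  show ?thesis unfolding exponent4_def mh 1 2 Epost_def by simp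
qed

lemma fermionic_sum:
  fixes z :: "'a::field"
  assumes z: "generic z" and L: "even (int L - al 0)"
  defines "M \<equiv> msum_set cs (Qvec cs (\<lambda>j. uvec cs TL sL j + uvec cs TR sR j))"
    and "ft \<equiv> fermi_term z cs L (uvec cs TL sL) (uvec cs TR sR) (gamma cs (Delta cs TL sL) (Delta cs TR sR))"
  shows "finite {m \<in> M. ft m \<noteq> 0} \<and> (\<Sum>m\<le>L + 1. Fpost 0 z L m) = (\<Sum>m | m \<in> M \<and> ft m \<noteq> 0. ft m)"
proof -
  let ?M = "{m. (\<forall>j. j \<notin> {1..<cf_t cs} \<longrightarrow> m j = 0) \<and> (\<forall>j\<in>{1..<cf_t cs}. even (int (m j) - al j))}"
  let ?tm = "\<lambda>m. z powi Epost 0 (m(0 := L)) * gprod z 0 (m(0 := L))"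
  have cong: "int n mod 2 = Qvec cs (\<lambda>j. uvec cs TL sL j + uvec cs TR sR j) j mod 2 \<longleftrightarrow> even (int n - al j)"
    if "j \<in> {1..<cf_t cs}" for n j
  proof -
    let ?x = "\<Sum>k = 1..cf_t cs. Chat_inv cs j k * (uvec cs TL sL k + uvec cs TR sR k)"
    have "even (?x - al j)" using Qvec_al[of j] that by simp
    then have "al j mod 2 = ?x mod 2" by (metis mod_eq_dvd_iff)
    then show ?thesis unfolding Qvec_def mod_mod_trivial mod_eq_dvd_iff[symmetric] by simp
  qed
  have M: "M = ?M" unfolding M_def msum_set_def using cong by blast
  have ft: "ft m = ?tm m" if m: "m \<in> ?M" for m
  proof -
    have m0: "j \<notin> {1..<cf_t cs} \<Longrightarrow> m j = 0" for j using m by blast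
    define \<mu> where "\<mu> = m(0 := L)"
    have mh: "mhat L m = (\<lambda>j. int (\<mu> j))" by (rule ext) (simp add: mhat_def \<mu>_def)
    have \<mu>0: "\<mu> 0 = L" and \<mu>m: "j \<noteq> 0 \<Longrightarrow> \<mu> j = m j" for j by (simp_all add: \<mu>_def)
    have s: "\<mu> j = 0" if "cf_t cs \<le> j" for j using that m0[of j] \<mu>m[of j] t0 by simp
    have par: "\<forall>j<cf_t cs. even (int (\<mu> j) - al j)"
    proof (intro allI impI)
      fix j assume "j < cf_t cs"
      then show "even (int (\<mu> j) - al j)"
        using m L \<mu>0 \<mu>m[of j] by (cases "j = 0") (auto simp del: even_diff)
    qed
    have arg: "int (m j) - (Chat_mult cs (mhat L m) j - uvec cs TL sL j - uvec cs TR sR j) div 2 = arg \<mu> j div 2"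
      if j: "j \<in> {1..<cf_t cs}" for j
    proof -
      have j': "1 \<le> j" "j \<le> cf_t cs" using j by auto
      let ?X = "row (\<lambda>j. int (\<mu> j)) j - (u TL sL j + u TR sR j)"
      have "\<forall>i\<in>{1..cf_t cs}. even (row (\<lambda>j. int (\<mu> j)) i - (u TL sL i + u TR sR i))"
        by (rule iffD2[OF row_parity par]) (simp add: s)
      then have "even ?X" using j' by simp
      then obtain k where k: "?X = 2 * k" by (rule evenE)
      have "Chat_mult cs (mhat L m) j = row (\<lambda>j. int (\<mu> j)) j"
        unfolding mh by (rule row_Chat_mult[OF j']) (simp add: s)
      then have "Chat_mult cs (mhat L m) j - uvec cs TL sL j - uvec cs TR sR j = 2 * k"
        using k uvec_eq[OF j'] by simp
      moreover have "arg \<mu> j = 2 * (int (m j) - k)"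
        unfolding arg_row k using \<mu>m[of j] j' by simp
      ultimately show ?thesis by simp
    qed
    have "(\<Prod>j = 1..<cf_t cs. gauss' (z ^ 4) (int (m j) - (Chat_mult cs (mhat L m) j - uvec cs TL sL j - uvec cs TR sR j) div 2) (int (m j)))
        = gprod z 0 \<mu>"
      unfolding gprod_def One_nat_def by (rule prod.cong[OF refl]) (use arg \<mu>m in simp)
    moreover have "exponent4 cs L (uvec cs TL sL) (uvec cs TR sR) (gpost 0) m = Epost 0 \<mu>"
      unfolding \<mu>_def by (rule exponent_eq) (rule m0)
    ultimately show ?thesis unfolding ft_def fermi_term_def gamma_eq \<mu>_def[symmetric] by metis
  qed
  have S: "{m \<in> M. ft m \<noteq> 0} = {m \<in> ?M. ?tm m \<noteq> 0}" unfolding M using ft by (intro Collect_cong) auto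
  have "finite {m \<in> ?M. ?tm m \<noteq> 0}" by (rule sum_Fpost(1)[OF z L])
  moreover have "(\<Sum>m\<le>L + 1. Fpost 0 z L m) = (\<Sum>m \<in> {m \<in> ?M. ?tm m \<noteq> 0}. ?tm m)" by (rule sum_Fpost(2)[OF z L])
  moreover have "\<dots> = (\<Sum>m \<in> {m \<in> ?M. ?tm m \<noteq> 0}. ft m)" by (rule sum.cong[OF refl]) (use ft in simp)
  ultimately show ?thesis unfolding S[symmetric] by simp
qed

lemma fg_pos: "1 \<le> fst (fg brk (1, 0) j) \<and> 0 \<le> snd (fg brk (1, 0) j) \<and> (0 < j \<longrightarrow> 1 \<le> snd (fg brk (1, 0) j))"
  by (induction j) (auto simp: fg.simps(2))

text \<open>If no break lies between 1 and \<open>sR\<close>, kappa grows by 1 at each index, so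
  \<open>b\<close> is at distance \<open>sR + 1\<close> from its boundary. As \<open>sR\<close> is
  less than tau, this is within the range where the rule prescribes the extra height. Twice tau is
  less than p' outside the special cases, so the lower and the upper range do not interfere.\<close>

lemma c_choice:
  assumes p: "1 \<le> p" "p < p'" "coprime p p'" and pp: "p' = cf_num cs" "p = cf_den cs"
    and b0: "cf_brk cs 0 \<longleftrightarrow> p' < 2 * p"
    and nb: "\<not> (\<exists>i. 0 < i \<and> i \<le> sR \<and> cf_brk cs i)" and b: "b = side TR p' (kap sR)" and c: "c_rule p p' cs b TR c"
  shows "c = b + (if sR = 0 then sg TR else - sg TR)"
proof -
  define \<tau> where "\<tau> = cf_tau p p' cs"
  obtain c0 ys where cs: "cs = c0 # ys" using ne by (cases cs) auto
  \<comment> \<open>Equality would mean the (1, 2)-model, for which \<open>t = 0\<close> and there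
    is no admissible end height.\<close>
  have p2: "p' \<noteq> 2 * p"
  proof
    assume e: "p' = 2 * p"
    then have "p dvd p'" by simp
    then have "p dvd 1" using p by (metis coprime_common_divisor dvd_refl)
    then have "p' = 2" using e p by simp
    moreover have "p' = 2 * fst (fg (cf_brk cs) (1, 0) (cf_t cs)) + snd (fg (cf_brk cs) (1, 0) (cf_t cs))"
      unfolding fg_end pp(1) ..
    ultimately show False using fg_pos[of "cf_brk cs" "cf_t cs"] t0 by simp
  qed
  have num: "p' = int c0 * p + cf_den ys" unfolding pp cs cf_num_Cons cf_den_Cons ..
  have den: "0 \<le> cf_den xs" for xs by (rule gy_nonneg) simp_all
  have \<tau>: "int sR < \<tau> \<and> (p \<noteq> 1 \<longrightarrow> p \<noteq> p' - 1 \<longrightarrow> 2 * \<tau> < p')"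
  proof (cases "2 * p < p'")
    case True
    then have nb0: "\<not> cf_brk cs 0" and t: "\<tau> = cf_tk cs 1" using b0 by (auto simp: \<tau>_def cf_tau_def)
    have "cf_tk cs 0 < cf_tk cs 1" by (rule tk_less) (use cs in auto)
    then have "int sR < cf_tk cs 1"
      by (intro not_brk_tk[OF sR nb]) (use cs nb0 tk_0 in auto)
    moreover have "2 * cf_tk cs 1 < p'" if "p \<noteq> 1"
    proof -
      have "int c0 * 2 \<le> int c0 * p" using that p by (intro mult_left_mono) auto
      moreover have "cf_tk cs 1 = int c0 - 1" using tk_Suc[of 0] tk_0 cs by simp
      ultimately show ?thesis using num den[of ys] by linarith
    qed
    ultimately show ?thesis unfolding t by blast
  next
    case False
    then have br: "cf_brk cs 0" and t: "\<tau> = cf_tk cs 2" using b0 p2 by (auto simp: \<tau>_def cf_tau_def)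
    have l: "2 \<le> length cs" and t1: "cf_tk cs 1 = 0" using brk_0_tk[OF br] by auto
    obtain c1 zs where ys: "ys = c1 # zs" using l cs by (cases ys) auto
    have "cf_tk cs 1 < cf_tk cs 2" by (rule tk_less) (use l in auto)
    then have "int sR < cf_tk cs 2"
      by (intro not_brk_tk[OF sR nb]) (use l t1 in auto)
    moreover have "2 * cf_tk cs 2 < p'" if "p \<noteq> 1" "p \<noteq> p' - 1"
    proof -
      have c0: "int c0 = 1" using tk_Suc[of 0] tk_0 t1 cs by simp
      have B: "cf_den ys = p' - p" using num c0 by simp
      have "p = int c1 * (p' - p) + cf_den zs"
        using pp(2) B unfolding cs cf_den_Cons ys cf_num_Cons by simp
      moreover have "int c1 * 2 \<le> int c1 * (p' - p)" using that p by (intro mult_left_mono) auto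
      moreover have "cf_tk cs 2 = int c1" using tk_Suc[of 1] t1 cs ys by (simp add: numeral_2_eq_2)
      ultimately show ?thesis using den[of zs] that p by linarith
    qed
    ultimately show ?thesis unfolding t by blast
  qed
  have kap: "kap sR = int sR + 1" using fg_no_break[of sR] nb by auto
  show ?thesis
  proof (cases TR)
    case True
    have b': "b = int sR + 1" unfolding b kap using True by (simp add: side_def)
    show ?thesis using c \<tau> True unfolding c_rule_def Let_def \<tau>_def[symmetric] b'
      by (cases "sR = 0") (simp_all add: sg_def)
  next
    case False
    have b': "b = p' - int sR - 1" unfolding b kap using False by (simp add: side_def)
    have low: "\<not> ((p = 1 \<or> p = p' - 1 \<longrightarrow> TR) \<and> b = 1)" "\<not> ((p = 1 \<or> p = p' - 1 \<longrightarrow> TR) \<and> 1 < b \<and> b \<le> \<tau>)"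
      using \<tau> False b' by auto
    have "if b = p' - 1 then c = p' - 2 else if p' - \<tau> \<le> b \<and> b < p' - 1 then c = b + 1 else c = b + 1 \<or> c = b - 1"
      using c False low unfolding c_rule_def Let_def \<tau>_def[symmetric] by (simp only: if_False) simp
    then show ?thesis using \<tau> False b' by (cases "sR = 0") (simp_all add: sg_def)
  qed
qed

end

section \<open>Assembly over formal Laurent series\<close>

lemma generic_fls_X: "generic (fls_X :: 'a::field fls)"
  unfolding generic_def
proof (intro conjI allI impI)
  fix i :: nat assume "0 < i"
  then have "fls_subdegree ((fls_X :: 'a fls) ^ i) \<noteq> 0" by (simp add: fls_subdegree_fls_X_pow)
  then show "(fls_X :: 'a fls) ^ i \<noteq> 1" by (metis fls_one_subdegree)
qed simp

theorem theorem8p2: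
  fixes p p' a b c :: int and L :: nat and cs :: "nat list"
    and aT bT :: bool and \<sigma>L \<sigma>R :: nat
    and z q :: "rat fls"
    and uL uR :: "nat \<Rightarrow> int" and \<gamma> :: int
    and M :: "(nat \<Rightarrow> nat) set"
  assumes "1 \<le> p" and "p < p'" and "coprime p p'"
    and "is_cf cs (of_int p' / of_int p)"
    and "a \<in> Tak cs \<union> Tak' p' cs" and "b \<in> Tak cs \<union> Tak' p' cs"
    and "regarded p' cs a aT" and "regarded p' cs b bT"
    and "c_rule p p' cs b bT c"
    and "even (int L - (a - b))"
    and "\<sigma>L < cf_t cs" and "kappa cs \<sigma>L = (if aT then a else p' - a)"
    and "\<sigma>R < cf_t cs" and "kappa cs \<sigma>R = (if bT then b else p' - b)"
    and "z = fls_X" and "q = z ^ 4"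
    and "uL = uvec cs aT \<sigma>L" and "uR = uvec cs bT \<sigma>R"
    and "\<gamma> = gamma cs (Delta cs aT \<sigma>L) (Delta cs bT \<sigma>R)"
    and "M = msum_set cs (Qvec cs (\<lambda>j. uL j + uR j))"
  shows "finite {m \<in> M. fermi_term z cs L uL uR \<gamma> m \<noteq> 0} \<and>
         chi p p' a b c L q =
           (\<Sum>m | m \<in> M \<and> fermi_term z cs L uL uR \<gamma> m \<noteq> 0. fermi_term z cs L uL uR \<gamma> m)"
proof -
  interpret contfrac cs using assms(4) by unfold_locales (auto simp: is_cf_def)
  interpret cf_ladder cs \<sigma>L \<sigma>R aT bT by unfold_locales (use assms in auto)
  obtain P P' A B f where m: "model P P'" and b0: "cf_brk cs 0 \<longleftrightarrow> P' < 2 * P"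
    and P': "P' = 2 * fst (fg (cf_brk cs) (1, 0) (cf_t cs)) + snd (fg (cf_brk cs) (1, 0) (cf_t cs))"
    and P: "P = 2 * fst (fg (cf_brk cs) (0, 1) (cf_t cs)) + snd (fg (cf_brk cs) (0, 1) (cf_t cs))"
    and A: "A = side aT P' (kap \<sigma>L)" and B: "B = side bT P' (kap \<sigma>R)" and AB: "B - A = al 0"
    and info: "if \<exists>i. 0 < i \<and> i \<le> \<sigma>R \<and> cf_brk cs i then 2 \<le> B \<and> B \<le> P' - 2 \<and> odd_below P P' (B + 1) - odd_below P P' (B - 1) = 1
      else f = (if \<sigma>R = 0 then sg bT else - sg bT)"
    and f: "f = 1 \<or> f = - 1"
    and chi: "\<forall>z::rat fls. generic z \<longrightarrow> (\<forall>L. chi P P' A B (B + f) L (z ^ 4) = (\<Sum>m\<le>L + 1. Fpost 0 z L m))"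
    using ladder_chi[where ?'a = "rat fls"] by blast
  have num: "P' = cf_num cs" "P = cf_den cs" unfolding P' P fg_end by (rule refl)+
  \<comment> \<open>The climb and the hypothesis give two reduced fractions with the same value, the
    value of the continued fraction.\<close>
  have "p' = P' \<and> p = P"
  proof -
    have "\<forall>c\<in>set cs. 1 \<le> c" using nth_pos by (auto simp: in_set_conv_nth)
    then have "(of_int p' / of_int p :: rat) = of_int P' / of_int P" "0 < P'" "0 < P"
      using cf_val_quotient[OF ne] assms(4) unfolding num is_cf_def by auto
    then have "(of_int (p' * P) :: rat) = of_int (P' * p)" using assms(1) by (simp add: field_simps)
    then have "p' * P = P' * p" by (simp only: of_int_eq_iff)
    then have "\<bar>p'\<bar> * \<bar>P\<bar> = \<bar>P'\<bar> * \<bar>p\<bar>" by (simp only: abs_mult[symmetric])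
    moreover have "coprime p' p" "coprime P' P" using assms(3) m by (auto simp: model_def coprime_commute)
    ultimately have "\<bar>p'\<bar> = \<bar>P'\<bar>" "\<bar>P\<bar> = \<bar>p\<bar>" using coprime_crossproduct_int[of p' p P' P] by blast+
    then show ?thesis using assms(1,2) \<open>0 < P'\<close> \<open>0 < P\<close> by simp
  qed
  then have pP: "P' = p'" "P = p" by auto
  have kL: "kappa cs \<sigma>L = kap \<sigma>L" and kR: "kappa cs \<sigma>R = kap \<sigma>R" using kappa_eq assms by simp_all
  have a: "A = a" using assms(12) unfolding A pP side_def kL by (simp split: if_splits)
  have b: "B = b" using assms(14) unfolding B pP side_def kR by (simp split: if_splits)
  \<comment> \<open>Either \<open>b\<close> lies between an even and an odd band, where both
    neighbours give the same generating function, or the rule selects the very neighbour that the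
    climb has produced.\<close>
  have "chi p p' a b c L q = chi p p' a b (b + f) L q"
  proof (cases "\<exists>i. 0 < i \<and> i \<le> \<sigma>R \<and> cf_brk cs i")
    case True
    then have B: "2 \<le> b" "b \<le> p' - 2" "odd_below p p' (b + 1) - odd_below p p' (b - 1) = 1"
      using info unfolding pP b by simp_all
    have "c = b + 1 \<or> c = b - 1" using assms(9) B(1,2) unfolding c_rule_def Let_def by (auto split: if_splits)
    then show ?thesis
      using model.chi_boundary[OF m, unfolded pP, of b c "b + f"] B f by auto
  next
    case False
    have "c = b + f"
      using c_choice[OF assms(1-3), of b c] num b0 False B assms(9) info unfolding pP b by simp
    then show ?thesis by simp
  qed
  also have "\<dots> = (\<Sum>m\<le>L + 1. Fpost 0 z L m)"
    using chi generic_fls_X unfolding pP a b assms(15,16) by blast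
  finally have c: "chi p p' a b c L q = (\<Sum>m\<le>L + 1. Fpost 0 z L m)" .
  have "even (int L - al 0)"
  proof -
    have "int L - al 0 = (int L - (a - b)) + 2 * (a - b)" using AB unfolding a b by simp
    then show ?thesis using assms(10) by (metis dvd_add dvd_triv_left)
  qed
  then show ?thesis
    using fermionic_sum[of z L] generic_fls_X unfolding c assms(15,17,18,19,20) by blast
qed

end
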